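(* Consider the discrete memoryless wiretap channel with causal state information at the encoder and the legitimate decoder and secure rate-limited feedback at rate $R_f$ (as defined in the context). Then the secrecy capacity satisfies \[ C_S \ge \max\Big\{\max_{p(u|s)p(x|u,s)}\min\{I(U;Y|S)-I(U;Z|S)+H(S|Z)+R_f,\ I(U;Y|S)\},\ \max_{p(u)p(x|u,s)}\min\{H(S|Z,U)+R_f,\ I(U;Y|S)\}\Big\}, \] where $U$ is an auxiliary random variable; in the first maximum the joint distribution is $p(s)p(u|s)p(x|u,s)p(y,z|x,s)$ and in the second it is $p(s)p(u)p(x|u,s)p(y,z|x,s)$, with the distributions $p(u|s)$ (resp. $p(u)$) and $p(x|u,s)$ optimized.
   Context: Model: finite alphabets $\mathcal X,\mathcal Y,\mathcal Z,\mathcal S$. A state sequence $S^n$ is i.i.d. with distribution $p(s)$. The channel is memoryless: $p(y_i,z_i|x^i,y^{i-1},z^{i-1},s_i)=p(y_i,z_i|x_i,s_i)$; $Y$ is the legitimate receiver's (Bob's) output, $Z$ the eavesdropper's (Eve's) output. The state is known causally (i.e. $s^i$ at time $i$) to both the encoder and the legitimate decoder. A secure feedback link (not observed by Eve) from decoder to encoder carries symbols $K^f_i\in\mathcal K^f_i$, $i=1,\dots,n$, with $\frac1n\sum_{i=1}^n\log|\mathcal K^f_i|\le R_f$; $K^f_i$ is generated randomly according to $p(k^f_i|y^{i-1},k_f^{i-1})$, where $k_f^{i-1}=(k^f_1,\dots,k^f_{i-1})$. A $(2^{nR},2^{nR_f},n)$ code consists of a message set $\{1,\dots,2^{nR}\}$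 with message $M$ uniform on it, such feedback, a stochastic encoder $p(x_i|m,x^{i-1},s^i,k_f^i)$, and a decoder $\hat m:\mathcal Y^n\times\mathcal S^n\times\mathcal K^n_f\to\{1,\dots,2^{nR}\}$, $\hat M=\hat m(Y^n,S^n,K_f^n)$; $P_e^{(n)}=\Pr(\hat M\ne M)$. A rate $R$ is securely achievable (for feedback rate $R_f$) if for every $\varepsilon>0$ there exists a $(2^{nR},2^{nR_f},n)$ code with $H(M|Z^n)/H(M)\ge 1-\varepsilon$ and $P_e^{(n)}\le\varepsilon$. The secrecy capacity $C_S$ is the supremum of securely achievable rates. *)

theory Defs
  imports "HOL-Analysis.Analysis" "HOL-Library.Extended_Real"
begin

text \<open>A joint pmf P on a finite outcome set A; random variables are functions on outcomes.\<close>

definition prob_ev :: "('w \<Rightarrow> real) \<Rightarrow> 'w set \<Rightarrow> ('w \<Rightarrow> bool) \<Rightarrow> real" where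
  "prob_ev P A E = (\<Sum>w\<in>{w\<in>A. E w}. P w)"

definition centropy :: "('w \<Rightarrow> real) \<Rightarrow> 'w set \<Rightarrow> ('w \<Rightarrow> 'a) \<Rightarrow> ('w \<Rightarrow> 'b) \<Rightarrow> real" where
  "centropy P A f g =
     - (\<Sum>w\<in>A. P w * log 2 (prob_ev P A (\<lambda>v. f v = f w \<and> g v = g w)
                               / prob_ev P A (\<lambda>v. g v = g w)))"

definition cminfo :: "('w \<Rightarrow> real) \<Rightarrow> 'w set \<Rightarrow> ('w \<Rightarrow> 'a) \<Rightarrow> ('w \<Rightarrow> 'b) \<Rightarrow> ('w \<Rightarrow> 'c) \<Rightarrow> real" where
  "cminfo P A f g h = centropy P A f h - centropy P A f (\<lambda>w. (g w, h w))"

definition is_pmf :: "('a::finite \<Rightarrow> real) \<Rightarrow> bool" where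
  "is_pmf p \<longleftrightarrow> (\<forall>a. 0 \<le> p a) \<and> (\<Sum>a\<in>UNIV. p a) = 1"

text \<open>Time indices are 0,...,n-1.  ps: state pmf; W x s (y,z): channel.
  Feedback symbol k_i takes values in {0..<K i}, generated by fb i (y^{i-1}) (k^{i-1}) k_i.
  Encoder: enc i m (x^{i-1}) (s^i) (k^i) x_i.  Decoder: dec y^n s^n k^n.\<close>

definition lists_n :: "nat \<Rightarrow> 'a list set" where
  "lists_n n = {xs. length xs = n}"

definition fbseqs :: "nat \<Rightarrow> (nat \<Rightarrow> nat) \<Rightarrow> nat list set" where
  "fbseqs n K = {ks. length ks = n \<and> (\<forall>i<n. ks ! i < K i)}"

definition code_outcomes ::
  "nat \<Rightarrow> nat \<Rightarrow> (nat \<Rightarrow> nat) \<Rightarrow> (nat \<times> 's list \<times> nat list \<times> 'x list \<times> 'y list \<times> 'z list) set" where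
  "code_outcomes n Mn K =
     {0..<Mn} \<times> lists_n n \<times> fbseqs n K \<times> lists_n n \<times> lists_n n \<times> lists_n n"

definition code_pmf ::
  "('s \<Rightarrow> real) \<Rightarrow> ('x \<Rightarrow> 's \<Rightarrow> 'y \<times> 'z \<Rightarrow> real) \<Rightarrow> nat \<Rightarrow> nat
   \<Rightarrow> (nat \<Rightarrow> 'y list \<Rightarrow> nat list \<Rightarrow> nat \<Rightarrow> real)
   \<Rightarrow> (nat \<Rightarrow> nat \<Rightarrow> 'x list \<Rightarrow> 's list \<Rightarrow> nat list \<Rightarrow> 'x \<Rightarrow> real)
   \<Rightarrow> (nat \<times> 's list \<times> nat list \<times> 'x list \<times> 'y list \<times> 'z list) \<Rightarrow> real" where
  "code_pmf ps W n Mn fb enc = (\<lambda>(m, ss, ks, xs, ys, zs).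
     (1 / real Mn) *
     (\<Prod>i<n. ps (ss ! i)
             * fb i (take i ys) (take i ks) (ks ! i)
             * enc i m (take i xs) (take (Suc i) ss) (take (Suc i) ks) (xs ! i)
             * W (xs ! i) (ss ! i) (ys ! i, zs ! i)))"

definition valid_feedback :: "real \<Rightarrow> nat \<Rightarrow> (nat \<Rightarrow> nat)
    \<Rightarrow> (nat \<Rightarrow> 'y list \<Rightarrow> nat list \<Rightarrow> nat \<Rightarrow> real) \<Rightarrow> bool" where
  "valid_feedback Rf n K fb \<longleftrightarrow>
     (\<forall>i<n. 1 \<le> K i) \<and>
     (\<forall>i<n. \<forall>ys ks. (\<forall>k. 0 \<le> fb i ys ks k) \<and> (\<forall>k. K i \<le> k \<longrightarrow> fb i ys ks k = 0)
                     \<and> (\<Sum>k<K i. fb i ys ks k) = 1) \<and>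
     (\<Sum>i<n. log 2 (real (K i))) / real n \<le> Rf"

definition valid_encoder :: "nat \<Rightarrow> (nat \<Rightarrow> nat \<Rightarrow> 'x::finite list \<Rightarrow> 's list \<Rightarrow> nat list \<Rightarrow> 'x \<Rightarrow> real) \<Rightarrow> bool" where
  "valid_encoder n enc \<longleftrightarrow> (\<forall>i<n. \<forall>m xs ss ks. is_pmf (enc i m xs ss ks))"

definition num_messages :: "nat \<Rightarrow> real \<Rightarrow> nat" where
  "num_messages n R = nat \<lceil>2 powr (real n * R)\<rceil>"

text \<open>R securely achievable for feedback rate Rf.  The secrecy requirement
  H(M|Z^n)/H(M) \<ge> 1 - \<epsilon> is stated in multiplied-out form.\<close>
definition securely_achievable ::
  "('s::finite \<Rightarrow> real) \<Rightarrow> ('x::finite \<Rightarrow> 's \<Rightarrow> 'y::finite \<times> 'z::finite \<Rightarrow> real) \<Rightarrow> real \<Rightarrow> real \<Rightarrow> bool" where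
  "securely_achievable ps W Rf R \<longleftrightarrow> 0 \<le> R \<and>
     (\<forall>\<epsilon>>0. \<exists>n>0. \<exists>K fb enc (dec :: 'y list \<Rightarrow> 's list \<Rightarrow> nat list \<Rightarrow> nat).
        let Mn = num_messages n R;
            \<Omega> = (code_outcomes n Mn K :: (nat \<times> 's list \<times> nat list \<times> 'x list \<times> 'y list \<times> 'z list) set);
            P = code_pmf ps W n Mn fb enc
        in valid_feedback Rf n K fb \<and> valid_encoder n enc \<and>
           prob_ev P \<Omega> (\<lambda>(m, ss, ks, xs, ys, zs). dec ys ss ks \<noteq> m) \<le> \<epsilon> \<and>
           centropy P \<Omega> (\<lambda>(m, ss, ks, xs, ys, zs). m) (\<lambda>(m, ss, ks, xs, ys, zs). zs)
             \<ge> (1 - \<epsilon>) * centropy P \<Omega> (\<lambda>(m, ss, ks, xs, ys, zs). m) (\<lambda>_. ()))"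

definition secrecy_capacity ::
  "('s::finite \<Rightarrow> real) \<Rightarrow> ('x::finite \<Rightarrow> 's \<Rightarrow> 'y::finite \<times> 'z::finite \<Rightarrow> real) \<Rightarrow> real \<Rightarrow> ereal" where
  "secrecy_capacity ps W Rf = Sup (ereal ` {R. securely_achievable ps W Rf R})"

definition sl_pmf :: "('s \<Rightarrow> real) \<Rightarrow> ('s \<Rightarrow> 'u \<Rightarrow> real) \<Rightarrow> ('u \<Rightarrow> 's \<Rightarrow> 'x \<Rightarrow> real)
    \<Rightarrow> ('x \<Rightarrow> 's \<Rightarrow> 'y \<times> 'z \<Rightarrow> real) \<Rightarrow> ('s \<times> 'u \<times> 'x \<times> 'y \<times> 'z) \<Rightarrow> real" where
  "sl_pmf ps pu px W = (\<lambda>(s, u, x, y, z). ps s * pu s u * px u s x * W x s (y, z))"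

definition rvS :: "'s \<times> 'u \<times> 'x \<times> 'y \<times> 'z \<Rightarrow> 's" where "rvS = (\<lambda>(s,u,x,y,z). s)"
definition rvU :: "'s \<times> 'u \<times> 'x \<times> 'y \<times> 'z \<Rightarrow> 'u" where "rvU = (\<lambda>(s,u,x,y,z). u)"
definition rvY :: "'s \<times> 'u \<times> 'x \<times> 'y \<times> 'z \<Rightarrow> 'y" where "rvY = (\<lambda>(s,u,x,y,z). y)"
definition rvZ :: "'s \<times> 'u \<times> 'x \<times> 'y \<times> 'z \<Rightarrow> 'z" where "rvZ = (\<lambda>(s,u,x,y,z). z)"

end

theory Submission
  imports Defs
begin

text \<open>
The decoder uses the feedback link only to send, at time 0, a uniform secret key of rate
\<open>Rf\<close>.  Replacing \<open>U\<close> by a Shannon strategy \<open>T : S \<rightarrow> U\<close> that is independent of the state, both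
bounds reduce to showing that every \<open>R < I(T;Y,S)\<close> with \<open>R \<le> H(S|Z,T) + Rf\<close> or
\<open>R < I(T;Y,S) - I(T;Z) + H(S|Z,T) + Rf\<close> is achievable.

Transmission takes place in \<open>B\<close> blocks of length \<open>n\<close>, all using the same random codebook and the
same random hash \<open>g\<close>.  The codeword index in a block is \<open>(m1, m2 + g(s, k), d)\<close>, where \<open>(m1, m2)\<close>
is the message of the block, \<open>d\<close> is private randomness, \<open>s\<close> is the state sequence of the previous
block and \<open>k\<close> a fresh piece of the feedback key.  As \<open>m2\<close> is uniform, so is the index,
independently of everything before the block.  Giving Eve the index and the output of a block once
it is over bounds her information about the next one by two terms: a covering term
(\<open>m1\<close> is hidden because \<open>(m2, d)\<close> has rate at least \<open>I(T;Z)\<close>) and a key term (\<open>m2\<close> is hidden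
because the hash is nearly uniform given the index and the output).  Both random-coding
expectations reduce to \<open>E log (1 + c f)\<close> for an i.i.d. product \<open>f\<close> via the tangent line
of the logarithm, which needs only pairwise independence; they are \<open>o(n)\<close>
by second moments.  The first block has no previous state and may leak completely, a fraction
\<open>1/B\<close> of the message.
\<close>

section \<open>Finite words and stochastic realization of a mixture of strategies\<close>

text \<open>The first bound rests on an identity: for \<open>T\<close> independent of
  \<open>S\<close>, I(T;Y,S) = I(T;Y|S) and H(S|Z,T) - I(T;Z) = H(S|Z) - I(T;Z|S). The right-hand
  sides involve only the letter that \<open>T\<close> assigns to the actual state, so any coupling
  of the letters of different states will do. H(S|Z,T) by itself does depend on the coupling; the
  second bound therefore takes \<open>U\<close> itself as a constant strategy. The two rate
  conditions come from the split of R. Above H(S|Z,T) + Rf, m2 takes the whole key rate, m1 the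
  rest, and \<open>d\<close> is just large enough to fill (m2, d) up to I(T;Z). Below it everything
  is padded, m1 is trivial and nothing has to be covered. Past blocks bear on later ones only
  through the last state. Given the index and the output, its law is a posterior, so the leakage is
  bounded by induction over the blocks for an arbitrary law of the initial state. The number of
  blocks is fixed first, from \<open>\<epsilon>\<close> alone; only then does \<open>n\<close> grow,
  which is why o(n) bounds per block suffice.\<close>

definition words :: "'a set \<Rightarrow> nat \<Rightarrow> 'a list set" where
  "words A n = {xs. set xs \<subseteq> A \<and> length xs = n}"

lemma lists_n_words: "lists_n n = words UNIV n"
  by (auto simp: lists_n_def words_def)

lemma words_0 [simp]: "words A 0 = {[]}"
  by (auto simp: words_def)

lemma words_Suc: "words A (Suc n) = (\<lambda>(x, xs). x # xs) ` (A \<times> words A n)"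
  by (auto simp: words_def image_iff length_Suc_conv)

lemma finite_words [simp]: "finite A \<Longrightarrow> finite (words A n)"
  unfolding words_def by (rule finite_lists_length_eq)

lemma card_words: "finite A \<Longrightarrow> card (words A n) = card A ^ n"
  unfolding words_def by (rule card_lists_length_eq)

lemma sum_words_Suc: "sum F (words A (Suc n)) = (\<Sum>x\<in>A. \<Sum>xs\<in>words A n. F (x # xs))"
proof -
  have "inj_on (\<lambda>(x, xs). x # xs) (A \<times> words A n)" by (auto simp: inj_on_def)
  then show ?thesis
    by (simp add: words_Suc sum.reindex sum.cartesian_product case_prod_unfold)
qed

lemma sum_words_append: "sum F (words A (n + k)) = (\<Sum>a\<in>words A n. \<Sum>b\<in>words A k. F (a @ b))"
  by (induction n arbitrary: F) (simp_all add: sum_words_Suc)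

lemma sum_prod_words:
  fixes f :: "nat \<Rightarrow> 'a \<Rightarrow> 'b::comm_semiring_1"
  shows "(\<Sum>xs\<in>words A n. \<Prod>i<n. f i (xs ! i)) = (\<Prod>i<n. \<Sum>a\<in>A. f i a)"
proof (induction n arbitrary: f)
  case (Suc n)
  have "(\<Sum>xs\<in>words A (Suc n). \<Prod>i<Suc n. f i (xs ! i))
      = (\<Sum>x\<in>A. f 0 x * (\<Sum>xs\<in>words A n. \<Prod>i<n. f (Suc i) (xs ! i)))"
    by (simp add: sum_words_Suc prod.lessThan_Suc_shift sum_distrib_left del: prod.lessThan_Suc)
  also have "\<dots> = (\<Prod>i<Suc n. \<Sum>a\<in>A. f i a)"
    unfolding Suc[of "\<lambda>i. f (Suc i)"]
    by (simp add: prod.lessThan_Suc_shift sum_distrib_right del: prod.lessThan_Suc)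
  finally show ?case .
qed simp

text \<open>The state is drawn inside the law: a fixed strategy word \<open>ts\<close> is the input
  of a memoryless channel whose output letter is (s, y, z).\<close>

definition memoryless_law :: "('s \<Rightarrow> real) \<Rightarrow> ('t \<Rightarrow> 's \<Rightarrow> 'y \<times> 'z \<Rightarrow> real) \<Rightarrow>
    't list \<Rightarrow> 's list \<Rightarrow> 'y list \<Rightarrow> 'z list \<Rightarrow> real" where
  "memoryless_law ps v ts ss ys zs = (\<Prod>i<length ss. ps (ss ! i) * v (ts ! i) (ss ! i) (ys ! i, zs ! i))"

definition compose_channel :: "('t \<Rightarrow> 's \<Rightarrow> 'x::finite \<Rightarrow> real) \<Rightarrow> ('x \<Rightarrow> 's \<Rightarrow> 'o \<Rightarrow> real) \<Rightarrow>
    't \<Rightarrow> 's \<Rightarrow> 'o \<Rightarrow> real" where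
  "compose_channel px W t s o' = (\<Sum>x\<in>UNIV. px t s x * W x s o')"

text \<open>Replaces sequential feedback and encoding by a mixture: a key uniform on
  \<open>K0\<close> values, a private seed uniform on \<open>D\<close>, and strategy words sent
  through the averaged channel. Since \<open>\<phi>\<close> is arbitrary, the one identity yields
  both the error probability and the joint law of message and \<open>Z\<close>. The word at time
  \<open>i\<close> may look only at states before \<open>i\<close>; the current state enters through
  \<open>px\<close>.\<close>

lemma realization:
  fixes ps :: "'s::finite \<Rightarrow> real"
    and W :: "'x::finite \<Rightarrow> 's \<Rightarrow> 'y::finite \<times> 'z::finite \<Rightarrow> real"
    and px :: "'t \<Rightarrow> 's \<Rightarrow> 'x \<Rightarrow> real"
    and cw :: "nat \<Rightarrow> 'd \<Rightarrow> nat \<Rightarrow> 's list \<Rightarrow> 't list"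
  assumes px: "\<And>t s. is_pmf (px t s)"
    and D: "finite D" "D \<noteq> {}" and n: "0 < n" and K0: "1 \<le> K0" "log 2 (real K0) \<le> real n * Rf"
    and causal: "\<And>m d k ss ss' i. i < n \<Longrightarrow> take i ss = take i ss' \<Longrightarrow> cw m d k ss ! i = cw m d k ss' ! i"
  shows "\<exists>K (fb :: nat \<Rightarrow> 'y list \<Rightarrow> nat list \<Rightarrow> nat \<Rightarrow> real)
      (enc :: nat \<Rightarrow> nat \<Rightarrow> 'x list \<Rightarrow> 's list \<Rightarrow> nat list \<Rightarrow> 'x \<Rightarrow> real).
    valid_feedback Rf n K fb \<and> valid_encoder n enc \<and>
    (\<forall>Mn \<phi>. (\<Sum>w\<in>code_outcomes n Mn K. code_pmf ps W n Mn fb enc w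
              * (case w of (m, ss, ks, xs, ys, zs) \<Rightarrow> \<phi> m ss ks ys zs))
          = (\<Sum>m<Mn. \<Sum>k<K0. \<Sum>d\<in>D. \<Sum>ss\<in>words UNIV n. \<Sum>ys\<in>words UNIV n. \<Sum>zs\<in>words UNIV n.
              1 / (real Mn * real K0 * real (card D))
              * memoryless_law ps (compose_channel px W) (cw m d k ss) ss ys zs
              * \<phi> m ss (k # replicate (n - 1) 0) ys zs))"
proof -
  \<comment> \<open>The whole key budget goes into the first symbol; each later symbol has a
    one-element alphabet and costs log 1 = 0.\<close>
  define K :: "nat \<Rightarrow> nat" where "K i = (if i = 0 then K0 else 1)" for i
  define fb :: "nat \<Rightarrow> 'y list \<Rightarrow> nat list \<Rightarrow> nat \<Rightarrow> real" where
    "fb i ys ks k = (if k < K i then 1 / real (K i) else 0)" for i ys ks k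
  define G :: "nat \<Rightarrow> 'x list \<Rightarrow> 's list \<Rightarrow> nat \<Rightarrow> real" where
    "G m xs ss k = (\<Sum>d\<in>D. \<Prod>i<length xs. px (cw m d k ss ! i) (ss ! i) (xs ! i)) / real (card D)"
    for m xs ss k
  define enc :: "nat \<Rightarrow> nat \<Rightarrow> 'x list \<Rightarrow> 's list \<Rightarrow> nat list \<Rightarrow> 'x \<Rightarrow> real" where
    "enc i m xs ss ks x = (let T = (\<Sum>x'\<in>UNIV. G m (xs @ [x']) ss (hd ks)) in
        if T > 0 then G m (xs @ [x]) ss (hd ks) / T else 1 / real CARD('x))" for i m xs ss ks x
  \<comment> \<open>The encoder does not remember \<open>d\<close>: it samples \<open>x\<close> from the conditional law of the mixture, the ratio
      of \<open>G\<close> at consecutive prefixes, which only involves states already seen.\<close>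
  have Kpos: "0 < K i" "K i \<noteq> 0" for i using K0 by (simp_all add: K_def)
  have pxn: "0 \<le> px t s x" and pxs: "(\<Sum>x\<in>UNIV. px t s x) = 1" for t s x
    using px by (auto simp: is_pmf_def)
  have Gn: "0 \<le> G m xs ss k" for m xs ss k
    unfolding G_def by (intro divide_nonneg_nonneg sum_nonneg prod_nonneg) (auto simp: pxn)
  have cD: "real (card D) > 0" using D by (simp add: card_gt_0_iff)
  have "(\<Sum>i<n. log 2 (real (K i))) = log 2 (real K0)"
    using n by (cases n) (simp_all add: K_def sum.lessThan_Suc_shift del: sum.lessThan_Suc)
  moreover have "(\<Sum>k<K i. fb i ys ks k) = 1" for i ys ks
    by (simp add: fb_def Kpos)
  ultimately have vf: "valid_feedback Rf n K fb"
    using K0 n unfolding valid_feedback_def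
    by (auto simp: field_simps Suc_le_eq Kpos) (auto simp: fb_def)
  have ve: "valid_encoder n enc"
    unfolding valid_encoder_def is_pmf_def
  proof (intro allI impI conjI)
    fix i m xs ss ks x
    show "0 \<le> enc i m xs ss ks x" by (simp add: enc_def Let_def Gn)
    show "(\<Sum>a\<in>UNIV. enc i m xs ss ks a) = 1"
      by (cases "0 < (\<Sum>x'\<in>UNIV. G m (xs @ [x']) ss (hd ks))")
        (simp_all add: enc_def Let_def flip: sum_divide_distrib)
  qed
  \<comment> \<open>Consistency of the prefix laws: the denominator \<open>T\<close> in
    \<open>enc\<close> is \<open>G\<close> of the shorter prefix, which is what makes the product of
    the ratios telescope.\<close>
  have Gsum: "(\<Sum>x\<in>UNIV. G m (xs @ [x]) ss k) = G m xs ss k" for m xs ss k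
  proof -
    have "(\<Sum>x\<in>UNIV. \<Sum>d\<in>D. \<Prod>i<Suc (length xs). px (cw m d k ss ! i) (ss ! i) ((xs @ [x]) ! i))
        = (\<Sum>d\<in>D. \<Sum>x\<in>UNIV. (\<Prod>i<length xs. px (cw m d k ss ! i) (ss ! i) (xs ! i))
              * px (cw m d k ss ! length xs) (ss ! length xs) x)"
      by (subst sum.swap) (auto simp: nth_append intro!: sum.cong)
    also have "\<dots> = (\<Sum>d\<in>D. \<Prod>i<length xs. px (cw m d k ss ! i) (ss ! i) (xs ! i))"
      by (simp add: pxs flip: sum_distrib_left)
    finally show ?thesis by (simp add: G_def flip: sum_divide_distrib)
  qed
  have Gcausal: "G m xs (take (Suc j) ss) k = G m xs ss k" if "length xs \<le> Suc j" "Suc j \<le> n" for m xs j ss k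
  proof -
    have "cw m d k (take (Suc j) ss) ! i = cw m d k ss ! i" if "i < length xs" for d i
      using that \<open>length xs \<le> Suc j\<close> \<open>Suc j \<le> n\<close> by (intro causal) (auto simp: min_def)
    then show ?thesis using that unfolding G_def by (auto intro!: sum.cong prod.cong)
  qed
  have tele: "(\<Prod>i<j. enc i m (take i xs) (take (Suc i) ss) (take (Suc i) ks) (xs ! i)) = G m (take j xs) ss (ks ! 0)"
    if "length xs = n" "length ks = n" "j \<le> n" for m xs ss ks j
    using that(3)
  proof (induction j)
    case 0
    show ?case using cD by (simp add: G_def)
  next
    case (Suc j)
    have hd: "hd ks = ks ! 0" using that n by (cases ks) auto
    have tk: "take j xs @ [xs ! j] = take (Suc j) xs"
      using that Suc.prems by (simp add: take_Suc_conv_app_nth)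
    have T: "(\<Sum>x'\<in>UNIV. G m (take j xs @ [x']) (take (Suc j) ss) (ks ! 0)) = G m (take j xs) ss (ks ! 0)"
      using Suc.prems that by (simp add: Gcausal Gsum)
    have G1: "G m (take (Suc j) xs) (take (Suc j) ss) (ks ! 0) = G m (take (Suc j) xs) ss (ks ! 0)"
      using Suc.prems that by (intro Gcausal) auto
    have e: "enc j m (take j xs) (take (Suc j) ss) (take (Suc j) ks) (xs ! j)
      = (if G m (take j xs) ss (ks ! 0) > 0 then G m (take (Suc j) xs) ss (ks ! 0) / G m (take j xs) ss (ks ! 0)
         else 1 / real CARD('x))"
      by (simp add: enc_def Let_def T hd tk G1)
    show ?case
    proof (cases "G m (take j xs) ss (ks ! 0) > 0")
      case True
      then show ?thesis using Suc by (simp add: e)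
    next
      \<comment> \<open>A prefix without mass has no extension with mass, so both sides vanish and
        the uniform default of \<open>enc\<close> does not show.\<close>
      case False
      then have z: "G m (take j xs) ss (ks ! 0) = 0" using Gn[of m "take j xs" ss "ks ! 0"] by linarith
      then have "(\<Sum>x'\<in>UNIV. G m (take j xs @ [x']) ss (ks ! 0)) = 0" by (simp add: Gsum)
      then have "G m (take j xs @ [xs ! j]) ss (ks ! 0) = 0"
        by (subst (asm) sum_nonneg_eq_0_iff) (auto simp: Gn)
      then show ?thesis using Suc z by (simp add: tk)
    qed
  qed
  have fbs: "fbseqs n K = (\<lambda>k. k # replicate (n - 1) 0) ` {..<K0}"
  proof (intro equalityI subsetI)
    fix ks assume "ks \<in> fbseqs n K"
    then have l: "length ks = n" and b: "\<And>i. i < n \<Longrightarrow> ks ! i < K i" by (auto simp: fbseqs_def)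
    have "ks = (ks ! 0) # replicate (n - 1) 0"
    proof (rule nth_equalityI)
      show "length ks = length (ks ! 0 # replicate (n - 1) 0)" using l n by simp
      fix i assume "i < length ks"
      then show "ks ! i = (ks ! 0 # replicate (n - 1) 0) ! i"
        using b[of i] l by (cases i) (auto simp: K_def)
    qed
    moreover have "ks ! 0 < K0" using b[of 0] n by (simp add: K_def)
    ultimately show "ks \<in> (\<lambda>k. k # replicate (n - 1) 0) ` {..<K0}" by blast
  next
    fix ks assume "ks \<in> (\<lambda>k. k # replicate (n - 1) 0) ` {..<K0}"
    then show "ks \<in> fbseqs n K" using n by (auto simp: fbseqs_def K_def nth_Cons split: nat.splits)
  qed
  have pfb: "(\<Prod>i<n. fb i (take i ys) (take i ks) (ks ! i)) = 1 / real K0" if "ks \<in> fbseqs n K" for ys ks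
  proof -
    have "(\<Prod>i<n. fb i (take i ys) (take i ks) (ks ! i)) = (\<Prod>i<n. 1 / real (K i))"
      using that by (intro prod.cong) (auto simp: fb_def fbseqs_def)
    also have "\<dots> = 1 / real K0"
      using n by (cases n) (simp_all add: K_def prod.lessThan_Suc_shift del: prod.lessThan_Suc)
    finally show ?thesis .
  qed
  have inner: "(\<Sum>xs\<in>words UNIV n. code_pmf ps W n Mn fb enc (m, ss, k # replicate (n - 1) 0, xs, ys, zs))
      = (\<Sum>d\<in>D. 1 / (real Mn * real K0 * real (card D)) * memoryless_law ps (compose_channel px W) (cw m d k ss) ss ys zs)"
    if "length ss = n" "k < K0" for Mn m ss k ys zs
  proof -
    let ?ks = "k # replicate (n - 1) 0"
    have ks: "?ks \<in> fbseqs n K" "length ?ks = n" using that n by (auto simp: fbs)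
    have 1: "code_pmf ps W n Mn fb enc (m, ss, ?ks, xs, ys, zs)
       = (\<Sum>d\<in>D. 1 / (real Mn * real K0 * real (card D)) *
           (\<Prod>i<n. ps (ss ! i) * (px (cw m d k ss ! i) (ss ! i) (xs ! i) * W (xs ! i) (ss ! i) (ys ! i, zs ! i))))"
      if "xs \<in> words UNIV n" for xs
    proof -
      have len: "length xs = n" using that by (simp add: words_def)
      have "code_pmf ps W n Mn fb enc (m, ss, ?ks, xs, ys, zs)
        = 1 / real Mn * ((\<Prod>i<n. ps (ss ! i)) * (1 / real K0)
           * G m xs ss k * (\<Prod>i<n. W (xs ! i) (ss ! i) (ys ! i, zs ! i)))"
        using tele[OF len ks(2), of n m ss] pfb[OF ks(1), of ys] len
        by (simp add: code_pmf_def prod.distrib)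
      also have "\<dots> = (\<Sum>d\<in>D. 1 / (real Mn * real K0 * real (card D)) *
           (\<Prod>i<n. ps (ss ! i) * (px (cw m d k ss ! i) (ss ! i) (xs ! i) * W (xs ! i) (ss ! i) (ys ! i, zs ! i))))"
        by (simp add: G_def len prod.distrib sum_distrib_left sum_distrib_right sum_divide_distrib mult_ac)
      finally show ?thesis .
    qed
    have "(\<Sum>xs\<in>words UNIV n. code_pmf ps W n Mn fb enc (m, ss, ?ks, xs, ys, zs))
      = (\<Sum>d\<in>D. \<Sum>xs\<in>words UNIV n. 1 / (real Mn * real K0 * real (card D)) *
           (\<Prod>i<n. ps (ss ! i) * (px (cw m d k ss ! i) (ss ! i) (xs ! i) * W (xs ! i) (ss ! i) (ys ! i, zs ! i))))"
      by (subst sum.swap) (intro sum.cong refl 1)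
    also have "\<dots> = (\<Sum>d\<in>D. 1 / (real Mn * real K0 * real (card D)) *
       (\<Prod>i<n. \<Sum>x\<in>UNIV. ps (ss ! i) * (px (cw m d k ss ! i) (ss ! i) x * W x (ss ! i) (ys ! i, zs ! i))))"
      by (simp add: sum_prod_words[symmetric] sum_distrib_left)
    also have "\<dots> = (\<Sum>d\<in>D. 1 / (real Mn * real K0 * real (card D)) * memoryless_law ps (compose_channel px W) (cw m d k ss) ss ys zs)"
      by (simp add: memoryless_law_def compose_channel_def that sum_distrib_left)
    finally show ?thesis .
  qed
  have main: "(\<Sum>w\<in>code_outcomes n Mn K. code_pmf ps W n Mn fb enc w
              * (case w of (m, ss, ks, xs, ys, zs) \<Rightarrow> \<phi> m ss ks ys zs))
          = (\<Sum>m<Mn. \<Sum>k<K0. \<Sum>d\<in>D. \<Sum>ss\<in>words UNIV n. \<Sum>ys\<in>words UNIV n. \<Sum>zs\<in>words UNIV n.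
              1 / (real Mn * real K0 * real (card D))
              * memoryless_law ps (compose_channel px W) (cw m d k ss) ss ys zs
              * \<phi> m ss (k # replicate (n - 1) 0) ys zs)" for Mn \<phi>
  proof -
    let ?key = "\<lambda>k. k # replicate (n - 1) (0::nat)"
    let ?c = "code_pmf ps W n Mn fb enc"
    let ?N = "1 / (real Mn * real K0 * real (card D))"
    have inj: "inj_on ?key {..<K0}" by (auto simp: inj_on_def)
    have "(\<Sum>w\<in>code_outcomes n Mn K. ?c w * (case w of (m, ss, ks, xs, ys, zs) \<Rightarrow> \<phi> m ss ks ys zs))
       = (\<Sum>m<Mn. \<Sum>ss\<in>words UNIV n. \<Sum>k<K0. \<Sum>xs\<in>words UNIV n. \<Sum>ys\<in>words UNIV n. \<Sum>zs\<in>words UNIV n.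
            ?c (m, ss, ?key k, xs, ys, zs) * \<phi> m ss (?key k) ys zs)"
      unfolding code_outcomes_def lists_n_words fbs
      by (simp add: sum.cartesian_product' atLeast0LessThan sum.reindex[OF inj] del: One_nat_def)
    also have "\<dots> = (\<Sum>m<Mn. \<Sum>ss\<in>words UNIV n. \<Sum>k<K0. \<Sum>ys\<in>words UNIV n. \<Sum>zs\<in>words UNIV n. \<Sum>xs\<in>words UNIV n. 
            ?c (m, ss, ?key k, xs, ys, zs) * \<phi> m ss (?key k) ys zs)"
      by (simp add: sum.swap[of _ "words UNIV n :: 'z list set" "words UNIV n :: 'x list set"]
          sum.swap[of _ "words UNIV n :: 'y list set" "words UNIV n :: 'x list set"])
    also have "\<dots> = (\<Sum>m<Mn. \<Sum>ss\<in>words UNIV n. \<Sum>k<K0. \<Sum>ys\<in>words UNIV n. \<Sum>zs\<in>words UNIV n. \<Sum>d\<in>D.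
            ?N * memoryless_law ps (compose_channel px W) (cw m d k ss) ss ys zs * \<phi> m ss (?key k) ys zs)"
    proof (intro sum.cong refl, goal_cases)
      case (1 m ss k ys zs)
      then have "length ss = n" "k < K0" by (auto simp: words_def)
      from inner[OF this, of Mn m ys zs] show ?case
        by (simp only: flip: sum_distrib_right)
    qed
    also have "\<dots> = (\<Sum>m<Mn. \<Sum>k<K0. \<Sum>ss\<in>words UNIV n. \<Sum>ys\<in>words UNIV n. \<Sum>zs\<in>words UNIV n. \<Sum>d\<in>D.
            ?N * memoryless_law ps (compose_channel px W) (cw m d k ss) ss ys zs * \<phi> m ss (?key k) ys zs)"
      by (intro sum.cong refl) (rule sum.swap)
    also have "\<dots> = (\<Sum>m<Mn. \<Sum>k<K0. \<Sum>d\<in>D. \<Sum>ss\<in>words UNIV n. \<Sum>ys\<in>words UNIV n. \<Sum>zs\<in>words UNIV n. 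
            ?N * memoryless_law ps (compose_channel px W) (cw m d k ss) ss ys zs * \<phi> m ss (?key k) ys zs)"
      by (simp add: sum.swap[of _ D "words UNIV n :: 'z list set"]
          sum.swap[of _ D "words UNIV n :: 'y list set"] sum.swap[of _ D "words UNIV n :: 's list set"])
    finally show ?thesis .
  qed
  show ?thesis using vf ve main by blast
qed

section \<open>Divergence of a block code\<close>

lemma length_words: "xs \<in> words A n \<Longrightarrow> length xs = n"
  by (simp add: words_def)

text \<open>Concavity. In the random-coding bounds \<open>c\<close> is an upper bound on a mean of
  \<open>x\<close>, so that the linear term averages to something nonpositive.\<close>

lemma log2_le_tangent:
  fixes x c :: real
  assumes "0 < x" "0 < c"
  shows "log 2 x \<le> log 2 c + (x / c - 1) / ln 2"
proof -
  have "ln (x / c) \<le> x / c - 1" using assms by (intro ln_le_minus_one) simp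
  then have "ln x \<le> ln c + (x / c - 1)" using assms by (simp add: ln_div)
  then show ?thesis by (simp add: log_def divide_right_mono flip: add_divide_distrib)
qed

text \<open>Take the tangent of the logarithm at each \<open>u i / r i\<close>, evaluate it at the
  ratio of the totals and weight it by \<open>u i\<close>: the linear terms add up to zero.\<close>

lemma log_sum_inequality:
  fixes u r :: "'i \<Rightarrow> real"
  assumes "finite I" and u: "\<And>i. i \<in> I \<Longrightarrow> 0 \<le> u i" and r: "\<And>i. i \<in> I \<Longrightarrow> 0 \<le> r i"
    and ur: "\<And>i. i \<in> I \<Longrightarrow> r i = 0 \<Longrightarrow> u i = 0"
  shows "(\<Sum>i\<in>I. u i) * log 2 ((\<Sum>i\<in>I. u i) / (\<Sum>i\<in>I. r i)) \<le> (\<Sum>i\<in>I. u i * log 2 (u i / r i))"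
proof (cases "(\<Sum>i\<in>I. u i) = 0")
  case True
  then have "\<And>i. i \<in> I \<Longrightarrow> u i = 0" using u \<open>finite I\<close> by (simp add: sum_nonneg_eq_0_iff)
  then show ?thesis by simp
next
  case False
  define U where "U = (\<Sum>i\<in>I. u i)"
  define Rs where "Rs = (\<Sum>i\<in>I. r i)"
  have U: "U > 0" using False u unfolding U_def by (simp add: sum_nonneg order_less_le)
  have Rs: "Rs > 0"
  proof -
    have "Rs \<ge> 0" using r unfolding Rs_def by (simp add: sum_nonneg)
    moreover have "Rs \<noteq> 0"
    proof
      assume "Rs = 0"
      then have "\<And>i. i \<in> I \<Longrightarrow> r i = 0" using r \<open>finite I\<close> unfolding Rs_def by (simp add: sum_nonneg_eq_0_iff)
      then have "U = 0" using ur unfolding U_def by simp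
      then show False using U by simp
    qed
    ultimately show ?thesis by simp
  qed
  have pt: "u i * log 2 (U / Rs) + (u i - U * r i / Rs) / ln 2 \<le> u i * log 2 (u i / r i)" if "i \<in> I" for i
  proof (cases "u i = 0")
    case True
    then show ?thesis using r[OF that] U Rs by (simp add: divide_nonneg_nonneg)
  next
    case False
    then have ui: "u i > 0" using u[OF that] by simp
    have ri: "r i > 0" using False ur[OF that] r[OF that] by (metis order_le_less)
    have "log 2 (U / Rs) \<le> log 2 (u i / r i) + (U / Rs / (u i / r i) - 1) / ln 2"
      using U Rs ui ri by (intro log2_le_tangent) auto
    then have "u i * log 2 (U / Rs) \<le> u i * (log 2 (u i / r i) + (U / Rs / (u i / r i) - 1) / ln 2)"
      using ui by (intro mult_left_mono) auto
    also have "\<dots> = u i * log 2 (u i / r i) + (U * r i / Rs - u i) / ln 2"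
      using ui ri Rs by (simp add: field_simps)
    finally show ?thesis by (simp add: diff_divide_distrib)
  qed
  have "U * log 2 (U / Rs) = (\<Sum>i\<in>I. u i * log 2 (U / Rs) + (u i - U * r i / Rs) / ln 2)"
  proof -
    have "(\<Sum>i\<in>I. U * r i / Rs) = U"
      using Rs by (simp add: Rs_def[symmetric] flip: sum_distrib_left sum_divide_distrib)
    then have "(\<Sum>i\<in>I. (u i - U * r i / Rs) / ln 2) = 0"
      by (simp add: sum_subtractf U_def[symmetric] flip: sum_divide_distrib)
    then show ?thesis by (simp add: sum.distrib U_def[symmetric] flip: sum_distrib_right)
  qed
  also have "\<dots> \<le> (\<Sum>i\<in>I. u i * log 2 (u i / r i))" by (intro sum_mono pt)
  finally show ?thesis by (simp add: U_def Rs_def)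
qed

lemma KL_nonneg:
  fixes u r :: "'i \<Rightarrow> real"
  assumes "finite I" and u: "\<And>i. i \<in> I \<Longrightarrow> 0 \<le> u i" and r: "\<And>i. i \<in> I \<Longrightarrow> 0 \<le> r i"
    and ur: "\<And>i. i \<in> I \<Longrightarrow> r i = 0 \<Longrightarrow> u i = 0"
    and "(\<Sum>i\<in>I. u i) = 1" "(\<Sum>i\<in>I. r i) = 1"
  shows "0 \<le> (\<Sum>i\<in>I. u i * log 2 (u i / r i))"
  using log_sum_inequality[of I u r] assms by simp

text \<open>Translation permutes the residues modulo \<open>q\<close>; this is what makes a padded
  uniform symbol uniform.\<close>

lemma sum_mod_shift:
  fixes c q :: nat
  assumes "0 < q"
  shows "(\<Sum>m<q. F ((m + c) mod q)) = (\<Sum>a<q. F a)"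
proof -
  have inj: "inj_on (\<lambda>m. (m + c) mod q) {..<q}"
  proof (rule inj_onI)
    fix x y assume xy: "x \<in> {..<q}" "y \<in> {..<q}" "(x + c) mod q = (y + c) mod q"
    have 1: "x = y" if "x \<le> y" "(x + c) mod q = (y + c) mod q" "x < q" "y < q" for x y
    proof -
      have "q dvd (y + c) - (x + c)" using that mod_eq_dvd_iff_nat[of "x + c" "y + c" q] by simp
      then have "q dvd y - x" by simp
      then show ?thesis using that nat_dvd_not_less[of "y - x" q] by linarith
    qed
    show "x = y" using xy 1[of x y] 1[of y x] by (cases "x \<le> y") auto
  qed
  then have "bij_betw (\<lambda>m. (m + c) mod q) {..<q} {..<q}"
    using assms by (intro bij_betw_imageI[OF inj] endo_inj_surj inj) auto
  then show ?thesis by (rule sum.reindex_bij_betw)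
qed

text \<open>\<open>V l\<close> is the joint law of the states and outputs of one block when codeword
  \<open>l\<close> is sent. The hash \<open>g\<close> acts on the state sequence of the previous
  block and a key piece below \<open>Kn\<close>.\<close>

locale block_code =
  fixes n q1 q2 Dn Kn :: nat
    and V :: "nat \<times> nat \<times> nat \<Rightarrow> 's::finite list \<Rightarrow> 'y::finite list \<Rightarrow> 'z::finite list \<Rightarrow> real"
    and g :: "'s list \<Rightarrow> nat \<Rightarrow> nat"
  assumes pos: "0 < q1" "0 < q2" "0 < Dn" "0 < Kn"
    and V_nonneg: "0 \<le> V l s y z"
    and V_sum: "l \<in> {..<q1} \<times> {..<q2} \<times> {..<Dn} \<Longrightarrow>
      (\<Sum>s\<in>words UNIV n. \<Sum>y\<in>words UNIV n. \<Sum>z\<in>words UNIV n. V l s y z) = 1"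
begin

abbreviation S :: "'s list set" where "S \<equiv> words UNIV n"
abbreviation Y :: "'y list set" where "Y \<equiv> words UNIV n"
abbreviation Z :: "'z list set" where "Z \<equiv> words UNIV n"
abbreviation M :: "(nat \<times> nat) set" where "M \<equiv> {..<q1} \<times> {..<q2}"

definition idx :: "nat \<times> nat \<Rightarrow> 's list \<Rightarrow> nat \<Rightarrow> nat \<Rightarrow> nat \<times> nat \<times> nat" where
  "idx m s d k = (fst m, (snd m + g s k) mod q2, d)"

definition Vsz :: "nat \<times> nat \<times> nat \<Rightarrow> 's list \<Rightarrow> 'z list \<Rightarrow> real" where
  "Vsz l s z = (\<Sum>y\<in>Y. V l s y z)"

definition Vz :: "nat \<times> nat \<times> nat \<Rightarrow> 'z list \<Rightarrow> real" where
  "Vz l z = (\<Sum>s\<in>S. Vsz l s z)"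

definition post :: "nat \<times> nat \<times> nat \<Rightarrow> 'z list \<Rightarrow> 's list \<Rightarrow> real" where
  "post l z s = Vsz l s z / Vz l z"

text \<open>Law of the padded component when its message part is \<open>m\<close>, the previous
  state has law \<open>\<rho>\<close> and the key piece is uniform.\<close>

definition keydist :: "('s list \<Rightarrow> real) \<Rightarrow> nat \<Rightarrow> nat \<Rightarrow> real" where
  "keydist \<rho> m a = (\<Sum>s\<in>S. \<Sum>k<Kn. \<rho> s * of_bool ((m + g s k) mod q2 = a) / real Kn)"

text \<open>The laws \<open>keydist \<rho> m\<close> are cyclic shifts of one another; averaging over \<open>m\<close> avoids choosing one of them.\<close>

definition keyleak :: "('s list \<Rightarrow> real) \<Rightarrow> real" where
  "keyleak \<rho> = (\<Sum>m<q2. \<Sum>a<q2. keydist \<rho> m a * log 2 (real q2 * keydist \<rho> m a)) / real q2"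

text \<open>Eve's output law for first message part \<open>m\<close> when the other two index
  components are uniform; covering brings it close to \<open>Q\<close>.\<close>

definition group_law :: "nat \<Rightarrow> 'z list \<Rightarrow> real" where
  "group_law m z = (\<Sum>a<q2. \<Sum>d<Dn. Vz (m, a, d) z) / (real q2 * real Dn)"

definition cover_leak :: "('z list \<Rightarrow> real) \<Rightarrow> real" where
  "cover_leak Q = (\<Sum>m<q1. \<Sum>z\<in>Z. group_law m z * log 2 (group_law m z / Q z)) / real q1"

text \<open>The posterior is what Eve, holding index and output, knows about the state that the next
  block will hash; its key leakage is averaged over a uniform index and the output it
  produces.\<close>

definition hash_leak :: real where
  "hash_leak = (\<Sum>m<q1. \<Sum>a<q2. \<Sum>d<Dn. \<Sum>z\<in>Z. Vz (m, a, d) z * keyleak (post (m, a, d) z))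
     / (real q1 * real q2 * real Dn)"

text \<open>The state \<open>s'\<close> of a block becomes the hash input of the next one, so this
  law of Eve's outputs is not a product over the blocks.\<close>

primrec output_law :: "(nat \<times> nat) list \<Rightarrow> 's list \<Rightarrow> 'z list \<Rightarrow> real" where
  "output_law [] s zs = 1"
| "output_law (m # ms) s zs = (\<Sum>d<Dn. \<Sum>k<Kn. \<Sum>s'\<in>S. Vsz (idx m s d k) s' (take n zs) * output_law ms s' (drop n zs))
     / (real Dn * real Kn)"

text \<open>Conditioning on the index and output of the first block replaces \<open>\<rho>\<close>
  by a posterior, so this family, unlike that with a fixed \<open>s\<close>, is closed under the
  recursion.\<close>

definition mixed_law :: "('s list \<Rightarrow> real) \<Rightarrow> (nat \<times> nat) list \<Rightarrow> 'z list \<Rightarrow> real" where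
  "mixed_law \<rho> ms zs = (\<Sum>s\<in>S. \<rho> s * output_law ms s zs)"

primrec block_ref :: "('z list \<Rightarrow> real) \<Rightarrow> nat \<Rightarrow> 'z list \<Rightarrow> real" where
  "block_ref Q 0 zs = 1"
| "block_ref Q (Suc B) zs = Q (take n zs) * block_ref Q B (drop n zs)"

section \<open>Mass and support of the block laws\<close>

lemma Vsz_nonneg: "0 \<le> Vsz l s z"
  unfolding Vsz_def by (simp add: sum_nonneg V_nonneg)

lemma Vz_nonneg: "0 \<le> Vz l z"
  unfolding Vz_def by (simp add: sum_nonneg Vsz_nonneg)

lemma Vsz_sum: "l \<in> {..<q1} \<times> {..<q2} \<times> {..<Dn} \<Longrightarrow> (\<Sum>s\<in>S. \<Sum>z\<in>Z. Vsz l s z) = 1"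
  unfolding Vsz_def using V_sum[of l] by (simp add: sum.swap[of _ Z Y])

lemma Vz_sum: "l \<in> {..<q1} \<times> {..<q2} \<times> {..<Dn} \<Longrightarrow> (\<Sum>z\<in>Z. Vz l z) = 1"
  unfolding Vz_def using Vsz_sum[of l] by (simp add: sum.swap[of _ Z S])

lemma Vz_eq_0: "Vz l z = 0 \<Longrightarrow> s \<in> S \<Longrightarrow> Vsz l s z = 0"
  unfolding Vz_def by (simp add: sum_nonneg_eq_0_iff Vsz_nonneg)

lemma post_nonneg: "0 \<le> post l z s"
  by (simp add: post_def Vsz_nonneg Vz_nonneg)

lemma post_sum: "Vz l z \<noteq> 0 \<Longrightarrow> (\<Sum>s\<in>S. post l z s) = 1"
  unfolding post_def by (simp add: Vz_def flip: sum_divide_distrib)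

lemma idx_in: "m \<in> M \<Longrightarrow> d < Dn \<Longrightarrow> idx m s d k \<in> {..<q1} \<times> {..<q2} \<times> {..<Dn}"
  using pos by (auto simp: idx_def)

lemma output_law_nonneg: "0 \<le> output_law ms s zs"
  by (induction ms arbitrary: s zs) (auto intro!: divide_nonneg_nonneg sum_nonneg mult_nonneg_nonneg Vsz_nonneg)


lemma output_law_sum: "ms \<in> words M B \<Longrightarrow> (\<Sum>zs\<in>words UNIV (n * B). output_law ms s zs) = 1"
proof (induction B arbitrary: ms s)
  case (Suc B)
  obtain m ms' where ms: "ms = m # ms'" "m \<in> M" "ms' \<in> words M B"
    using Suc.prems by (auto simp: words_Suc)
  have "(\<Sum>zs\<in>words UNIV (n * Suc B). output_law ms s zs)
    = (\<Sum>z\<in>Z. \<Sum>zs\<in>words UNIV (n * B). (\<Sum>d<Dn. \<Sum>k<Kn. \<Sum>s'\<in>S. Vsz (idx m s d k) s' z * output_law ms' s' zs)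
     / (real Dn * real Kn))"
    by (simp add: sum_words_append ms length_words[of _ UNIV n] cong: sum.cong)
  also have "\<dots> = (\<Sum>d<Dn. \<Sum>k<Kn. \<Sum>s'\<in>S. \<Sum>z\<in>Z. \<Sum>zs\<in>words UNIV (n * B). Vsz (idx m s d k) s' z * output_law ms' s' zs)
     / (real Dn * real Kn)"
    by (simp add: sum.swap[of _ "{..<Dn}" Z] sum.swap[of _ "{..<Kn}" Z] sum.swap[of _ S Z]
        sum.swap[of _ "{..<Dn}" "words UNIV (n * B)"] sum.swap[of _ "{..<Kn}" "words UNIV (n * B)"]
        sum.swap[of _ S "words UNIV (n * B)"] flip: sum_divide_distrib)
  also have "\<dots> = (\<Sum>d<Dn. \<Sum>k<Kn. \<Sum>s'\<in>S. \<Sum>z\<in>Z. Vsz (idx m s d k) s' z) / (real Dn * real Kn)"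
    by (simp add: Suc.IH[OF ms(3)] flip: sum_distrib_left)
  also have "\<dots> = (\<Sum>d<Dn. \<Sum>k<Kn. 1) / (real Dn * real Kn)"
    by (intro arg_cong2[where f="(/)"] sum.cong refl Vsz_sum idx_in ms) simp
  also have "\<dots> = 1" using pos by simp
  finally show ?case .
qed simp

lemma keydist_nonneg: "(\<And>s. s \<in> S \<Longrightarrow> 0 \<le> \<rho> s) \<Longrightarrow> 0 \<le> keydist \<rho> m a"
  unfolding keydist_def by (intro sum_nonneg) auto

lemma keydist_sum:
  assumes "(\<Sum>s\<in>S. \<rho> s) = 1"
  shows "(\<Sum>a<q2. keydist \<rho> m a) = 1"
proof -
  have *: "(\<Sum>a<q2. of_bool ((m + g s k) mod q2 = a)) = (1::real)" for s k
    using pos by (simp add: of_bool_def)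
  have "(\<Sum>a<q2. keydist \<rho> m a) = (\<Sum>s\<in>S. \<Sum>k<Kn. \<rho> s * (\<Sum>a<q2. of_bool ((m + g s k) mod q2 = a)) / real Kn)"
    unfolding keydist_def
    by (simp add: sum.swap[of _ S "{..<q2}"] sum.swap[of _ "{..<Kn}" "{..<q2}"] sum_distrib_left sum_divide_distrib
        del: sum_of_bool_eq sum_of_bool_mult_eq sum_mult_of_bool_eq)
  also have "\<dots> = 1" using pos by (simp only: *) (simp add: assms)
  finally show ?thesis .
qed

lemma keydist_sum_msg:
  assumes "(\<Sum>s\<in>S. \<rho> s) = 1" "a < q2"
  shows "(\<Sum>m<q2. keydist \<rho> m a) = 1"
proof -
  have *: "(\<Sum>m<q2. of_bool ((m + g s k) mod q2 = a)) = (1::real)" for s k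
    using sum_mod_shift[OF pos(2), of "\<lambda>b. of_bool (b = a) :: real" "g s k"] assms(2)
    by (simp add: of_bool_def)
  have "(\<Sum>m<q2. keydist \<rho> m a) = (\<Sum>s\<in>S. \<Sum>k<Kn. \<rho> s * (\<Sum>m<q2. of_bool ((m + g s k) mod q2 = a)) / real Kn)"
    unfolding keydist_def
    by (simp add: sum.swap[of _ S "{..<q2}"] sum.swap[of _ "{..<Kn}" "{..<q2}"] sum_distrib_left sum_divide_distrib
        del: sum_of_bool_eq sum_of_bool_mult_eq sum_mult_of_bool_eq)
  also have "\<dots> = 1" using pos by (simp only: *) (simp add: assms)
  finally show ?thesis .
qed

lemma keyleak_nonneg:
  assumes "\<And>s. s \<in> S \<Longrightarrow> 0 \<le> \<rho> s" "(\<Sum>s\<in>S. \<rho> s) = 1"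
  shows "0 \<le> keyleak \<rho>"
proof -
  have "0 \<le> (\<Sum>a<q2. keydist \<rho> m a * log 2 (real q2 * keydist \<rho> m a))" for m
    using KL_nonneg[of "{..<q2}" "keydist \<rho> m" "\<lambda>_. 1 / real q2"] pos
    by (simp add: keydist_nonneg[OF assms(1)] keydist_sum[OF assms(2)] mult.commute)
  then show ?thesis unfolding keyleak_def by (simp add: divide_nonneg_nonneg sum_nonneg)
qed

lemma keyleak_le:
  assumes "\<And>s. s \<in> S \<Longrightarrow> 0 \<le> \<rho> s" "(\<Sum>s\<in>S. \<rho> s) = 1"
  shows "keyleak \<rho> \<le> log 2 (real q2)"
proof -
  have le1: "keydist \<rho> m a \<le> 1" if "a < q2" for m a
    using member_le_sum[where i = a and A = "{..<q2}" and f = "keydist \<rho> m"] that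
    by (simp add: keydist_nonneg[OF assms(1)] keydist_sum[OF assms(2)])
  have "keydist \<rho> m a * log 2 (real q2 * keydist \<rho> m a) \<le> keydist \<rho> m a * log 2 (real q2)" if "a < q2" for m a
  proof (cases "keydist \<rho> m a = 0")
    case False
    then have "keydist \<rho> m a > 0" using keydist_nonneg[of \<rho> m a] assms(1) by simp
    then show ?thesis using pos le1[OF that] by (intro mult_left_mono) auto
  qed simp
  then have "keyleak \<rho> \<le> (\<Sum>m<q2. \<Sum>a<q2. keydist \<rho> m a * log 2 (real q2)) / real q2"
    unfolding keyleak_def by (intro divide_right_mono sum_mono) auto
  also have "\<dots> = log 2 (real q2)"
    using pos by (simp add: keydist_sum[OF assms(2)] flip: sum_distrib_right)
  finally show ?thesis .
qed

lemma mixed_law_nonneg: "(\<And>s. s \<in> S \<Longrightarrow> 0 \<le> \<rho> s) \<Longrightarrow> 0 \<le> mixed_law \<rho> ms zs"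
  unfolding mixed_law_def by (intro sum_nonneg mult_nonneg_nonneg output_law_nonneg)

lemma mixed_law_sum:
  assumes "(\<Sum>s\<in>S. \<rho> s) = 1" "ms \<in> words M B"
  shows "(\<Sum>zs\<in>words UNIV (n * B). mixed_law \<rho> ms zs) = 1"
  unfolding mixed_law_def
  by (simp add: sum.swap[of _ S "words UNIV (n * B)"] output_law_sum[OF assms(2)] assms(1) flip: sum_distrib_left)

text \<open>Bayes' rule, multiplied out so that it also covers outputs of probability 0, where
  \<open>post\<close> is 0 by the convention on division.\<close>

lemma mixed_law_post: "Vz l z * mixed_law (post l z) ms zs = (\<Sum>s\<in>S. Vsz l s z * output_law ms s zs)"
  using Vz_eq_0[of l z] by (cases "Vz l z = 0") (simp_all add: mixed_law_def post_def sum_distrib_left)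

text \<open>Conditioning on the index of the first block: given it, the output and all later blocks
  forget \<open>\<rho>\<close>, which survives only in the weight \<open>keydist\<close>.\<close>

lemma mixed_law_Cons:
  assumes "z \<in> Z"
  shows "mixed_law \<rho> (m # ms) (z @ zs) = (\<Sum>(a, d)\<in>{..<q2} \<times> {..<Dn}.
     keydist \<rho> (snd m) a / real Dn * (Vz (fst m, a, d) z * mixed_law (post (fst m, a, d) z) ms zs))"
proof -
  define X where "X a d = Vz (fst m, a, d) z * mixed_law (post (fst m, a, d) z) ms zs" for a d
  have "mixed_law \<rho> (m # ms) (z @ zs) = (\<Sum>s\<in>S. \<rho> s * ((\<Sum>d<Dn. \<Sum>k<Kn. X ((snd m + g s k) mod q2) d) / (real Dn * real Kn)))"
    unfolding mixed_law_def[of \<rho>] X_def mixed_law_post by (simp add: length_words[OF assms] idx_def)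
  also have "\<dots> = (\<Sum>s\<in>S. \<rho> s * ((\<Sum>d<Dn. \<Sum>k<Kn. \<Sum>a<q2. of_bool ((snd m + g s k) mod q2 = a) * X a d) / (real Dn * real Kn)))"
    using pos by (simp add: of_bool_def if_distrib[of "\<lambda>x. x * _"] cong: if_cong)
  also have "\<dots> = (\<Sum>s\<in>S. \<Sum>d<Dn. \<Sum>k<Kn. \<Sum>a<q2. \<rho> s * of_bool ((snd m + g s k) mod q2 = a) / real Kn * X a d / real Dn)"
    by (simp add: sum_distrib_left sum_divide_distrib mult_ac
        del: sum_of_bool_eq sum_of_bool_mult_eq sum_mult_of_bool_eq)
  also have "\<dots> = (\<Sum>a<q2. \<Sum>d<Dn. \<Sum>s\<in>S. \<Sum>k<Kn. \<rho> s * of_bool ((snd m + g s k) mod q2 = a) / real Kn * X a d / real Dn)"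
    by (simp add: sum.swap[of _ "{..<q2}" "{..<Kn}"] sum.swap[of _ "{..<q2}" S] sum.swap[of _ "{..<Dn}" S]
        sum.swap[of _ "{..<q2}" "{..<Dn}"])
  also have "\<dots> = (\<Sum>a<q2. \<Sum>d<Dn. keydist \<rho> (snd m) a / real Dn * X a d)"
    by (simp add: keydist_def sum_distrib_right sum_divide_distrib)
  finally show ?thesis by (simp add: X_def sum.cartesian_product)
qed


text \<open>Absolute continuity passes from single blocks to the product reference. It is what gives
  the divergences their meaning, since x / 0 = 0 would otherwise hide infinite values.\<close>

lemma block_ref_eq_0:
  assumes Q0: "\<And>l z. l \<in> {..<q1} \<times> {..<q2} \<times> {..<Dn} \<Longrightarrow> z \<in> Z \<Longrightarrow> Q z = 0 \<Longrightarrow> Vz l z = 0"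
    and "ms \<in> words M B" "zs \<in> words UNIV (n * B)" "block_ref Q B zs = 0"
  shows "output_law ms s zs = 0"
  using assms(2-)
proof (induction B arbitrary: ms s zs)
  case (Suc B)
  obtain m ms' where ms: "ms = m # ms'" "m \<in> M" "ms' \<in> words M B"
    using Suc.prems by (auto simp: words_Suc)
  have z: "take n zs \<in> Z" "drop n zs \<in> words UNIV (n * B)" using Suc.prems by (auto simp: words_def)
  have "Vsz (idx m s d k) s' (take n zs) * output_law ms' s' (drop n zs) = 0" if "d < Dn" "s' \<in> S" for d k s'
  proof (cases "Q (take n zs) = 0")
    case True
    then show ?thesis using Q0[OF idx_in[OF ms(2)] z(1)] Vz_eq_0 that by simp
  next
    case False
    then show ?thesis using Suc.IH[OF ms(3) z(2)] Suc.prems by simp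
  qed
  then show ?case by (auto simp: ms intro!: sum.neutral)
qed simp

lemma block_ref_nonneg: "(\<And>z. 0 \<le> Q z) \<Longrightarrow> 0 \<le> block_ref Q B zs"
  by (induction B arbitrary: zs) auto

lemma block_ref_sum: "(\<Sum>z\<in>Z. Q z) = 1 \<Longrightarrow> (\<Sum>zs\<in>words UNIV (n * B). block_ref Q B zs) = 1"
proof (induction B)
  case (Suc B)
  then show ?case
    by (simp add: sum_words_append length_words[of _ UNIV n] cong: sum.cong flip: sum_distrib_left)
qed simp

text \<open>Revealing the index to Eve is the log-sum inequality over the pairs (a, d): it can only
  increase the divergence, and afterwards the logarithm splits into a key term, a covering term and
  the divergence of the remaining blocks.\<close>

lemma divergence_step:
  assumes Q: "\<And>z. 0 \<le> Q z"
    and Q0: "\<And>l z. l \<in> {..<q1} \<times> {..<q2} \<times> {..<Dn} \<Longrightarrow> z \<in> Z \<Longrightarrow> Q z = 0 \<Longrightarrow> Vz l z = 0"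
    and \<rho>: "\<And>s. s \<in> S \<Longrightarrow> 0 \<le> \<rho> s"
    and m: "m1 < q1" "ms \<in> words M B" and z: "z \<in> Z" "zs \<in> words UNIV (n * B)"
  shows "mixed_law \<rho> ((m1, m2) # ms) (z @ zs) * log 2 (mixed_law \<rho> ((m1, m2) # ms) (z @ zs) / (Q z * block_ref Q B zs))
    \<le> (\<Sum>(a, d)\<in>{..<q2} \<times> {..<Dn}. keydist \<rho> m2 a / real Dn * (Vz (m1, a, d) z * mixed_law (post (m1, a, d) z) ms zs)
        * (log 2 (real q2 * keydist \<rho> m2 a) + log 2 (group_law m1 z / Q z)
            + log 2 (mixed_law (post (m1, a, d) z) ms zs / block_ref Q B zs)))"
proof -
  define A where "A = {..<q2} \<times> {..<Dn}"
  have A: "finite A" by (simp add: A_def)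
  define v where "v i = Vz (m1, fst i, snd i) z" for i
  define P where "P i = mixed_law (post (m1, fst i, snd i) z) ms zs" for i
  define G where "G i = keydist \<rho> m2 (fst i)" for i :: "nat \<times> nat"
  define u where "u i = G i / real Dn * (v i * P i)" for i
  \<comment> \<open>The reference mass is divided among the indices of the group like the posterior,
    given \<open>z\<close>, of a uniform index. With this choice \<open>u i / r i\<close> is the
    product of the three ratios in the claim.\<close>
  define r where "r i = v i / (real q2 * real Dn * group_law m1 z) * (Q z * block_ref Q B zs)" for i
  have nn: "0 \<le> v i" "0 \<le> P i" "0 \<le> G i" for i
    by (simp_all add: v_def P_def G_def Vz_nonneg mixed_law_nonneg post_nonneg keydist_nonneg \<rho>)
  have Rv: "group_law m1 z = (\<Sum>i\<in>A. v i) / (real q2 * real Dn)"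
    by (simp add: group_law_def v_def A_def sum.cartesian_product case_prod_unfold)
  have Rn: "0 \<le> group_law m1 z" by (simp add: Rv nn sum_nonneg)
  have Qn: "0 \<le> block_ref Q B zs" by (rule block_ref_nonneg[OF Q])
  have pmu: "mixed_law \<rho> ((m1, m2) # ms) (z @ zs) = (\<Sum>i\<in>A. u i)"
    unfolding mixed_law_Cons[OF z(1)] by (simp add: u_def A_def v_def P_def G_def case_prod_unfold)
  have v0: "v i = 0" if "i \<in> A" "group_law m1 z = 0" for i
    using that A pos unfolding Rv by (simp add: sum_nonneg_eq_0_iff nn)
  have P0: "P i = 0" if "block_ref Q B zs = 0" for i
  proof -
    have "output_law ms s zs = 0" for s
      using Q0 by (rule block_ref_eq_0[where Q = Q and B = B, OF _ m(2) z(2) that])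
    then show ?thesis by (simp add: P_def mixed_law_def)
  qed
  have vQ: "v i = 0" if "i \<in> A" "Q z = 0" for i
    using that m(1) by (auto simp: v_def A_def intro!: Q0 z(1))
  have r0: "u i = 0" if "i \<in> A" "r i = 0" for i
    using that v0[of i] vQ[of i] P0[of i] pos by (auto simp: r_def u_def)
  have rsum: "(\<Sum>i\<in>A. r i) = Q z * block_ref Q B zs" if "group_law m1 z \<noteq> 0"
  proof -
    have "(\<Sum>i\<in>A. r i) = (\<Sum>i\<in>A. v i) / (real q2 * real Dn * group_law m1 z) * (Q z * block_ref Q B zs)"
      by (simp add: r_def sum_distrib_right sum_divide_distrib)
    also have "(\<Sum>i\<in>A. v i) = real q2 * real Dn * group_law m1 z" using pos by (simp add: Rv)
    finally show ?thesis using that pos by simp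
  qed
  have "(\<Sum>i\<in>A. u i) * log 2 ((\<Sum>i\<in>A. u i) / (Q z * block_ref Q B zs)) \<le> (\<Sum>i\<in>A. u i * log 2 (u i / r i))"
  proof (cases "group_law m1 z = 0")
    case True
    then have "\<And>i. i \<in> A \<Longrightarrow> u i = 0" using v0 by (simp add: u_def)
    then show ?thesis by simp
  next
    case False
    have "0 \<le> u i" "0 \<le> r i" for i using nn Q[of z] Qn Rn by (simp_all add: u_def r_def)
    with log_sum_inequality[OF A, of u r] r0 rsum[OF False] show ?thesis by simp
  qed
  also have "\<dots> = (\<Sum>i\<in>A. u i * (log 2 (real q2 * G i) + log 2 (group_law m1 z / Q z) + log 2 (P i / block_ref Q B zs)))"
  proof (intro sum.cong refl)
    fix i assume i: "i \<in> A"
    show "u i * log 2 (u i / r i) = u i * (log 2 (real q2 * G i) + log 2 (group_law m1 z / Q z) + log 2 (P i / block_ref Q B zs))"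
    proof (cases "u i = 0")
      case False
      then have "G i \<noteq> 0" "v i \<noteq> 0" "P i \<noteq> 0" by (auto simp: u_def)
      with nn[of i] have p: "G i > 0" "v i > 0" "P i > 0" by linarith+
      have "group_law m1 z \<noteq> 0" "Q z \<noteq> 0" "block_ref Q B zs \<noteq> 0"
        using v0[OF i] vQ[OF i] P0[of i] p by auto
      with Rn Q[of z] Qn have p2: "group_law m1 z > 0" "Q z > 0" "block_ref Q B zs > 0" by linarith+
      have "u i / r i = (real q2 * G i) * (group_law m1 z / Q z) * (P i / block_ref Q B zs)"
        using p p2 pos by (simp add: u_def r_def divide_simps)
      moreover have "log 2 ((real q2 * G i) * (group_law m1 z / Q z) * (P i / block_ref Q B zs))
          = log 2 (real q2 * G i) + log 2 (group_law m1 z / Q z) + log 2 (P i / block_ref Q B zs)"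
        using p p2 pos by (subst log_mult_pos, simp, simp, subst log_mult_pos) simp_all
      ultimately show ?thesis by presburger
    qed simp
  qed
  finally show ?thesis unfolding pmu by (simp add: A_def u_def v_def P_def G_def case_prod_unfold)
qed

text \<open>Induction over the number of blocks, for all \<open>\<rho>\<close> at once. The first
  block costs \<open>keyleak \<rho>\<close> and the covering leakage; the posteriors with which the
  other blocks start cost \<open>hash_leak\<close> on average. With no blocks left,
  \<open>keyleak \<rho>\<close> is nonnegative slack.\<close>

lemma block_leakage:
  assumes Q: "\<And>z. 0 \<le> Q z"
    and Q0: "\<And>l z. l \<in> {..<q1} \<times> {..<q2} \<times> {..<Dn} \<Longrightarrow> z \<in> Z \<Longrightarrow> Q z = 0 \<Longrightarrow> Vz l z = 0"
    and \<rho>: "\<And>s. s \<in> S \<Longrightarrow> 0 \<le> \<rho> s" "(\<Sum>s\<in>S. \<rho> s) = 1"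
  shows "(\<Sum>ms\<in>words M B. \<Sum>zs\<in>words UNIV (n * B). mixed_law \<rho> ms zs * log 2 (mixed_law \<rho> ms zs / block_ref Q B zs))
      \<le> real ((q1 * q2) ^ B) * (keyleak \<rho> + real B * (cover_leak Q + hash_leak))"
  using \<rho>
proof (induction B arbitrary: \<rho>)
  case 0
  then show ?case by (simp add: mixed_law_def keyleak_nonneg)
next
  case (Suc B)
  define N where "N = real ((q1 * q2) ^ B)"
  define c where "c = real B * (cover_leak Q + hash_leak)"
  define w where "w m1 m2 a d z = keydist \<rho> m2 a / real Dn * Vz (m1, a, d) z" for m1 m2 a d z
  define \<pi> where "\<pi> m1 a d z = post (m1, a, d) z" for m1 a d z
  define f where "f m1 m2 a z = log 2 (real q2 * keydist \<rho> m2 a) + log 2 (group_law m1 z / Q z)" for m1 m2 a z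
  have wn: "0 \<le> w m1 m2 a d z" for m1 m2 a d z
    using Suc.prems by (simp add: w_def Vz_nonneg keydist_nonneg)
  have zstep: "(\<Sum>ms\<in>words M B. \<Sum>zs\<in>words UNIV (n * B). mixed_law \<rho> ((m1, m2) # ms) (z @ zs)
          * log 2 (mixed_law \<rho> ((m1, m2) # ms) (z @ zs) / (Q z * block_ref Q B zs)))
      \<le> (\<Sum>a<q2. \<Sum>d<Dn. w m1 m2 a d z * (N * (f m1 m2 a z + keyleak (\<pi> m1 a d z) + c)))"
    if m1: "m1 < q1" and z: "z \<in> Z" for m1 m2 z
  proof -
    have "(\<Sum>ms\<in>words M B. \<Sum>zs\<in>words UNIV (n * B). mixed_law \<rho> ((m1, m2) # ms) (z @ zs)
          * log 2 (mixed_law \<rho> ((m1, m2) # ms) (z @ zs) / (Q z * block_ref Q B zs)))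
      \<le> (\<Sum>ms\<in>words M B. \<Sum>zs\<in>words UNIV (n * B). \<Sum>(a, d)\<in>{..<q2} \<times> {..<Dn}.
          keydist \<rho> m2 a / real Dn * (Vz (m1, a, d) z * mixed_law (post (m1, a, d) z) ms zs)
        * (log 2 (real q2 * keydist \<rho> m2 a) + log 2 (group_law m1 z / Q z)
            + log 2 (mixed_law (post (m1, a, d) z) ms zs / block_ref Q B zs)))"
      by (intro sum_mono divergence_step Q Q0 Suc.prems m1 z) auto
    also have "\<dots> = (\<Sum>ms\<in>words M B. \<Sum>zs\<in>words UNIV (n * B). \<Sum>a<q2. \<Sum>d<Dn.
          w m1 m2 a d z * (mixed_law (\<pi> m1 a d z) ms zs * (f m1 m2 a z + log 2 (mixed_law (\<pi> m1 a d z) ms zs / block_ref Q B zs))))"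
      by (simp add: sum.cartesian_product w_def f_def \<pi>_def mult_ac)
    also have "\<dots> = (\<Sum>a<q2. \<Sum>d<Dn. \<Sum>ms\<in>words M B. \<Sum>zs\<in>words UNIV (n * B).
          w m1 m2 a d z * (mixed_law (\<pi> m1 a d z) ms zs * (f m1 m2 a z + log 2 (mixed_law (\<pi> m1 a d z) ms zs / block_ref Q B zs))))"
      by (simp add: sum.swap[of _ "{..<q2}" "words UNIV (n * B)"] sum.swap[of _ "{..<q2}" "words M B"]
          sum.swap[of _ "{..<Dn}" "words UNIV (n * B)"] sum.swap[of _ "{..<Dn}" "words M B"])
    also have "\<dots> \<le> (\<Sum>a<q2. \<Sum>d<Dn. w m1 m2 a d z * (N * (f m1 m2 a z + keyleak (\<pi> m1 a d z) + c)))"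
    proof (intro sum_mono)
      fix a d assume ad: "a \<in> {..<q2}" "d \<in> {..<Dn}"
      show "(\<Sum>ms\<in>words M B. \<Sum>zs\<in>words UNIV (n * B).
          w m1 m2 a d z * (mixed_law (\<pi> m1 a d z) ms zs * (f m1 m2 a z + log 2 (mixed_law (\<pi> m1 a d z) ms zs / block_ref Q B zs))))
         \<le> w m1 m2 a d z * (N * (f m1 m2 a z + keyleak (\<pi> m1 a d z) + c))"
      proof (cases "Vz (m1, a, d) z = 0")
        case True
        then show ?thesis by (simp add: w_def)
      next
        case False
        then have p1: "(\<Sum>s\<in>S. \<pi> m1 a d z s) = 1" by (simp add: \<pi>_def post_sum)
        have "(\<Sum>ms\<in>words M B. \<Sum>zs\<in>words UNIV (n * B).
            mixed_law (\<pi> m1 a d z) ms zs * (f m1 m2 a z + log 2 (mixed_law (\<pi> m1 a d z) ms zs / block_ref Q B zs)))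
          = (\<Sum>ms\<in>words M B. f m1 m2 a z) + (\<Sum>ms\<in>words M B. \<Sum>zs\<in>words UNIV (n * B).
            mixed_law (\<pi> m1 a d z) ms zs * log 2 (mixed_law (\<pi> m1 a d z) ms zs / block_ref Q B zs))"
          by (simp add: distrib_left sum.distrib mixed_law_sum[OF p1] flip: sum_distrib_right cong: sum.cong)
        also have "(\<Sum>ms\<in>words M B. f m1 m2 a z) = N * f m1 m2 a z"
          by (simp add: N_def card_words card_cartesian_product)
        also have "N * f m1 m2 a z + (\<Sum>ms\<in>words M B. \<Sum>zs\<in>words UNIV (n * B).
            mixed_law (\<pi> m1 a d z) ms zs * log 2 (mixed_law (\<pi> m1 a d z) ms zs / block_ref Q B zs))
          \<le> N * f m1 m2 a z + N * (keyleak (\<pi> m1 a d z) + c)"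
          using Suc.IH[OF _ p1] by (simp add: N_def c_def \<pi>_def post_nonneg)
        also have "\<dots> = N * (f m1 m2 a z + keyleak (\<pi> m1 a d z) + c)"
          by (simp add: algebra_simps)
        finally show ?thesis
          using wn[of m1 m2 a d z] by (simp only: mult_left_mono flip: sum_distrib_left)
      qed
    qed
    finally show ?thesis .
  qed
  have "(\<Sum>ms\<in>words M (Suc B). \<Sum>zs\<in>words UNIV (n * Suc B). mixed_law \<rho> ms zs * log 2 (mixed_law \<rho> ms zs / block_ref Q (Suc B) zs))
     = (\<Sum>m1<q1. \<Sum>m2<q2. \<Sum>ms\<in>words M B. \<Sum>z\<in>Z. \<Sum>zs\<in>words UNIV (n * B). mixed_law \<rho> ((m1, m2) # ms) (z @ zs)
          * log 2 (mixed_law \<rho> ((m1, m2) # ms) (z @ zs) / (Q z * block_ref Q B zs)))"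
    by (simp add: sum_words_Suc sum_words_append length_words[of _ UNIV n] sum.cartesian_product' cong: sum.cong)
  also have "\<dots> = (\<Sum>m1<q1. \<Sum>m2<q2. \<Sum>z\<in>Z. \<Sum>ms\<in>words M B. \<Sum>zs\<in>words UNIV (n * B). mixed_law \<rho> ((m1, m2) # ms) (z @ zs)
          * log 2 (mixed_law \<rho> ((m1, m2) # ms) (z @ zs) / (Q z * block_ref Q B zs)))"
    by (intro sum.cong refl sum.swap)
  also have "\<dots> \<le> (\<Sum>m1<q1. \<Sum>m2<q2. \<Sum>z\<in>Z. \<Sum>a<q2. \<Sum>d<Dn. w m1 m2 a d z * (N * (f m1 m2 a z + keyleak (\<pi> m1 a d z) + c)))"
    by (intro sum_mono zstep) auto
  also have "\<dots> = N * (\<Sum>m1<q1. \<Sum>m2<q2. \<Sum>a<q2. \<Sum>d<Dn. \<Sum>z\<in>Z. w m1 m2 a d z * (f m1 m2 a z + keyleak (\<pi> m1 a d z) + c))"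
    by (simp add: sum.swap[of _ "{..<q2}" Z] sum.swap[of _ "{..<Dn}" Z] sum_distrib_left mult_ac)
  also have "(\<Sum>m1<q1. \<Sum>m2<q2. \<Sum>a<q2. \<Sum>d<Dn. \<Sum>z\<in>Z. w m1 m2 a d z * (f m1 m2 a z + keyleak (\<pi> m1 a d z) + c))
     = (\<Sum>m1<q1. \<Sum>m2<q2. \<Sum>a<q2. \<Sum>d<Dn. keydist \<rho> m2 a / real Dn * (log 2 (real q2 * keydist \<rho> m2 a) + c)
         + keydist \<rho> m2 a / real Dn * (\<Sum>z\<in>Z. Vz (m1, a, d) z * (log 2 (group_law m1 z / Q z) + keyleak (\<pi> m1 a d z))))"
  proof (intro sum.cong refl)
    fix m1 m2 a d assume *: "m1 \<in> {..<q1}" "m2 \<in> {..<q2}" "a \<in> {..<q2}" "d \<in> {..<Dn}"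
    let ?G = "keydist \<rho> m2 a / real Dn"
    have "(\<Sum>z\<in>Z. w m1 m2 a d z * (f m1 m2 a z + keyleak (\<pi> m1 a d z) + c))
      = (\<Sum>z\<in>Z. ?G * (log 2 (real q2 * keydist \<rho> m2 a) + c) * Vz (m1, a, d) z
          + ?G * (Vz (m1, a, d) z * (log 2 (group_law m1 z / Q z) + keyleak (\<pi> m1 a d z))))"
      by (intro sum.cong refl) (simp add: w_def f_def algebra_simps add_divide_distrib)
    also have "\<dots> = ?G * (log 2 (real q2 * keydist \<rho> m2 a) + c) * (\<Sum>z\<in>Z. Vz (m1, a, d) z)
          + ?G * (\<Sum>z\<in>Z. Vz (m1, a, d) z * (log 2 (group_law m1 z / Q z) + keyleak (\<pi> m1 a d z)))"
      by (simp add: sum.distrib sum_distrib_left)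
    finally show "(\<Sum>z\<in>Z. w m1 m2 a d z * (f m1 m2 a z + keyleak (\<pi> m1 a d z) + c))
      = ?G * (log 2 (real q2 * keydist \<rho> m2 a) + c) 
          + ?G * (\<Sum>z\<in>Z. Vz (m1, a, d) z * (log 2 (group_law m1 z / Q z) + keyleak (\<pi> m1 a d z)))"
      using * by (simp add: Vz_sum)
  qed
  also have "\<dots> = (\<Sum>m1<q1. \<Sum>m2<q2. \<Sum>a<q2. keydist \<rho> m2 a * (log 2 (real q2 * keydist \<rho> m2 a) + c))
     + (\<Sum>m1<q1. \<Sum>m2<q2. \<Sum>a<q2. \<Sum>d<Dn. keydist \<rho> m2 a / real Dn *
           (\<Sum>z\<in>Z. Vz (m1, a, d) z * (log 2 (group_law m1 z / Q z) + keyleak (\<pi> m1 a d z))))"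
    using pos by (simp add: sum.distrib)
  also have "(\<Sum>m1<q1. \<Sum>m2<q2. \<Sum>a<q2. keydist \<rho> m2 a * (log 2 (real q2 * keydist \<rho> m2 a) + c))
     = real (q1 * q2) * (keyleak \<rho> + c)"
  proof -
    have "(\<Sum>m2<q2. \<Sum>a<q2. keydist \<rho> m2 a * (log 2 (real q2 * keydist \<rho> m2 a) + c)) = real q2 * keyleak \<rho> + real q2 * c"
      using pos Suc.prems
      by (simp add: distrib_left sum.distrib keyleak_def keydist_sum flip: sum_distrib_right)
    then show ?thesis by (simp add: algebra_simps)
  qed
  also have "(\<Sum>m1<q1. \<Sum>m2<q2. \<Sum>a<q2. \<Sum>d<Dn. keydist \<rho> m2 a / real Dn *
           (\<Sum>z\<in>Z. Vz (m1, a, d) z * (log 2 (group_law m1 z / Q z) + keyleak (\<pi> m1 a d z))))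
     = real (q1 * q2) * (cover_leak Q + hash_leak)"
  proof -
    define e where "e m1 a d = (\<Sum>z\<in>Z. Vz (m1, a, d) z * (log 2 (group_law m1 z / Q z) + keyleak (\<pi> m1 a d z)))" for m1 a d
    have "(\<Sum>m1<q1. \<Sum>m2<q2. \<Sum>a<q2. \<Sum>d<Dn. keydist \<rho> m2 a / real Dn * e m1 a d)
       = (\<Sum>m1<q1. \<Sum>a<q2. \<Sum>m2<q2. \<Sum>d<Dn. keydist \<rho> m2 a / real Dn * e m1 a d)"
      by (intro sum.cong refl sum.swap)
    \<comment> \<open>For fixed \<open>a\<close> the key laws belonging to all \<open>m2\<close> add
      up to 1: averaged over the message the index is uniform, and \<open>\<rho>\<close> disappears
      from the covering and hash terms.\<close>
    also have "\<dots> = (\<Sum>m1<q1. \<Sum>a<q2. (\<Sum>m2<q2. keydist \<rho> m2 a) * (\<Sum>d<Dn. e m1 a d / real Dn))"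
      by (simp add: sum_product)
    also have "\<dots> = (\<Sum>m1<q1. \<Sum>a<q2. \<Sum>d<Dn. e m1 a d / real Dn)"
      by (intro sum.cong refl) (simp add: keydist_sum_msg[OF Suc.prems(2)])
    also have "\<dots> = (\<Sum>m1<q1. \<Sum>a<q2. \<Sum>d<Dn. \<Sum>z\<in>Z. Vz (m1, a, d) z * log 2 (group_law m1 z / Q z) / real Dn)
        + (\<Sum>m1<q1. \<Sum>a<q2. \<Sum>d<Dn. \<Sum>z\<in>Z. Vz (m1, a, d) z * keyleak (\<pi> m1 a d z) / real Dn)"
      by (simp add: e_def distrib_left sum.distrib add_divide_distrib sum_divide_distrib)
    also have "(\<Sum>m1<q1. \<Sum>a<q2. \<Sum>d<Dn. \<Sum>z\<in>Z. Vz (m1, a, d) z * keyleak (\<pi> m1 a d z) / real Dn) = real (q1 * q2) * hash_leak"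
      using pos by (simp add: hash_leak_def \<pi>_def flip: sum_divide_distrib)
    also have "(\<Sum>m1<q1. \<Sum>a<q2. \<Sum>d<Dn. \<Sum>z\<in>Z. Vz (m1, a, d) z * log 2 (group_law m1 z / Q z) / real Dn)
       = (\<Sum>m1<q1. \<Sum>z\<in>Z. (\<Sum>a<q2. \<Sum>d<Dn. Vz (m1, a, d) z) / real Dn * log 2 (group_law m1 z / Q z))"
      by (simp add: sum.swap[of _ Z "{..<q2}"] sum.swap[of _ Z "{..<Dn}"] sum_distrib_right sum_divide_distrib)
    also have "\<dots> = (\<Sum>m1<q1. \<Sum>z\<in>Z. real q2 * (group_law m1 z * log 2 (group_law m1 z / Q z)))"
      using pos by (simp add: group_law_def)
    also have "\<dots> = real (q1 * q2) * cover_leak Q"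
      using pos by (simp add: cover_leak_def flip: sum_distrib_left)
    finally show ?thesis by (simp add: e_def distrib_left)
  qed
  finally show ?case
    by (simp add: N_def c_def algebra_simps)
qed

end

section \<open>Error probability of a block code\<close>

lemma prod_lessThan_add:
  fixes f :: "nat \<Rightarrow> 'a::comm_monoid_mult"
  shows "(\<Prod>i<a + b. f i) = (\<Prod>i<a. f i) * (\<Prod>i<b. f (a + i))"
  by (induction b) (simp_all add: mult_ac)

lemma memoryless_law_append:
  assumes "length ts = length ss" "length ys = length ss" "length zs = length ss"
  shows "memoryless_law ps v (ts @ ts') (ss @ ss') (ys @ ys') (zs @ zs') = memoryless_law ps v ts ss ys zs * memoryless_law ps v ts' ss' ys' zs'"
  unfolding memoryless_law_def length_append prod_lessThan_add using assms by (simp add: nth_append)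

context block_code
begin

primrec joint_law :: "(nat \<times> nat) list \<Rightarrow> 's list \<Rightarrow> nat list \<Rightarrow> nat list \<Rightarrow> 's list \<Rightarrow> 'y list \<Rightarrow> 'z list \<Rightarrow> real" where
  "joint_law [] s ds ks ss ys zs = 1"
| "joint_law (m # ms) s ds ks ss ys zs = V (idx m s (hd ds) (hd ks)) (take n ss) (take n ys) (take n zs)
     * joint_law ms (take n ss) (tl ds) (tl ks) (drop n ss) (drop n ys) (drop n zs)"

primrec codeword :: "(nat \<times> nat \<times> nat \<Rightarrow> 't list) \<Rightarrow> (nat \<times> nat) list \<Rightarrow> 's list \<Rightarrow> nat list \<Rightarrow> nat list \<Rightarrow> 's list \<Rightarrow> 't list" where
  "codeword C [] s ds ks ss = []"
| "codeword C (m # ms) s ds ks ss = C (idx m s (hd ds) (hd ks)) @ codeword C ms (take n ss) (tl ds) (tl ks) (drop n ss)"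

text \<open>The pad is removed with the true state of the previous block, which the decoder knows,
  so a wrong index does not spoil the next block. Adding \<open>q2 - g s k mod q2\<close> is
  subtraction modulo \<open>q2\<close> in the naturals.\<close>

primrec decode_blocks :: "('y list \<Rightarrow> 's list \<Rightarrow> nat \<times> nat \<times> nat) \<Rightarrow> nat list \<Rightarrow> 's list \<Rightarrow> 's list \<Rightarrow> 'y list \<Rightarrow> (nat \<times> nat) list" where
  "decode_blocks \<delta> [] s ss ys = []"
| "decode_blocks \<delta> (k # ks) s ss ys = (let l = \<delta> (take n ys) (take n ss) in
      (fst l, (fst (snd l) + (q2 - g s k mod q2)) mod q2)) # decode_blocks \<delta> ks (take n ss) (drop n ss) (drop n ys)"

definition error_prob :: "('y list \<Rightarrow> 's list \<Rightarrow> nat \<times> nat \<times> nat) \<Rightarrow> (nat \<times> nat) list \<Rightarrow> 's list \<Rightarrow> nat list \<Rightarrow> nat list \<Rightarrow> real" where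
  "error_prob \<delta> ms s ds ks = (\<Sum>ss\<in>words UNIV (n * length ms). \<Sum>ys\<in>words UNIV (n * length ms). \<Sum>zs\<in>words UNIV (n * length ms).
      joint_law ms s ds ks ss ys zs * of_bool (decode_blocks \<delta> ks s ss ys \<noteq> ms))"

text \<open>Error probability of a single block under a uniform index, the quantity that random
  coding controls.\<close>

definition index_error :: "('y list \<Rightarrow> 's list \<Rightarrow> nat \<times> nat \<times> nat) \<Rightarrow> real" where
  "index_error \<delta> = (\<Sum>l\<in>{..<q1} \<times> {..<q2} \<times> {..<Dn}. \<Sum>s\<in>S. \<Sum>y\<in>Y. \<Sum>z\<in>Z. V l s y z * of_bool (\<delta> y s \<noteq> l))
     / (real q1 * real q2 * real Dn)"

lemma joint_law_nonneg: "0 \<le> joint_law ms s ds ks ss ys zs"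
  by (induction ms arbitrary: s ds ks ss ys zs) (auto simp: V_nonneg)

text \<open>Identifies the recursion for Eve with the marginal of the full law, the seeds and key
  pieces being uniform.\<close>

lemma output_law_joint_law:
  "output_law ms s zs = (\<Sum>ds\<in>words {..<Dn} (length ms). \<Sum>ks\<in>words {..<Kn} (length ms).
     \<Sum>ss\<in>words UNIV (n * length ms). \<Sum>ys\<in>words UNIV (n * length ms). joint_law ms s ds ks ss ys zs) / (real Dn * real Kn) ^ length ms"
proof (induction ms arbitrary: s zs)
  case (Cons m ms)
  define B where "B = length ms"
  define W where "W = (real Dn * real Kn) ^ B"
  have "(\<Sum>ds\<in>words {..<Dn} (Suc B). \<Sum>ks\<in>words {..<Kn} (Suc B).
     \<Sum>ss\<in>words UNIV (n * Suc B). \<Sum>ys\<in>words UNIV (n * Suc B). joint_law (m # ms) s ds ks ss ys zs)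
     = (\<Sum>d<Dn. \<Sum>ds\<in>words {..<Dn} B. \<Sum>k<Kn. \<Sum>ks\<in>words {..<Kn} B. \<Sum>s'\<in>S. \<Sum>ss\<in>words UNIV (n * B). \<Sum>y\<in>Y. \<Sum>ys\<in>words UNIV (n * B).
          V (idx m s d k) s' y (take n zs) * joint_law ms s' ds ks ss ys (drop n zs))"
    by (simp add: sum_words_Suc sum_words_append length_words[of _ UNIV n] cong: sum.cong)
  also have "\<dots> = (\<Sum>d<Dn. \<Sum>k<Kn. \<Sum>s'\<in>S. \<Sum>y\<in>Y. \<Sum>ds\<in>words {..<Dn} B. \<Sum>ks\<in>words {..<Kn} B. \<Sum>ss\<in>words UNIV (n * B). \<Sum>ys\<in>words UNIV (n * B).
          V (idx m s d k) s' y (take n zs) * joint_law ms s' ds ks ss ys (drop n zs))"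
    by (simp add: sum.swap[of _ Y "words UNIV (n * B) :: 's list set"]
        sum.swap[of _ Y "words {..<Kn} B"] sum.swap[of _ Y "words {..<Dn} B"]
        sum.swap[of _ S "words {..<Kn} B"] sum.swap[of _ S "words {..<Dn} B"]
        sum.swap[of _ "{..<Kn}" "words {..<Dn} B"])
  also have "\<dots> = (\<Sum>d<Dn. \<Sum>k<Kn. \<Sum>s'\<in>S. \<Sum>y\<in>Y. V (idx m s d k) s' y (take n zs) * (W * output_law ms s' (drop n zs)))"
    using pos by (simp add: Cons.IH W_def B_def flip: sum_distrib_left)
  also have "\<dots> = W * (\<Sum>d<Dn. \<Sum>k<Kn. \<Sum>s'\<in>S. Vsz (idx m s d k) s' (take n zs) * output_law ms s' (drop n zs))"
    by (simp add: Vsz_def sum_distrib_left sum_distrib_right mult_ac)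
  finally show ?case using pos by (simp add: W_def B_def)
qed simp

lemma joint_law_sum:
  assumes "ms \<in> words M B" "ds \<in> words {..<Dn} B"
  shows "(\<Sum>ss\<in>words UNIV (n * B). \<Sum>ys\<in>words UNIV (n * B). \<Sum>zs\<in>words UNIV (n * B). joint_law ms s ds ks ss ys zs) = 1"
  using assms
proof (induction B arbitrary: ms s ds ks)
  case (Suc B)
  obtain m ms' d ds' where ms: "ms = m # ms'" "m \<in> M" "ms' \<in> words M B"
    and ds: "ds = d # ds'" "d < Dn" "ds' \<in> words {..<Dn} B"
    using Suc.prems by (auto simp: words_Suc)
  have "(\<Sum>ss\<in>words UNIV (n * Suc B). \<Sum>ys\<in>words UNIV (n * Suc B). \<Sum>zs\<in>words UNIV (n * Suc B). joint_law ms s ds ks ss ys zs)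
    = (\<Sum>s'\<in>S. \<Sum>ss\<in>words UNIV (n * B). \<Sum>y\<in>Y. \<Sum>ys\<in>words UNIV (n * B). \<Sum>z\<in>Z. \<Sum>zs\<in>words UNIV (n * B).
        V (idx m s d (hd ks)) s' y z * joint_law ms' s' ds' (tl ks) ss ys zs)"
    by (simp add: sum_words_append length_words[of _ UNIV n] ms ds cong: sum.cong)
  also have "\<dots> = (\<Sum>s'\<in>S. \<Sum>y\<in>Y. \<Sum>z\<in>Z. \<Sum>ss\<in>words UNIV (n * B). \<Sum>ys\<in>words UNIV (n * B). \<Sum>zs\<in>words UNIV (n * B).
        V (idx m s d (hd ks)) s' y z * joint_law ms' s' ds' (tl ks) ss ys zs)"
    by (simp add: sum.swap[of _ Y "words UNIV (n * B) :: 's list set"] sum.swap[of _ Z "words UNIV (n * B) :: 's list set"]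
        sum.swap[of _ Z "words UNIV (n * B) :: 'y list set"])
  also have "\<dots> = (\<Sum>s'\<in>S. \<Sum>y\<in>Y. \<Sum>z\<in>Z. V (idx m s d (hd ks)) s' y z)"
    by (simp add: Suc.IH[OF ms(3) ds(3)] flip: sum_distrib_left)
  also have "\<dots> = 1" by (intro V_sum idx_in ms ds)
  finally show ?case .
qed simp

text \<open>Union bound over the first block and the rest: a correct index returns the message
  because the pad cancels modulo \<open>q2\<close>.\<close>

lemma error_prob_Cons:
  assumes m: "m \<in> M" "ms \<in> words M B" and d: "d < Dn" "ds \<in> words {..<Dn} B"
  shows "error_prob \<delta> (m # ms) s (d # ds) (k # ks) \<le> (\<Sum>s'\<in>S. \<Sum>y\<in>Y. \<Sum>z\<in>Z. V (idx m s d k) s' y z *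
     (of_bool (\<delta> y s' \<noteq> idx m s d k) + error_prob \<delta> ms s' ds ks))"
proof -
  let ?l = "idx m s d k"
  have len: "length ms = B" using m by (simp add: words_def)
  have dec: "(let l = \<delta> y s' in (fst l, (fst (snd l) + (q2 - g s k mod q2)) mod q2)) = m" if "\<delta> y s' = ?l" for y s'
  proof -
    have gq: "g s k mod q2 < q2" using pos by simp
    have "((snd m + g s k) mod q2 + (q2 - g s k mod q2)) mod q2 = (snd m + (g s k mod q2 + (q2 - g s k mod q2))) mod q2"
      by (metis add.assoc mod_add_left_eq mod_add_right_eq)
    also have "\<dots> = snd m" using gq m(1) by auto
    finally show ?thesis using that by (auto simp: idx_def Let_def)
  qed
  have "error_prob \<delta> (m # ms) s (d # ds) (k # ks)
    = (\<Sum>s'\<in>S. \<Sum>ss\<in>words UNIV (n * B). \<Sum>y\<in>Y. \<Sum>ys\<in>words UNIV (n * B). \<Sum>z\<in>Z. \<Sum>zs\<in>words UNIV (n * B).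
        V ?l s' y z * joint_law ms s' ds ks ss ys zs *
        of_bool ((let l = \<delta> y s' in (fst l, (fst (snd l) + (q2 - g s k mod q2)) mod q2)) # decode_blocks \<delta> ks s' ss ys \<noteq> m # ms))"
    unfolding error_prob_def by (simp add: sum_words_append length_words[of _ UNIV n] len cong: sum.cong)
  also have "\<dots> \<le> (\<Sum>s'\<in>S. \<Sum>ss\<in>words UNIV (n * B). \<Sum>y\<in>Y. \<Sum>ys\<in>words UNIV (n * B). \<Sum>z\<in>Z. \<Sum>zs\<in>words UNIV (n * B).
        V ?l s' y z * joint_law ms s' ds ks ss ys zs * (of_bool (\<delta> y s' \<noteq> ?l) + of_bool (decode_blocks \<delta> ks s' ss ys \<noteq> ms)))"
    by (intro sum_mono mult_left_mono mult_nonneg_nonneg V_nonneg joint_law_nonneg) (use dec in auto)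
  also have "\<dots> = (\<Sum>s'\<in>S. \<Sum>y\<in>Y. \<Sum>z\<in>Z. \<Sum>ss\<in>words UNIV (n * B). \<Sum>ys\<in>words UNIV (n * B). \<Sum>zs\<in>words UNIV (n * B).
        V ?l s' y z * joint_law ms s' ds ks ss ys zs * (of_bool (\<delta> y s' \<noteq> ?l) + of_bool (decode_blocks \<delta> ks s' ss ys \<noteq> ms)))"
    by (simp add: sum.swap[of _ Y "words UNIV (n * B) :: 's list set"] sum.swap[of _ Z "words UNIV (n * B) :: 's list set"]
        sum.swap[of _ Z "words UNIV (n * B) :: 'y list set"]
        del: sum_of_bool_eq sum_of_bool_mult_eq sum_mult_of_bool_eq)
  also have "\<dots> = (\<Sum>s'\<in>S. \<Sum>y\<in>Y. \<Sum>z\<in>Z. V ?l s' y z * ((\<Sum>ss\<in>words UNIV (n * B). \<Sum>ys\<in>words UNIV (n * B). \<Sum>zs\<in>words UNIV (n * B).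
        joint_law ms s' ds ks ss ys zs) * of_bool (\<delta> y s' \<noteq> ?l) + error_prob \<delta> ms s' ds ks))"
    unfolding error_prob_def len
    by (simp add: distrib_left sum.distrib sum_distrib_left sum_distrib_right mult.assoc
        del: sum_of_bool_eq sum_of_bool_mult_eq sum_mult_of_bool_eq)
  also have "\<dots> = (\<Sum>s'\<in>S. \<Sum>y\<in>Y. \<Sum>z\<in>Z. V ?l s' y z * (of_bool (\<delta> y s' \<noteq> ?l) + error_prob \<delta> ms s' ds ks))"
    by (simp add: joint_law_sum[OF m(2) d(2)])
  finally show ?thesis .
qed

text \<open>For a fixed pad, passing from (m, d) to the index is a bijection, so uniform messages
  and seeds give a uniform index.\<close>

lemma sum_idx: "(\<Sum>m\<in>M. \<Sum>d<Dn. F (idx m s d k)) = (\<Sum>l\<in>{..<q1} \<times> {..<q2} \<times> {..<Dn}. F l)"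
  using sum_mod_shift[OF pos(2), of "\<lambda>a. \<Sum>d<Dn. F (_, a, d)" "g s k"]
  by (simp add: sum.cartesian_product' idx_def)

text \<open>Valid for each key sequence separately, as every block index is uniform whatever the
  pad. The factor \<open>B\<close> is the union bound over the blocks.\<close>

lemma block_error:
  assumes "ks \<in> words A B"
  shows "(\<Sum>ms\<in>words M B. \<Sum>ds\<in>words {..<Dn} B. error_prob \<delta> ms s ds ks) \<le> (real q1 * real q2 * real Dn) ^ B * (real B * index_error \<delta>)"
  using assms
proof (induction B arbitrary: s ks)
  case 0
  then show ?case by (simp add: error_prob_def)
next
  case (Suc B)
  obtain k ks' where ks: "ks = k # ks'" "ks' \<in> words A B" using Suc.prems by (auto simp: words_Suc)
  define L where "L = {..<q1} \<times> {..<q2} \<times> {..<Dn}"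
  define N where "N = (real q1 * real q2 * real Dn) ^ B"
  have N: "real (card (words M B)) * real (card (words {..<Dn} B)) = N"
    by (simp add: card_words card_cartesian_product N_def power_mult_distrib)
  have "(\<Sum>ms\<in>words M (Suc B). \<Sum>ds\<in>words {..<Dn} (Suc B). error_prob \<delta> ms s ds ks)
     = (\<Sum>m\<in>M. \<Sum>ms\<in>words M B. \<Sum>d<Dn. \<Sum>ds\<in>words {..<Dn} B. error_prob \<delta> (m # ms) s (d # ds) (k # ks'))"
    by (simp add: sum_words_Suc ks)
  also have "\<dots> \<le> (\<Sum>m\<in>M. \<Sum>ms\<in>words M B. \<Sum>d<Dn. \<Sum>ds\<in>words {..<Dn} B. 
      (\<Sum>s'\<in>S. \<Sum>y\<in>Y. \<Sum>z\<in>Z. V (idx m s d k) s' y z * (of_bool (\<delta> y s' \<noteq> idx m s d k) + error_prob \<delta> ms s' ds ks')))"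
    by (intro sum_mono error_prob_Cons) auto
  also have "\<dots> = (\<Sum>m\<in>M. \<Sum>d<Dn. \<Sum>s'\<in>S. \<Sum>y\<in>Y. \<Sum>z\<in>Z. \<Sum>ms\<in>words M B. \<Sum>ds\<in>words {..<Dn} B. 
      V (idx m s d k) s' y z * (of_bool (\<delta> y s' \<noteq> idx m s d k) + error_prob \<delta> ms s' ds ks'))"
    by (simp add: sum.swap[of _ "{..<Dn}" "words M B"] sum.swap[of _ S "words M B"] sum.swap[of _ Y "words M B"] sum.swap[of _ Z "words M B"]
        sum.swap[of _ S "words {..<Dn} B"] sum.swap[of _ Y "words {..<Dn} B"] sum.swap[of _ Z "words {..<Dn} B"])
  also have "\<dots> = (\<Sum>m\<in>M. \<Sum>d<Dn. \<Sum>s'\<in>S. \<Sum>y\<in>Y. \<Sum>z\<in>Z. V (idx m s d k) s' y z *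
       (N * of_bool (\<delta> y s' \<noteq> idx m s d k) + (\<Sum>ms\<in>words M B. \<Sum>ds\<in>words {..<Dn} B. error_prob \<delta> ms s' ds ks')))"
    by (simp add: sum.distrib N[symmetric] mult.assoc flip: sum_distrib_left)
  also have "\<dots> \<le> (\<Sum>m\<in>M. \<Sum>d<Dn. \<Sum>s'\<in>S. \<Sum>y\<in>Y. \<Sum>z\<in>Z. V (idx m s d k) s' y z *
       (N * of_bool (\<delta> y s' \<noteq> idx m s d k) + N * (real B * index_error \<delta>)))"
    using Suc.IH[OF ks(2)] by (intro sum_mono mult_left_mono add_mono V_nonneg) (auto simp: N_def)
  also have "\<dots> = (\<Sum>m\<in>M. \<Sum>d<Dn. (\<lambda>l. N * (\<Sum>s'\<in>S. \<Sum>y\<in>Y. \<Sum>z\<in>Z. V l s' y z * of_bool (\<delta> y s' \<noteq> l))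
       + N * (real B * index_error \<delta>) * (\<Sum>s'\<in>S. \<Sum>y\<in>Y. \<Sum>z\<in>Z. V l s' y z)) (idx m s d k))"
    by (simp add: distrib_left sum.distrib sum_distrib_left mult_ac
        del: sum_of_bool_eq sum_of_bool_mult_eq sum_mult_of_bool_eq)
  also have "\<dots> = (\<Sum>l\<in>L. N * (\<Sum>s'\<in>S. \<Sum>y\<in>Y. \<Sum>z\<in>Z. V l s' y z * of_bool (\<delta> y s' \<noteq> l))
       + N * (real B * index_error \<delta>) * (\<Sum>s'\<in>S. \<Sum>y\<in>Y. \<Sum>z\<in>Z. V l s' y z))"
    using sum_idx[of "\<lambda>l. N * (\<Sum>s'\<in>S. \<Sum>y\<in>Y. \<Sum>z\<in>Z. V l s' y z * of_bool (\<delta> y s' \<noteq> l))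
       + N * (real B * index_error \<delta>) * (\<Sum>s'\<in>S. \<Sum>y\<in>Y. \<Sum>z\<in>Z. V l s' y z)" s k]
    unfolding L_def .
  also have "\<dots> = (\<Sum>l\<in>L. N * (\<Sum>s'\<in>S. \<Sum>y\<in>Y. \<Sum>z\<in>Z. V l s' y z * of_bool (\<delta> y s' \<noteq> l))
       + N * (real B * index_error \<delta>))"
    by (intro sum.cong refl) (simp add: V_sum L_def)
  also have "\<dots> = N * ((real q1 * real q2 * real Dn) * index_error \<delta>) + (real q1 * real q2 * real Dn) * (N * (real B * index_error \<delta>))"
    using pos by (simp add: sum.distrib index_error_def L_def card_cartesian_product flip: sum_distrib_left)
  finally show ?case by (simp add: N_def algebra_simps)
qed

text \<open>The codeword of a block is settled by the states of the block before it, so each letter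
  depends only on the past.\<close>

lemma codeword_causal:
  assumes C: "\<And>l. length (C l) = n" and "take i ss = take i ss'" "i < n * length ms"
  shows "codeword C ms s ds ks ss ! i = codeword C ms s ds ks ss' ! i"
  using assms(2,3)
proof (induction ms arbitrary: s ds ks ss ss' i)
  case (Cons m ms)
  show ?case
  proof (cases "i < n")
    case True
    then show ?thesis by (simp add: nth_append C)
  next
    case False
    have "take n (take i ss) = take n (take i ss')" "drop n (take i ss) = drop n (take i ss')"
      using Cons.prems(1) by simp_all
    then have *: "take n ss = take n ss'" "take (i - n) (drop n ss) = take (i - n) (drop n ss')"
      using False by (simp_all add: min_def drop_take)
    show ?thesis using Cons.IH[OF *(2)] Cons.prems(2) False by (simp add: nth_append C *(1))
  qed
qed simp

lemma memoryless_law_codeword: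
  assumes C: "\<And>l. length (C l) = n"
    and V: "\<And>l s y z. l \<in> {..<q1} \<times> {..<q2} \<times> {..<Dn} \<Longrightarrow> s \<in> S \<Longrightarrow> y \<in> Y \<Longrightarrow> z \<in> Z \<Longrightarrow> V l s y z = memoryless_law ps v (C l) s y z"
    and "ms \<in> words M B" "ds \<in> words {..<Dn} B" "ss \<in> words UNIV (n * B)" "ys \<in> words UNIV (n * B)" "zs \<in> words UNIV (n * B)"
  shows "memoryless_law ps v (codeword C ms s ds ks ss) ss ys zs = joint_law ms s ds ks ss ys zs"
  using assms(3-)
proof (induction B arbitrary: ms s ds ks ss ys zs)
  case 0
  then show ?case by (simp add: memoryless_law_def)
next
  case (Suc B)
  obtain m ms' d ds' where ms: "ms = m # ms'" "m \<in> M" "ms' \<in> words M B"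
    and ds: "ds = d # ds'" "d < Dn" "ds' \<in> words {..<Dn} B"
    using Suc.prems by (auto simp: words_Suc)
  have t: "take n ss \<in> S" "take n ys \<in> Y" "take n zs \<in> Z" 
    and dr: "drop n ss \<in> words UNIV (n * B)" "drop n ys \<in> words UNIV (n * B)" "drop n zs \<in> words UNIV (n * B)"
    using Suc.prems by (auto simp: words_def)
  have "memoryless_law ps v (codeword C ms s ds ks ss) (take n ss @ drop n ss) (take n ys @ drop n ys) (take n zs @ drop n zs)
     = joint_law ms s ds ks ss ys zs"
    unfolding ms ds codeword.simps joint_law.simps list.sel
    using t dr Suc.IH[OF ms(3) ds(3) dr] V[OF idx_in[OF ms(2) ds(2)] t]
    by (subst memoryless_law_append) (auto simp: C words_def)
  then show ?case by simp
qed

end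

section \<open>From block codes to wiretap codes\<close>

text \<open>I(M;Z) is the average of D(p m || Q) minus D(q || Q), where q is the output mixture. The
  subtracted term is nonnegative, so any reference \<open>Q\<close> bounds the leakage from above.
  The joint law is given through test functions, the form in which \<open>realization\<close>
  supplies it.\<close>

lemma centropy_uniform:
  fixes P :: "'w \<Rightarrow> real" and f :: "'w \<Rightarrow> nat" and p :: "nat \<Rightarrow> 'b \<Rightarrow> real"
  assumes fin: "finite A" "finite ZZ" and Mn: "0 < Mn"
    and law: "\<And>\<phi>. (\<Sum>w\<in>A. P w * \<phi> (f w) (g w)) = (\<Sum>m<Mn. \<Sum>z\<in>ZZ. p m z / real Mn * \<phi> m z)"
    and p: "\<And>m z. 0 \<le> p m z" "\<And>m. m < Mn \<Longrightarrow> (\<Sum>z\<in>ZZ. p m z) = 1"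
    and Q: "\<And>z. 0 \<le> Q z" "(\<Sum>z\<in>ZZ. Q z) = 1" "\<And>m z. m < Mn \<Longrightarrow> z \<in> ZZ \<Longrightarrow> Q z = 0 \<Longrightarrow> p m z = 0"
  shows "centropy P A f (\<lambda>_. ()) = log 2 (real Mn)"
    and "centropy P A f g \<ge> log 2 (real Mn) - (\<Sum>m<Mn. \<Sum>z\<in>ZZ. p m z * log 2 (p m z / Q z)) / real Mn"
proof -
  have prob: "prob_ev P A (\<lambda>v. h (f v) (g v)) = (\<Sum>m<Mn. \<Sum>z\<in>ZZ. p m z / real Mn * of_bool (h m z))" for h
  proof -
    have "prob_ev P A (\<lambda>v. h (f v) (g v)) = (\<Sum>w\<in>A. P w * of_bool (h (f w) (g w)))"
      unfolding prob_ev_def using fin by (simp add: sum.inter_filter of_bool_def if_distrib cong: if_cong)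
    also have "\<dots> = (\<Sum>m<Mn. \<Sum>z\<in>ZZ. p m z / real Mn * of_bool (h m z))"
      by (rule law[of "\<lambda>m z. of_bool (h m z)"])
    finally show ?thesis .
  qed
  have single: "(\<Sum>m<Mn. of_bool (m = a) * F m) = F a" if "a < Mn" for a and F :: "nat \<Rightarrow> real"
    using that by (simp add: of_bool_def if_distrib[of "\<lambda>x. x * _"] cong: if_cong)
  have singlez: "(\<Sum>z\<in>ZZ. of_bool (z = b) * F z) = F b" if "b \<in> ZZ" for b and F :: "'b \<Rightarrow> real"
    using that fin by (simp add: of_bool_def if_distrib[of "\<lambda>x. x * _"] cong: if_cong)
  have prob_msg: "prob_ev P A (\<lambda>v. f v = a) = 1 / real Mn" if "a < Mn" for a
  proof -
    have "prob_ev P A (\<lambda>v. f v = a) = (\<Sum>m<Mn. of_bool (m = a) * (\<Sum>z\<in>ZZ. p m z / real Mn))"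
      using prob[of "\<lambda>m z. m = a"] by (simp add: sum_distrib_left mult.commute)
    then show ?thesis using p(2)[OF that] by (simp add: single[OF that] flip: sum_divide_distrib)
  qed
  have pall: "prob_ev P A (\<lambda>v. True) = 1"
    using prob[of "\<lambda>m z. True"] Mn p(2) by (simp flip: sum_divide_distrib)
  have "centropy P A f (\<lambda>_. ()) = - (\<Sum>w\<in>A. P w * log 2 (prob_ev P A (\<lambda>v. f v = f w)))"
    by (simp add: centropy_def pall)
  also have "(\<Sum>w\<in>A. P w * log 2 (prob_ev P A (\<lambda>v. f v = f w)))
      = (\<Sum>m<Mn. \<Sum>z\<in>ZZ. p m z / real Mn * log 2 (prob_ev P A (\<lambda>v. f v = m)))"
    by (rule law[of "\<lambda>m z. log 2 (prob_ev P A (\<lambda>v. f v = m))"])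
  also have "\<dots> = (\<Sum>m<Mn. log 2 (1 / real Mn) / real Mn)"
    using p(2) by (intro sum.cong refl) (simp add: prob_msg flip: sum_distrib_right sum_divide_distrib)
  also have "\<dots> = - log 2 (real Mn)" using Mn by (simp add: log_divide)
  finally show "centropy P A f (\<lambda>_. ()) = log 2 (real Mn)" by simp
  define q where "q z = (\<Sum>m<Mn. p m z) / real Mn" for z
  have qn: "0 \<le> q z" for z by (simp add: q_def p sum_nonneg)
  have prob_both: "prob_ev P A (\<lambda>v. f v = a \<and> g v = b) = p a b / real Mn" if "a < Mn" "b \<in> ZZ" for a b
  proof -
    have "prob_ev P A (\<lambda>v. f v = a \<and> g v = b)
       = (\<Sum>m<Mn. of_bool (m = a) * (\<Sum>z\<in>ZZ. of_bool (z = b) * (p m z / real Mn)))"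
      using prob[of "\<lambda>m z. m = a \<and> z = b"] by (simp only: sum_distrib_left of_bool_conj mult_ac)
    then show ?thesis by (simp only: single[OF that(1)] singlez[OF that(2)])
  qed
  have prob_out: "prob_ev P A (\<lambda>v. g v = b) = q b" if "b \<in> ZZ" for b
  proof -
    have "prob_ev P A (\<lambda>v. g v = b) = (\<Sum>m<Mn. \<Sum>z\<in>ZZ. of_bool (z = b) * (p m z / real Mn))"
      using prob[of "\<lambda>m z. z = b"] by (simp only: mult_ac)
    then show ?thesis by (simp only: singlez[OF that]) (simp add: q_def sum_divide_distrib)
  qed
  have "centropy P A f g = - (\<Sum>m<Mn. \<Sum>z\<in>ZZ. p m z / real Mn * log 2 (prob_ev P A (\<lambda>v. f v = m \<and> g v = z)
           / prob_ev P A (\<lambda>v. g v = z)))"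
    unfolding centropy_def
    using law[of "\<lambda>m z. log 2 (prob_ev P A (\<lambda>v. f v = m \<and> g v = z) / prob_ev P A (\<lambda>v. g v = z))"] by simp
  also have "\<dots> = - (\<Sum>m<Mn. \<Sum>z\<in>ZZ. p m z / real Mn * (log 2 (p m z / Q z) - log 2 (real Mn) - log 2 (q z / Q z)))"
  proof (intro arg_cong[where f = uminus] sum.cong refl)
    fix m z assume mz: "m \<in> {..<Mn}" "z \<in> ZZ"
    show "p m z / real Mn * log 2 (prob_ev P A (\<lambda>v. f v = m \<and> g v = z) / prob_ev P A (\<lambda>v. g v = z))
       = p m z / real Mn * (log 2 (p m z / Q z) - log 2 (real Mn) - log 2 (q z / Q z))"
    proof (cases "p m z = 0")
      case False
      then have pp: "p m z > 0" using p(1)[of m z] by simp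
      have "p m z \<le> (\<Sum>m<Mn. p m z)" using mz p(1) by (intro member_le_sum) auto
      then have qq: "q z > 0" using pp Mn by (simp add: q_def)
      have "Q z \<noteq> 0" using Q(3)[of m z] mz False by auto
      then have QQ: "Q z > 0" using Q(1)[of z] by simp
      show ?thesis using mz pp qq QQ Mn by (simp add: prob_both prob_out log_divide log_mult)
    qed simp
  qed
  also have "\<dots> = log 2 (real Mn) - (\<Sum>m<Mn. \<Sum>z\<in>ZZ. p m z * log 2 (p m z / Q z)) / real Mn
       + (\<Sum>z\<in>ZZ. q z * log 2 (q z / Q z))"
  proof -
    have 1: "(\<Sum>m<Mn. \<Sum>z\<in>ZZ. p m z / real Mn * log 2 (real Mn)) = log 2 (real Mn)"
      using p(2) Mn by (simp flip: sum_distrib_right sum_divide_distrib)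
    have 2: "(\<Sum>m<Mn. \<Sum>z\<in>ZZ. p m z / real Mn * log 2 (q z / Q z)) = (\<Sum>z\<in>ZZ. q z * log 2 (q z / Q z))"
      by (subst sum.swap) (simp add: q_def sum_distrib_right sum_divide_distrib)
    have 3: "(\<Sum>m<Mn. \<Sum>z\<in>ZZ. p m z / real Mn * log 2 (p m z / Q z))
        = (\<Sum>m<Mn. \<Sum>z\<in>ZZ. p m z * log 2 (p m z / Q z)) / real Mn"
      by (simp add: sum_divide_distrib)
    show ?thesis
      by (simp only: right_diff_distrib sum_subtractf 1 2 3)
  qed
  finally have eq: "centropy P A f g = log 2 (real Mn) - (\<Sum>m<Mn. \<Sum>z\<in>ZZ. p m z * log 2 (p m z / Q z)) / real Mn
       + (\<Sum>z\<in>ZZ. q z * log 2 (q z / Q z))" .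
  have "(\<Sum>z\<in>ZZ. q z) = (\<Sum>m<Mn. \<Sum>z\<in>ZZ. p m z) / real Mn"
    unfolding q_def by (subst sum.swap) (simp add: sum_divide_distrib)
  then have "(\<Sum>z\<in>ZZ. q z) = 1" using p(2) Mn by simp
  moreover have "q z = 0" if "z \<in> ZZ" "Q z = 0" for z using Q(3) that by (simp add: q_def)
  ultimately have "0 \<le> (\<Sum>z\<in>ZZ. q z * log 2 (q z / Q z))"
    using fin Q qn by (intro KL_nonneg) auto
  then show "centropy P A f g \<ge> log 2 (real Mn) - (\<Sum>m<Mn. \<Sum>z\<in>ZZ. p m z * log 2 (p m z / Q z)) / real Mn"
    using eq by simp
qed

text \<open>Removing an element that is at least the average does not raise the average; repeat
  until \<open>k\<close> elements are left.\<close>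

lemma subset_below_average:
  fixes f :: "'a \<Rightarrow> real"
  assumes "finite F" "k \<le> card F"
  shows "\<exists>A\<subseteq>F. card A = k \<and> real (card F) * sum f A \<le> real k * sum f F"
  using assms
proof (induction "card F - k" arbitrary: F)
  case 0
  then show ?case by (intro exI[of _ F]) auto
next
  case (Suc j)
  then have c: "0 < card F" by simp
  then have ne: "F \<noteq> {}" by auto
  obtain x where x: "x \<in> F" "sum f F \<le> real (card F) * f x"
  proof -
    have "\<exists>x\<in>F. sum f F \<le> real (card F) * f x"
    proof (rule ccontr)
      assume "\<not> ?thesis"
      then have "(\<Sum>x\<in>F. real (card F) * f x) < (\<Sum>x\<in>F. sum f F)"
        using Suc.prems ne by (intro sum_strict_mono) auto
      then show False by (simp add: sum_distrib_left)
    qed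
    then show thesis using that by blast
  qed
  have cF: "card (F - {x}) = card F - 1" using x Suc.prems by simp
  have "j = card (F - {x}) - k" "finite (F - {x})" "k \<le> card (F - {x})"
    using Suc.hyps(2) Suc.prems cF by auto
  from Suc.hyps(1)[OF this] obtain A where
    A: "A \<subseteq> F - {x}" "card A = k" "real (card (F - {x})) * sum f A \<le> real k * sum f (F - {x})"
    by blast
  have s: "sum f (F - {x}) = sum f F - f x" using x Suc.prems by (simp add: sum_diff1)
  \<comment> \<open>The induction hypothesis carries the factor card F - 1, which must be cancelled;
    a singleton is therefore treated apart.\<close>
  show ?case
  proof (cases "card F = 1")
    case True
    then have "k = 0" using Suc.hyps(2) by simp
    then show ?thesis by (intro exI[of _ "{}"]) auto
  next
    case False
    define N where "N = real (card F)"
    have N: "N > 1" "real (card (F - {x})) = N - 1" using False c cF unfolding N_def by auto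
    have "N * sum f A * (N - 1) \<le> N * (real k * (sum f F - f x))"
      using A(3) N s by (simp add: mult.assoc mult_left_mono mult.commute[of _ "N - 1"])
    also have "\<dots> \<le> real k * (N - 1) * sum f F"
      using x(2) mult_left_mono[of "sum f F" "N * f x" "real k"] by (simp add: N_def algebra_simps)
    finally have "(N * sum f A) * (N - 1) \<le> (real k * sum f F) * (N - 1)" by (simp add: mult_ac)
    then have "N * sum f A \<le> real k * sum f F" using N(1) by simp
    then show ?thesis using A unfolding N_def by blast
  qed
qed

context block_code
begin

text \<open>Expurgation of the block messages to exactly \<open>Mn\<close> of them. In
  \<open>small\<close>, the summand log q2 pays for the first block, whose hash input is a fixed
  state and whose padded part counts as fully exposed.\<close>

lemma codes_from_blocks:
  fixes ps :: "'s \<Rightarrow> real" and W :: "'x::finite \<Rightarrow> 's \<Rightarrow> 'y \<times> 'z \<Rightarrow> real" and px :: "'t \<Rightarrow> 's \<Rightarrow> 'x \<Rightarrow> real"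
  assumes px: "\<And>t s. is_pmf (px t s)"
    and nB: "0 < n" "0 < B" and Kn: "log 2 (real Kn) \<le> real n * Rf"
    and C: "\<And>l. length (C l) = n"
    and V: "\<And>l s y z. l \<in> {..<q1} \<times> {..<q2} \<times> {..<Dn} \<Longrightarrow> s \<in> S \<Longrightarrow> y \<in> Y \<Longrightarrow> z \<in> Z
        \<Longrightarrow> V l s y z = memoryless_law ps (compose_channel px W) (C l) s y z"
    and Q: "\<And>z. 0 \<le> Q z" "(\<Sum>z\<in>Z. Q z) = 1"
    and Q0: "\<And>l z. l \<in> {..<q1} \<times> {..<q2} \<times> {..<Dn} \<Longrightarrow> z \<in> Z \<Longrightarrow> Q z = 0 \<Longrightarrow> Vz l z = 0"
    and Mn: "2 \<le> Mn" "Mn \<le> (q1 * q2) ^ B" and \<epsilon>: "0 < \<epsilon>"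
    and small: "real B * index_error \<delta> / \<epsilon> + (log 2 (real q2) + real B * (cover_leak Q + hash_leak)) / (\<epsilon> * log 2 (real Mn)) \<le> 1"
  shows "\<exists>K fb enc (dec :: 'y list \<Rightarrow> 's list \<Rightarrow> nat list \<Rightarrow> nat).
        let \<Omega> = (code_outcomes (n * B) Mn K :: (nat \<times> 's list \<times> nat list \<times> 'x list \<times> 'y list \<times> 'z list) set);
            P = code_pmf ps W (n * B) Mn fb enc
        in valid_feedback Rf (n * B) K fb \<and> valid_encoder (n * B) enc \<and>
           prob_ev P \<Omega> (\<lambda>(m, ss, ks, xs, ys, zs). dec ys ss ks \<noteq> m) \<le> \<epsilon> \<and>
           centropy P \<Omega> (\<lambda>(m, ss, ks, xs, ys, zs). m) (\<lambda>(m, ss, ks, xs, ys, zs). zs)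
             \<ge> (1 - \<epsilon>) * centropy P \<Omega> (\<lambda>(m, ss, ks, xs, ys, zs). m) (\<lambda>_. ())"
proof -
  define N where "N = n * B"
  \<comment> \<open>Stands in for the missing previous state of the first block.\<close>
  define s0 :: "'s list" where "s0 = replicate n undefined"
  define \<rho>0 :: "'s list \<Rightarrow> real" where "\<rho>0 s = of_bool (s = s0)" for s
  define KB where "KB = words {..<Kn} B"
  define DB where "DB = words {..<Dn} B"
  define F where "F = words M B"
  define errm where "errm ms = (\<Sum>ks\<in>KB. \<Sum>ds\<in>DB. error_prob \<delta> ms s0 ds ks) / (real Dn * real Kn) ^ B" for ms
  define dv where "dv ms = (\<Sum>zs\<in>words UNIV N. output_law ms s0 zs * log 2 (output_law ms s0 zs / block_ref Q B zs))" for ms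
  define lM where "lM = log 2 (real Mn)"
  \<comment> \<open>Error in units of \<open>\<epsilon>\<close> plus divergence in units of
    \<open>\<epsilon> * lM\<close>. Both contributions are nonnegative after summation over the
    chosen messages, so an average of at most 1 gives the two requirements at once.\<close>
  define f where "f ms = errm ms / \<epsilon> + dv ms / (\<epsilon> * lM)" for ms
  have N0: "0 < N" using nB by (simp add: N_def)
  have lM: "lM > 0" using Mn by (simp add: lM_def)
  have s0: "s0 \<in> S" by (simp add: s0_def words_def)
  have \<rho>0: "(\<Sum>s\<in>S. \<rho>0 s * h s) = h s0" for h
    using s0 by (simp add: \<rho>0_def of_bool_def if_distrib[of "\<lambda>x. x * _"] cong: if_cong)
  have \<rho>01: "(\<Sum>s\<in>S. \<rho>0 s) = 1" using \<rho>0[of "\<lambda>_. 1"] by simp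
  have mixed_law0: "mixed_law \<rho>0 ms zs = output_law ms s0 zs" for ms zs by (simp add: mixed_law_def \<rho>0)
  have finF: "finite F" by (simp add: F_def)
  have cFn: "card F = (q1 * q2) ^ B" by (simp add: F_def card_words card_cartesian_product)
  then have cF: "real (card F) = real ((q1 * q2) ^ B)" by simp
  have cF0: "real (card F) > 0" using pos by (simp add: cF)
  have cD: "real (card DB) = real Dn ^ B" by (simp add: DB_def card_words)
  have cK: "card KB = Kn ^ B" by (simp add: KB_def card_words)
  have dvsum: "(\<Sum>ms\<in>F. dv ms) \<le> real (card F) * (log 2 (real q2) + real B * (cover_leak Q + hash_leak))"
  proof -
    have "(\<Sum>ms\<in>F. dv ms) \<le> real (card F) * (keyleak \<rho>0 + real B * (cover_leak Q + hash_leak))"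
      unfolding dv_def F_def cF[unfolded F_def] mixed_law0[symmetric] N_def
      by (rule block_leakage[OF Q(1)]) (use Q0 \<rho>01 in \<open>auto simp: \<rho>0_def\<close>)
    moreover have "keyleak \<rho>0 \<le> log 2 (real q2)" by (rule keyleak_le) (auto simp: \<rho>01, simp add: \<rho>0_def)
    ultimately show ?thesis using cF0
      by (smt (verit) mult_left_mono)
  qed
  have errsum: "(\<Sum>ms\<in>F. errm ms) \<le> real (card F) * (real B * index_error \<delta>)"
  proof -
    have "(\<Sum>ms\<in>F. errm ms) = (\<Sum>ks\<in>KB. \<Sum>ms\<in>F. \<Sum>ds\<in>DB. error_prob \<delta> ms s0 ds ks) / (real Dn * real Kn) ^ B"
      by (simp add: errm_def sum.swap[of _ KB F] flip: sum_divide_distrib)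
    also have "\<dots> \<le> (\<Sum>ks\<in>KB. (real q1 * real q2 * real Dn) ^ B * (real B * index_error \<delta>)) / (real Dn * real Kn) ^ B"
      unfolding F_def DB_def KB_def by (intro divide_right_mono sum_mono block_error) auto
    also have "\<dots> = real (card F) * (real B * index_error \<delta>)"
      using pos by (simp add: cK cF power_mult_distrib)
    finally show ?thesis .
  qed
  have fsum: "(\<Sum>ms\<in>F. f ms) \<le> real (card F)"
  proof -
    have "(\<Sum>ms\<in>F. f ms) = (\<Sum>ms\<in>F. errm ms) / \<epsilon> + (\<Sum>ms\<in>F. dv ms) / (\<epsilon> * lM)"
      by (simp add: f_def sum.distrib sum_divide_distrib)
    also have "\<dots> \<le> real (card F) * (real B * index_error \<delta>) / \<epsilon> + real (card F) * (log 2 (real q2) + real B * (cover_leak Q + hash_leak)) / (\<epsilon> * lM)"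
      using errsum dvsum \<epsilon> lM by (intro add_mono divide_right_mono) auto
    also have "\<dots> = real (card F) * (real B * index_error \<delta> / \<epsilon> + (log 2 (real q2) + real B * (cover_leak Q + hash_leak)) / (\<epsilon> * log 2 (real Mn)))"
      by (simp add: lM_def distrib_left)
    also have "\<dots> \<le> real (card F) * 1" using small cF0 by (intro mult_left_mono) auto
    finally show ?thesis by simp
  qed
  have "Mn \<le> card F" using Mn(2) cFn by simp
  then obtain A where A: "A \<subseteq> F" "card A = Mn" "real (card F) * sum f A \<le> real Mn * sum f F"
    using subset_below_average[OF finF] by blast
  have "real (card F) * sum f A \<le> real (card F) * real Mn"
    using A(3) fsum mult_left_mono[OF fsum, of "real Mn"] by (simp add: mult.commute)
  then have fA: "sum f A \<le> real Mn" using cF0 by simp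
  have finA: "finite A" using A(1) finF finite_subset by blast
  obtain e where e: "bij_betw e {..<Mn} A"
    using ex_bij_betw_nat_finite[OF finA] A(2) by (auto simp: atLeast0LessThan)
  obtain \<kappa> where \<kappa>: "bij_betw \<kappa> {..<Kn ^ B} KB"
    using ex_bij_betw_nat_finite[of KB] cK by (auto simp: atLeast0LessThan KB_def)
  have eF: "e m \<in> words M B" if "m < Mn" for m
    using e A(1) that unfolding F_def bij_betw_def by blast
  \<comment> \<open>\<open>Mn\<close> need not equal \<open>(q1 * q2) ^ B\<close>: \<open>e\<close> maps the messages to a subset \<open>A\<close> of the block messages on
      which the combined error and divergence \<open>f\<close> is at most its overall average.\<close>
  define em where "em m = (if m < Mn then e m else replicate B (0, 0))" for m
  \<comment> \<open>The default outside the message range keeps every codeword at full length, since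
    causality is demanded for all \<open>m\<close>.\<close>
  have lem: "length (em m) = B" for m using eF[of m] by (auto simp: em_def words_def)
  define cw where "cw m ds k ss = codeword C (em m) s0 ds (\<kappa> k) ss" for m ds k ss
  define dec where "dec ys ss ks = the_inv_into {..<Mn} e (decode_blocks \<delta> (\<kappa> (hd ks)) s0 ss ys)" for ys ss ks
  have K2: "log 2 (real (Kn ^ B)) \<le> real N * Rf"
    using Kn nB pos by (simp add: log_nat_power N_def mult.assoc mult.left_commute[of "real n"] mult_left_mono)
  have DB: "finite DB" "DB \<noteq> {}" and K1: "1 \<le> Kn ^ B"
    using pos cD by (auto simp: DB_def)
  have causal: "cw m d k ss ! i = cw m d k ss' ! i" if "i < N" "take i ss = take i ss'" for m d k ss ss' i
    using that unfolding cw_def N_def by (intro codeword_causal C) (simp_all add: lem)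
  obtain K fb enc where vf: "valid_feedback Rf N K (fb :: nat \<Rightarrow> 'y list \<Rightarrow> nat list \<Rightarrow> nat \<Rightarrow> real)"
    and ve: "valid_encoder N (enc :: nat \<Rightarrow> nat \<Rightarrow> 'x list \<Rightarrow> 's list \<Rightarrow> nat list \<Rightarrow> 'x \<Rightarrow> real)"
    and law: "\<And>Mn \<phi>. (\<Sum>w\<in>code_outcomes N Mn K. code_pmf ps W N Mn fb enc w
              * (case w of (m, ss, ks, xs, ys, zs) \<Rightarrow> \<phi> m ss ks ys zs))
          = (\<Sum>m<Mn. \<Sum>k<Kn ^ B. \<Sum>d\<in>DB. \<Sum>ss\<in>words UNIV N. \<Sum>ys\<in>words UNIV N. \<Sum>zs\<in>words UNIV N.
              1 / (real Mn * real (Kn ^ B) * real (card DB))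
              * memoryless_law ps (compose_channel px W) (cw m d k ss) ss ys zs
              * \<phi> m ss (k # replicate (N - 1) 0) ys zs)"
    using realization[where cw = cw and px = px and ps = ps and W = W, OF px DB N0 K1 K2 causal] by blast
  define \<Omega> where "\<Omega> = (code_outcomes N Mn K :: (nat \<times> 's list \<times> nat list \<times> 'x list \<times> 'y list \<times> 'z list) set)"
  define P where "P = code_pmf ps W N Mn fb enc"
  have "finite (fbseqs N K)"
  proof -
    have "fbseqs N K \<subseteq> words (\<Union>i<N. {..<K i}) N"
      by (auto simp: fbseqs_def words_def in_set_conv_nth) blast
    then show ?thesis by (rule finite_subset) simp
  qed
  then have fin\<Omega>: "finite \<Omega>" by (simp add: \<Omega>_def code_outcomes_def lists_n_words)
  have law2: "(\<Sum>w\<in>\<Omega>. P w * (case w of (m, ss, ks, xs, ys, zs) \<Rightarrow> \<phi> m ss (hd ks) ys zs))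
     = (\<Sum>m<Mn. (\<Sum>k<Kn ^ B. \<Sum>d\<in>DB. \<Sum>ss\<in>words UNIV N. \<Sum>ys\<in>words UNIV N. \<Sum>zs\<in>words UNIV N.
          joint_law (e m) s0 d (\<kappa> k) ss ys zs * \<phi> m ss k ys zs) / (real Mn * (real Dn * real Kn) ^ B))" for \<phi>
  proof -
    have "(\<Sum>w\<in>\<Omega>. P w * (case w of (m, ss, ks, xs, ys, zs) \<Rightarrow> \<phi> m ss (hd ks) ys zs))
      = (\<Sum>m<Mn. \<Sum>k<Kn ^ B. \<Sum>d\<in>DB. \<Sum>ss\<in>words UNIV N. \<Sum>ys\<in>words UNIV N. \<Sum>zs\<in>words UNIV N.
              1 / (real Mn * real (Kn ^ B) * real (card DB))
              * memoryless_law ps (compose_channel px W) (cw m d k ss) ss ys zs * \<phi> m ss k ys zs)"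
      unfolding \<Omega>_def P_def using law[of Mn "\<lambda>m ss ks ys zs. \<phi> m ss (hd ks) ys zs"] by simp
    also have "\<dots> = (\<Sum>m<Mn. \<Sum>k<Kn ^ B. \<Sum>d\<in>DB. \<Sum>ss\<in>words UNIV N. \<Sum>ys\<in>words UNIV N. \<Sum>zs\<in>words UNIV N.
          joint_law (e m) s0 d (\<kappa> k) ss ys zs * \<phi> m ss k ys zs / (real Mn * (real Dn * real Kn) ^ B))"
    proof (intro sum.cong refl, goal_cases)
      case (1 m k d ss ys zs)
      then have "memoryless_law ps (compose_channel px W) (cw m d k ss) ss ys zs = joint_law (e m) s0 d (\<kappa> k) ss ys zs"
        unfolding cw_def em_def N_def DB_def by (auto intro!: memoryless_law_codeword[OF C V] eF)
      then show ?case by (simp add: cD power_mult_distrib mult_ac)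
    qed
    finally show ?thesis by (simp add: sum_divide_distrib)
  qed
  have Err: "prob_ev P \<Omega> (\<lambda>(m, ss, ks, xs, ys, zs). dec ys ss ks \<noteq> m) \<le> sum errm A / real Mn"
  proof -
    have "prob_ev P \<Omega> (\<lambda>(m, ss, ks, xs, ys, zs). dec ys ss ks \<noteq> m)
      = (\<Sum>w\<in>\<Omega>. P w * (case w of (m, ss, ks, xs, ys, zs) \<Rightarrow>
            of_bool (the_inv_into {..<Mn} e (decode_blocks \<delta> (\<kappa> (hd ks)) s0 ss ys) \<noteq> m)))"
      unfolding prob_ev_def sum.inter_filter[OF fin\<Omega>] by (intro sum.cong refl) (auto simp: dec_def)
    also have "\<dots> = (\<Sum>m<Mn. (\<Sum>k<Kn ^ B. \<Sum>d\<in>DB. \<Sum>ss\<in>words UNIV N. \<Sum>ys\<in>words UNIV N. \<Sum>zs\<in>words UNIV N.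
          joint_law (e m) s0 d (\<kappa> k) ss ys zs * of_bool (the_inv_into {..<Mn} e (decode_blocks \<delta> (\<kappa> k) s0 ss ys) \<noteq> m))
          / (real Mn * (real Dn * real Kn) ^ B))"
      by (rule law2)
    \<comment> \<open>As \<open>the_inv_into\<close> undoes \<open>e\<close>, a wrong final message
      forces a wrong list of block messages.\<close>
    also have "\<dots> \<le> (\<Sum>m<Mn. (\<Sum>k<Kn ^ B. \<Sum>d\<in>DB. \<Sum>ss\<in>words UNIV N. \<Sum>ys\<in>words UNIV N. \<Sum>zs\<in>words UNIV N.
          joint_law (e m) s0 d (\<kappa> k) ss ys zs * of_bool (decode_blocks \<delta> (\<kappa> k) s0 ss ys \<noteq> e m))
          / (real Mn * (real Dn * real Kn) ^ B))"
      using e by (intro sum_mono divide_right_mono mult_left_mono joint_law_nonneg)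
        (auto simp: bij_betw_def the_inv_into_f_f)
    also have "\<dots> = (\<Sum>m<Mn. (\<Sum>k<Kn ^ B. \<Sum>d\<in>DB. error_prob \<delta> (e m) s0 d (\<kappa> k)) / (real Mn * (real Dn * real Kn) ^ B))"
      using eF by (intro sum.cong refl arg_cong2[where f = "(/)"]) (auto simp: error_prob_def N_def words_def)
    also have "\<dots> = (\<Sum>m<Mn. errm (e m)) / real Mn"
      unfolding errm_def by (simp add: sum_divide_distrib sum.reindex_bij_betw[OF \<kappa>, symmetric] mult.commute)
    also have "\<dots> = sum errm A / real Mn" by (simp add: sum.reindex_bij_betw[OF e])
    finally show ?thesis .
  qed
  have law3: "(\<Sum>w\<in>\<Omega>. P w * \<phi> (case w of (m, ss, ks, xs, ys, zs) \<Rightarrow> m) (case w of (m, ss, ks, xs, ys, zs) \<Rightarrow> zs))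
     = (\<Sum>m<Mn. \<Sum>zs\<in>words UNIV N. output_law (em m) s0 zs / real Mn * \<phi> m zs)" for \<phi>
  proof -
    have "(\<Sum>w\<in>\<Omega>. P w * \<phi> (case w of (m, ss, ks, xs, ys, zs) \<Rightarrow> m) (case w of (m, ss, ks, xs, ys, zs) \<Rightarrow> zs))
      = (\<Sum>w\<in>\<Omega>. P w * (case w of (m, ss, ks, xs, ys, zs) \<Rightarrow> \<phi> m zs))"
      by (intro sum.cong refl) (auto split: prod.splits)
    also have "\<dots> = (\<Sum>m<Mn. (\<Sum>k<Kn ^ B. \<Sum>d\<in>DB. \<Sum>ss\<in>words UNIV N. \<Sum>ys\<in>words UNIV N. \<Sum>zs\<in>words UNIV N.
          joint_law (e m) s0 d (\<kappa> k) ss ys zs * \<phi> m zs) / (real Mn * (real Dn * real Kn) ^ B))"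
      by (rule law2)
    also have "\<dots> = (\<Sum>m<Mn. (\<Sum>ks\<in>KB. \<Sum>d\<in>DB. \<Sum>ss\<in>words UNIV N. \<Sum>ys\<in>words UNIV N. \<Sum>zs\<in>words UNIV N.
          joint_law (e m) s0 d ks ss ys zs * \<phi> m zs) / (real Mn * (real Dn * real Kn) ^ B))"
      by (simp add: sum.reindex_bij_betw[OF \<kappa>, symmetric])
    also have "\<dots> = (\<Sum>m<Mn. \<Sum>zs\<in>words UNIV N. (\<Sum>ds\<in>DB. \<Sum>ks\<in>KB. \<Sum>ss\<in>words UNIV N. \<Sum>ys\<in>words UNIV N.
          joint_law (e m) s0 ds ks ss ys zs) * \<phi> m zs / (real Mn * (real Dn * real Kn) ^ B))"
      by (simp add: sum_distrib_right sum_divide_distrib sum.swap[of _ "words UNIV N :: 'z list set" "words UNIV N :: 'y list set"]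
         sum.swap[of _ "words UNIV N :: 'z list set" "words UNIV N :: 's list set"]
         sum.swap[of _ "words UNIV N :: 'z list set" DB] sum.swap[of _ "words UNIV N :: 'z list set" KB]
         sum.swap[of _ DB KB])
    also have "\<dots> = (\<Sum>m<Mn. \<Sum>zs\<in>words UNIV N. output_law (em m) s0 zs / real Mn * \<phi> m zs)"
      unfolding output_law_joint_law lem by (simp add: DB_def KB_def N_def em_def mult.commute)
    finally show ?thesis .
  qed
  have p1: "(\<Sum>zs\<in>words UNIV N. output_law (em m) s0 zs) = 1" if "m < Mn" for m
    using output_law_sum[OF eF[OF that], of s0] that by (simp add: em_def N_def)
  have pQ: "output_law (em m) s0 zs = 0" if "m < Mn" "zs \<in> words UNIV N" "block_ref Q B zs = 0" for m zs
    using Q0 by (rule block_ref_eq_0[where Q = Q and B = B]) (use that eF in \<open>auto simp: em_def N_def\<close>)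
  have Qbs: "(\<Sum>zs\<in>words UNIV N. block_ref Q B zs) = 1" using block_ref_sum[OF Q(2)] by (simp add: N_def)
  have dvn: "0 \<le> dv (em m)" if "m < Mn" for m
    unfolding dv_def using pQ[OF that] p1[OF that] Qbs
    by (intro KL_nonneg) (auto simp: output_law_nonneg block_ref_nonneg Q)
  note ent = centropy_uniform[OF fin\<Omega> _ _ law3, of "block_ref Q B"]
  have ent1: "centropy P \<Omega> (\<lambda>(m, ss, ks, xs, ys, zs). m) (\<lambda>_. ()) = lM"
    unfolding lM_def using Mn pQ p1 Qbs by (intro ent(1)) (auto simp: output_law_nonneg block_ref_nonneg Q)
  have ent2: "centropy P \<Omega> (\<lambda>(m, ss, ks, xs, ys, zs). m) (\<lambda>(m, ss, ks, xs, ys, zs). zs)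
      \<ge> lM - (\<Sum>m<Mn. dv (em m)) / real Mn"
    unfolding lM_def dv_def using Mn pQ p1 Qbs by (intro ent(2)) (auto simp: output_law_nonneg block_ref_nonneg Q)
  have dvA: "(\<Sum>m<Mn. dv (em m)) = sum dv A"
    by (simp add: em_def sum.reindex_bij_betw[OF e, symmetric])
  have n1: "0 \<le> sum errm A"
    unfolding errm_def error_prob_def by (intro sum_nonneg divide_nonneg_nonneg mult_nonneg_nonneg joint_law_nonneg) auto
  have n2: "0 \<le> sum dv A" unfolding dvA[symmetric] by (intro sum_nonneg dvn) auto
  have fA': "sum errm A / \<epsilon> + sum dv A / (\<epsilon> * lM) \<le> real Mn"
    using fA by (simp add: f_def sum.distrib sum_divide_distrib)
  have "0 \<le> sum errm A / \<epsilon>" "0 \<le> sum dv A / (\<epsilon> * lM)"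
    using n1 n2 \<epsilon> lM by simp_all
  with fA' have "sum errm A / \<epsilon> \<le> real Mn" "sum dv A / (\<epsilon> * lM) \<le> real Mn"
    by linarith+
  then have b1: "sum errm A / real Mn \<le> \<epsilon>" and b2: "sum dv A / real Mn \<le> \<epsilon> * lM"
    using \<epsilon> lM Mn by (simp_all add: divide_simps mult_ac)
  have "prob_ev P \<Omega> (\<lambda>(m, ss, ks, xs, ys, zs). dec ys ss ks \<noteq> m) \<le> \<epsilon>" using Err b1 by linarith
  moreover have "centropy P \<Omega> (\<lambda>(m, ss, ks, xs, ys, zs). m) (\<lambda>(m, ss, ks, xs, ys, zs). zs)
             \<ge> (1 - \<epsilon>) * centropy P \<Omega> (\<lambda>(m, ss, ks, xs, ys, zs). m) (\<lambda>_. ())"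
    using ent2 b2 unfolding ent1 dvA by (simp add: algebra_simps)
  ultimately show ?thesis
    using vf ve unfolding Let_def \<Omega>_def P_def N_def by blast
qed

end

section \<open>Random coding with pairwise independence\<close>

text \<open>Probability of the table \<open>c\<close> when its entries are independent of law
  \<open>q\<close>; used for the codebook and, with uniform \<open>q\<close>, for the hash.\<close>

definition product_weight :: "('a \<Rightarrow> real) \<Rightarrow> 'i set \<Rightarrow> ('i \<Rightarrow> 'a) \<Rightarrow> real" where
  "product_weight q I c = (\<Prod>i\<in>I. q (c i))"

lemma product_weight_nonneg: "(\<And>a. 0 \<le> q a) \<Longrightarrow> 0 \<le> product_weight q I c"
  unfolding product_weight_def by (simp add: prod_nonneg)

lemma product_weight_eq_0: "finite I \<Longrightarrow> i \<in> I \<Longrightarrow> q (c i) = 0 \<Longrightarrow> product_weight q I c = 0"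
  unfolding product_weight_def by (rule prod_zero) auto

text \<open>Independence of two entries: \<open>F\<close> and \<open>G\<close> are absorbed into
  coordinates \<open>i\<close> and \<open>j\<close> of a product, and the sum over tables is taken
  coordinatewise.\<close>

lemma sum_product_weight_two:
  assumes "finite I" "finite A" "(\<Sum>a\<in>A. q a) = 1" "i \<in> I" "j \<in> I" "i \<noteq> j"
  shows "(\<Sum>c\<in>I \<rightarrow>\<^sub>E A. product_weight q I c * (F (c i) * G (c j))) = (\<Sum>a\<in>A. q a * F a) * (\<Sum>a\<in>A. q a * G a)"
proof -
  define h where "h l a = q a * ((if l = i then F a else 1) * (if l = j then G a else 1))" for l a
  have one: "(\<Prod>l\<in>I. if l = i then x else 1) = x" "(\<Prod>l\<in>I. if l = j then x else 1) = x" for x :: real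
    using assms by simp_all
  have "(\<Prod>l\<in>I. h l (c l)) = product_weight q I c * (F (c i) * G (c j))" for c
  proof -
    have "(\<Prod>l\<in>I. h l (c l)) = product_weight q I c * ((\<Prod>l\<in>I. if l = i then F (c i) else 1) * (\<Prod>l\<in>I. if l = j then G (c j) else 1))"
      by (simp add: h_def product_weight_def prod.distrib cong: if_cong)
    then show ?thesis by (simp only: one)
  qed
  then have "(\<Sum>c\<in>I \<rightarrow>\<^sub>E A. product_weight q I c * (F (c i) * G (c j))) = (\<Prod>l\<in>I. \<Sum>a\<in>A. h l a)"
    using prod_sum_PiE[of I "\<lambda>_. A" h] assms by simp
  also have "\<dots> = (\<Prod>l\<in>I. (if l = i then \<Sum>a\<in>A. q a * F a else 1) * (if l = j then \<Sum>a\<in>A. q a * G a else 1))"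
    using assms by (intro prod.cong) (auto simp: h_def)
  also have "\<dots> = (\<Sum>a\<in>A. q a * F a) * (\<Sum>a\<in>A. q a * G a)"
    by (simp only: prod.distrib one)
  finally show ?thesis .
qed

lemma sum_product_weight_one:
  assumes "finite I" "finite A" "(\<Sum>a\<in>A. q a) = 1" "i \<in> I"
  shows "(\<Sum>c\<in>I \<rightarrow>\<^sub>E A. product_weight q I c * F (c i)) = (\<Sum>a\<in>A. q a * F a)"
proof -
  define h where "h l a = q a * (if l = i then F a else 1)" for l a
  have one: "(\<Prod>l\<in>I. if l = i then x else 1) = x" for x :: real
    using assms by simp
  have "(\<Prod>l\<in>I. h l (c l)) = product_weight q I c * F (c i)" for c
  proof -
    have "(\<Prod>l\<in>I. h l (c l)) = product_weight q I c * (\<Prod>l\<in>I. if l = i then F (c i) else 1)"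
      by (simp add: h_def product_weight_def prod.distrib cong: if_cong)
    then show ?thesis by (simp only: one)
  qed
  then have "(\<Sum>c\<in>I \<rightarrow>\<^sub>E A. product_weight q I c * F (c i)) = (\<Prod>l\<in>I. \<Sum>a\<in>A. h l a)"
    using prod_sum_PiE[of I "\<lambda>_. A" h] assms by simp
  also have "\<dots> = (\<Prod>l\<in>I. if l = i then \<Sum>a\<in>A. q a * F a else 1)"
    using assms by (intro prod.cong) (auto simp: h_def)
  finally show ?thesis by (simp only: one)
qed

lemma sum_product_weight:
  assumes "finite I" "finite A" "(\<Sum>a\<in>A. q a) = 1"
  shows "(\<Sum>c\<in>I \<rightarrow>\<^sub>E A. product_weight q I c) = 1"
  using prod_sum_PiE[of I "\<lambda>_. A" "\<lambda>_. q"] assms by (simp add: product_weight_def)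

text \<open>Positive weight is part of the conclusion, because a codeword of probability zero could
  put mass where the reference law vanishes.\<close>

lemma exists_below_mean:
  fixes F :: "'a \<Rightarrow> real"
  assumes "finite X" "\<And>x. x \<in> X \<Longrightarrow> 0 \<le> w x" "(\<Sum>x\<in>X. w x) = 1" "(\<Sum>x\<in>X. w x * F x) \<le> c"
  shows "\<exists>x\<in>X. 0 < w x \<and> F x \<le> c"
proof (rule ccontr)
  assume neg: "\<not> ?thesis"
  have "\<exists>x\<in>X. w x \<noteq> 0" using assms(3) by (metis sum.neutral zero_neq_one)
  then obtain x where x: "x \<in> X" "0 < w x" using assms(2) by (metis order_le_less)
  have "(\<Sum>x\<in>X. w x * c) < (\<Sum>x\<in>X. w x * F x)"
  proof (rule sum_strict_mono_ex1)
    show "\<forall>x\<in>X. w x * c \<le> w x * F x"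
      using neg assms(2) by (metis less_eq_real_def linorder_not_less mult_left_mono mult_zero_left)
    show "\<exists>x\<in>X. w x * c < w x * F x" using neg x by (intro bexI[of _ x]) auto
  qed fact
  then show False using assms(3,4) by (simp flip: sum_distrib_right)
qed

text \<open>The contribution of one codeword and one output to the expected divergence between a
  group law and the mean law \<open>Q\<close>; in the ratio inside the logarithm, the codeword
  itself contributes k / (card G * Q) and the others together at most 1 on average.\<close>

lemma soft_covering_pointwise:
  fixes q k :: "'t \<Rightarrow> real"
  assumes fin: "finite L" "finite T" and G: "G \<subseteq> L" "l \<in> G"
    and q: "\<And>t. 0 \<le> q t" "(\<Sum>t\<in>T. q t) = 1" and k: "\<And>t. 0 \<le> k t"
    and Q: "Q = (\<Sum>t\<in>T. q t * k t)"
  shows "(\<Sum>C\<in>L \<rightarrow>\<^sub>E T. product_weight q L C * (k (C l) * log 2 ((\<Sum>i\<in>G. k (C i)) / real (card G) / Q)))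
     \<le> (\<Sum>t\<in>T. q t * (k t * log 2 (1 + k t / (real (card G) * Q))))" (is "?l \<le> ?r")
proof (cases "Q = 0")
  case True
  then have z: "q t * k t = 0" if "t \<in> T" for t
    using that fin q k unfolding Q by (simp add: sum_nonneg_eq_0_iff)
  have "product_weight q L C * (k (C l) * log 2 ((\<Sum>i\<in>G. k (C i)) / real (card G) / Q)) = 0" if "C \<in> L \<rightarrow>\<^sub>E T" for C
    using z[of "C l"] product_weight_eq_0[OF fin(1), of l q C] G that by (auto simp: PiE_def Pi_def)
  then have "?l = 0" by (intro sum.neutral ballI)
  moreover have "?r = 0" using z by (intro sum.neutral ballI) auto
  ultimately show ?thesis by linarith
next
  case False
  have "0 \<le> Q" unfolding Q by (intro sum_nonneg mult_nonneg_nonneg q k)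
  then have Q0: "Q > 0" using False by simp
  have finG: "finite G" using G fin finite_subset by blast
  define N where "N = real (card G)"
  have N: "N \<ge> 1" using finG G by (simp add: N_def Suc_le_eq card_gt_0_iff) blast
  \<comment> \<open>Bounds the mean of \<open>R C\<close> given that the codeword of
    \<open>l\<close> is \<open>t\<close>: its own term, plus at most 1 for all the others.\<close>
  define c where "c t = 1 + k t / (N * Q)" for t
  have c: "c t > 0" for t using N Q0 k[of t] by (simp add: c_def add_pos_nonneg)
  define R where "R C = (\<Sum>i\<in>G. k (C i)) / N / Q" for C
  \<comment> \<open>The tangent of the logarithm at a point depending only on \<open>C l\<close> replaces Jensen's inequality
      conditionally on \<open>C l\<close>, so that only pairs of codewords need to be independent.\<close>
  have pt: "k (C l) * log 2 (R C) \<le> k (C l) * log 2 (c (C l)) + (k (C l) / c (C l) * R C - k (C l)) / ln 2" for C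
  proof (cases "k (C l) = 0")
    case False
    then have kp: "k (C l) > 0" using k[of "C l"] by simp
    have "k (C l) \<le> (\<Sum>i\<in>G. k (C i))" using finG G k by (intro member_le_sum) auto
    then have "R C > 0" using kp N Q0 by (simp add: R_def)
    then have "k (C l) * log 2 (R C) \<le> k (C l) * (log 2 (c (C l)) + (R C / c (C l) - 1) / ln 2)"
      using kp c by (intro mult_left_mono log2_le_tangent) auto
    also have "\<dots> = k (C l) * log 2 (c (C l)) + (k (C l) / c (C l) * R C - k (C l)) / ln 2"
      by (simp add: algebra_simps diff_divide_distrib)
    finally show ?thesis .
  qed simp
  have kc: "k t / c t * (k t / (N * Q) + 1) = k t" for t
    using c[of t] by (simp add: c_def add.commute)
  have ER: "(\<Sum>C\<in>L \<rightarrow>\<^sub>E T. product_weight q L C * (k (C l) / c (C l) * R C)) \<le> Q"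
  proof -
    define a where "a = (\<Sum>t\<in>T. q t * (k t / c t))"
    have a0: "0 \<le> a" unfolding a_def using q k c by (simp add: sum_nonneg less_imp_le)
    have "(\<Sum>C\<in>L \<rightarrow>\<^sub>E T. product_weight q L C * (k (C l) / c (C l) * R C))
      = (\<Sum>i\<in>G. \<Sum>C\<in>L \<rightarrow>\<^sub>E T. product_weight q L C * ((k (C l) / c (C l)) * k (C i))) / (N * Q)"
      by (subst sum.swap) (simp add: R_def sum_distrib_left sum_divide_distrib mult_ac)
    also have "(\<Sum>i\<in>G. \<Sum>C\<in>L \<rightarrow>\<^sub>E T. product_weight q L C * ((k (C l) / c (C l)) * k (C i)))
       = (\<Sum>C\<in>L \<rightarrow>\<^sub>E T. product_weight q L C * ((k (C l) / c (C l)) * k (C l)))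
        + (\<Sum>i\<in>G - {l}. \<Sum>C\<in>L \<rightarrow>\<^sub>E T. product_weight q L C * ((k (C l) / c (C l)) * k (C i)))"
      using finG G by (simp add: sum.remove)
    also have "(\<Sum>C\<in>L \<rightarrow>\<^sub>E T. product_weight q L C * ((k (C l) / c (C l)) * k (C l))) = (\<Sum>t\<in>T. q t * (k t / c t * k t))"
      using G by (intro sum_product_weight_one[OF fin q(2), of l "\<lambda>t. k t / c t * k t"]) auto
    also have "(\<Sum>i\<in>G - {l}. \<Sum>C\<in>L \<rightarrow>\<^sub>E T. product_weight q L C * ((k (C l) / c (C l)) * k (C i))) = (\<Sum>i\<in>G - {l}. a * Q)"
      using G unfolding a_def Q by (intro sum.cong refl sum_product_weight_two[OF fin q(2), of l _ "\<lambda>t. k t / c t" k]) auto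
    also have "\<dots> \<le> N * (a * Q)"
      using a0 Q0 finG G N by (simp add: N_def card_Diff_subset mult_right_mono)
    finally have "(\<Sum>C\<in>L \<rightarrow>\<^sub>E T. product_weight q L C * (k (C l) / c (C l) * R C))
       \<le> ((\<Sum>t\<in>T. q t * (k t / c t * k t)) + N * (a * Q)) / (N * Q)"
      using N Q0 by (simp add: divide_right_mono)
    also have "\<dots> = (\<Sum>t\<in>T. q t * (k t / c t * k t)) / (N * Q) + a" using N Q0 by (simp add: add_divide_distrib)
    also have "\<dots> = (\<Sum>t\<in>T. q t * (k t / c t * (k t / (N * Q) + 1)))"
      by (simp add: a_def distrib_left sum.distrib sum_divide_distrib)
    also have "\<dots> = Q" by (simp only: kc Q[symmetric])
    finally show ?thesis .
  qed
  have "(\<Sum>C\<in>L \<rightarrow>\<^sub>E T. product_weight q L C * (k (C l) * log 2 (R C)))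
    \<le> (\<Sum>C\<in>L \<rightarrow>\<^sub>E T. product_weight q L C * (k (C l) * log 2 (c (C l)) + (k (C l) / c (C l) * R C - k (C l)) / ln 2))"
    by (intro sum_mono mult_left_mono pt product_weight_nonneg q)
  also have "\<dots> = (\<Sum>C\<in>L \<rightarrow>\<^sub>E T. product_weight q L C * (k (C l) * log 2 (c (C l))))
      + ((\<Sum>C\<in>L \<rightarrow>\<^sub>E T. product_weight q L C * (k (C l) / c (C l) * R C)) - (\<Sum>C\<in>L \<rightarrow>\<^sub>E T. product_weight q L C * k (C l))) / ln 2"
    by (simp only: distrib_left right_diff_distrib diff_divide_distrib sum.distrib sum_subtractf times_divide_eq_right sum_divide_distrib)
  \<comment> \<open>The mean of \<open>k (C l)\<close> is \<open>Q\<close>, so by \<open>ER\<close>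
    the linear correction is nonpositive.\<close>
  also have "\<dots> \<le> (\<Sum>C\<in>L \<rightarrow>\<^sub>E T. product_weight q L C * (k (C l) * log 2 (c (C l))))"
    using ER sum_product_weight_one[OF fin q(2), of l k] G by (auto simp: Q divide_nonpos_pos)
  also have "\<dots> = (\<Sum>t\<in>T. q t * (k t * log 2 (c t)))"
    using G by (intro sum_product_weight_one[OF fin q(2), of l "\<lambda>t. k t * log 2 (c t)"]) auto
  finally show ?thesis by (simp add: R_def c_def N_def)
qed

text \<open>A random table hides its input in mean divergence. The argument parallels soft covering:
  at the value taken by an input \<open>i\<close>, the normalised key probability consists of the
  mass of \<open>i\<close> itself and of collisions, which contribute at most 1 on average.\<close>

lemma leftover_hash:
  fixes \<rho> :: "'s \<Rightarrow> real"
  assumes fin: "finite S" and q2: "0 < q2" and Kn: "0 < Kn"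
    and \<rho>: "\<And>s. 0 \<le> \<rho> s" "(\<Sum>s\<in>S. \<rho> s) = 1"
    and kd: "\<And>h m a. kd h m a = (\<Sum>s\<in>S. \<Sum>k<Kn. \<rho> s * of_bool ((m + h (s, k)) mod q2 = a) / real Kn)"
  shows "(\<Sum>h\<in>(S \<times> {..<Kn}) \<rightarrow>\<^sub>E {..<q2}. product_weight (\<lambda>_. 1 / real q2) (S \<times> {..<Kn}) h *
       ((\<Sum>m<q2. \<Sum>a<q2. kd h m a * log 2 (real q2 * kd h m a)) / real q2))
     \<le> (\<Sum>s\<in>S. \<rho> s * log 2 (1 + real q2 * \<rho> s / real Kn))"
proof -
  define I where "I = S \<times> {..<Kn}"
  define H where "H = I \<rightarrow>\<^sub>E {..<q2}"
  define w where "w h = product_weight (\<lambda>_. 1 / real q2) I h" for h :: "'s \<times> nat \<Rightarrow> nat"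
  have finI: "finite I" using fin by (simp add: I_def)
  have u: "(\<Sum>a<q2. 1 / real q2) = 1" using q2 by simp
  have wn: "0 \<le> w h" for h unfolding w_def by (rule product_weight_nonneg) simp
  have wsum: "(\<Sum>h\<in>H. w h) = 1" unfolding w_def H_def by (rule sum_product_weight[OF finI _ u]) simp
  define b where "b h m i = (m + h i) mod q2" for h :: "'s \<times> nat \<Rightarrow> nat" and m i
  have blt: "b h m i < q2" for h m i using q2 by (simp add: b_def)
  have kdI: "kd h m a = (\<Sum>i\<in>I. \<rho> (fst i) / real Kn * of_bool (b h m i = a))" for h m a
    by (simp add: kd I_def b_def sum.cartesian_product' del: sum_of_bool_eq sum_of_bool_mult_eq sum_mult_of_bool_eq)
  \<comment> \<open>The only randomness used: two distinct inputs collide with probability 1 /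
    q2.\<close>
  have coll: "(\<Sum>h\<in>H. w h * of_bool (b h m j = b h m i)) = 1 / real q2" if "i \<in> I" "j \<in> I" "i \<noteq> j" for i j m
  proof -
    have e: "of_bool (b h m j = b h m i) = (\<Sum>a<q2. of_bool (b h m i = a) * of_bool (b h m j = a) :: real)" for h
      using blt by (simp add: of_bool_def if_distrib[of "\<lambda>x. x * _"] cong: if_cong)
    have s1: "(\<Sum>x<q2. 1 / real q2 * of_bool ((m + x) mod q2 = a)) = 1 / real q2" if "a < q2" for a
      using sum_mod_shift[OF q2, of "\<lambda>y. 1 / real q2 * of_bool (y = a)" m] that
      by (simp add: add.commute of_bool_def flip: sum_divide_distrib)
    have "(\<Sum>h\<in>H. w h * of_bool (b h m j = b h m i))
      = (\<Sum>a<q2. \<Sum>h\<in>H. w h * (of_bool (b h m i = a) * of_bool (b h m j = a)))"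
      unfolding e sum_distrib_left by (rule sum.swap)
    also have "\<dots> = (\<Sum>a<q2. (\<Sum>x<q2. 1 / real q2 * of_bool ((m + x) mod q2 = a)) * (\<Sum>x<q2. 1 / real q2 * of_bool ((m + x) mod q2 = a)))"
      unfolding b_def w_def H_def
      by (intro sum.cong refl sum_product_weight_two[OF finI _ u that, of "\<lambda>x. of_bool ((m + x) mod q2 = _)" "\<lambda>x. of_bool ((m + x) mod q2 = _)"]) simp
    also have "\<dots> = (\<Sum>a<q2. 1 / real q2 * (1 / real q2))" by (intro sum.cong refl) (simp only: s1 lessThan_iff)
    also have "\<dots> = 1 / real q2" using q2 by simp
    finally show ?thesis .
  qed
  have one: "(\<Sum>h\<in>H. w h * log 2 (real q2 * kd h m (b h m i))) \<le> log 2 (1 + real q2 * \<rho> (fst i) / real Kn)"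
    if i: "i \<in> I" "0 < \<rho> (fst i)" for i m
  proof -
    define c where "c = 1 + real q2 * \<rho> (fst i) / real Kn"
    have c: "c > 0" using \<rho>(1)[of "fst i"] by (simp add: c_def add_pos_nonneg)
    have pos: "kd h m (b h m i) > 0" for h
    proof -
      have "\<rho> (fst i) / real Kn * of_bool (b h m i = b h m i) \<le> kd h m (b h m i)"
        unfolding kdI using finI i \<rho> by (intro member_le_sum) auto
      moreover have "0 < \<rho> (fst i) / real Kn" using i(2) Kn by simp
      ultimately show ?thesis by simp
    qed
    have "(\<Sum>h\<in>H. w h * (real q2 * kd h m (b h m i)))
       = (\<Sum>j\<in>I. real q2 * \<rho> (fst j) / real Kn * (\<Sum>h\<in>H. w h * of_bool (b h m j = b h m i)))"
      unfolding kdI sum_distrib_left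
      by (subst sum.swap) (intro sum.cong refl, simp)
    also have "\<dots> = real q2 * \<rho> (fst i) / real Kn * (\<Sum>h\<in>H. w h * of_bool (b h m i = b h m i))
       + (\<Sum>j\<in>I - {i}. real q2 * \<rho> (fst j) / real Kn * (\<Sum>h\<in>H. w h * of_bool (b h m j = b h m i)))"
      using finI i(1) by (rule sum.remove)
    also have "(\<Sum>j\<in>I - {i}. real q2 * \<rho> (fst j) / real Kn * (\<Sum>h\<in>H. w h * of_bool (b h m j = b h m i)))
       = (\<Sum>j\<in>I - {i}. \<rho> (fst j) / real Kn)"
      using q2 i(1) by (intro sum.cong refl) (subst coll, auto)
    also have "\<dots> \<le> (\<Sum>j\<in>I. \<rho> (fst j) / real Kn)"
      using finI \<rho>(1) by (intro sum_mono2) auto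
    also have "\<dots> = 1" using Kn \<rho>(2) by (simp add: I_def sum.cartesian_product')
    finally have E: "(\<Sum>h\<in>H. w h * (real q2 * kd h m (b h m i))) \<le> c"
      by (simp add: wsum c_def)
    have "(\<Sum>h\<in>H. w h * log 2 (real q2 * kd h m (b h m i)))
      \<le> (\<Sum>h\<in>H. w h * (log 2 c + (real q2 * kd h m (b h m i) / c - 1) / ln 2))"
      using pos q2 c by (intro sum_mono mult_left_mono wn log2_le_tangent) auto
    also have "\<dots> = (\<Sum>h\<in>H. w h) * log 2 c + ((\<Sum>h\<in>H. w h * (real q2 * kd h m (b h m i))) / c - (\<Sum>h\<in>H. w h)) / ln 2"
      by (simp only: distrib_left right_diff_distrib diff_divide_distrib sum.distrib sum_subtractf times_divide_eq_right
          sum_divide_distrib sum_distrib_right mult_1_right divide_divide_eq_left)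
    also have "\<dots> \<le> log 2 c" using E c by (simp add: wsum divide_nonpos_pos)
    finally show ?thesis by (simp add: c_def)
  qed
  \<comment> \<open>Trade the sum over key values for a sum over inputs, so that each logarithm is
    attached to one input.\<close>
  have kdlog: "(\<Sum>a<q2. kd h m a * log 2 (real q2 * kd h m a)) = (\<Sum>i\<in>I. \<rho> (fst i) / real Kn * log 2 (real q2 * kd h m (b h m i)))" for h m
  proof -
    have "(\<Sum>a<q2. kd h m a * log 2 (real q2 * kd h m a))
       = (\<Sum>a<q2. (\<Sum>i\<in>I. \<rho> (fst i) / real Kn * of_bool (b h m i = a)) * log 2 (real q2 * kd h m a))"
      by (simp only: kdI[symmetric])
    also have "\<dots> = (\<Sum>a<q2. \<Sum>i\<in>I. \<rho> (fst i) / real Kn * (of_bool (b h m i = a) * log 2 (real q2 * kd h m a)))"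
      by (simp only: sum_distrib_right mult.assoc)
    also have "\<dots> = (\<Sum>i\<in>I. \<rho> (fst i) / real Kn * (\<Sum>a<q2. of_bool (b h m i = a) * log 2 (real q2 * kd h m a)))"
      by (subst sum.swap) (simp only: sum_distrib_left)
    also have "\<dots> = (\<Sum>i\<in>I. \<rho> (fst i) / real Kn * log 2 (real q2 * kd h m (b h m i)))"
      using blt by (simp add: of_bool_def if_distrib[of "\<lambda>x. x * _"] cong: if_cong)
    finally show ?thesis .
  qed
  have "(\<Sum>h\<in>H. w h * ((\<Sum>m<q2. \<Sum>a<q2. kd h m a * log 2 (real q2 * kd h m a)) / real q2))
    = (\<Sum>m<q2. \<Sum>i\<in>I. \<rho> (fst i) / real Kn / real q2 * (\<Sum>h\<in>H. w h * log 2 (real q2 * kd h m (b h m i))))"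
    unfolding kdlog
    by (simp add: sum_distrib_left sum_divide_distrib sum.swap[of _ "{..<q2}" H] sum.swap[of _ I H] mult_ac)
  also have "\<dots> \<le> (\<Sum>m<q2. \<Sum>i\<in>I. \<rho> (fst i) / real Kn / real q2 * log 2 (1 + real q2 * \<rho> (fst i) / real Kn))"
  proof (intro sum_mono)
    fix m i assume i: "i \<in> I"
    show "\<rho> (fst i) / real Kn / real q2 * (\<Sum>h\<in>H. w h * log 2 (real q2 * kd h m (b h m i)))
       \<le> \<rho> (fst i) / real Kn / real q2 * log 2 (1 + real q2 * \<rho> (fst i) / real Kn)"
    proof (cases "\<rho> (fst i) = 0")
      case False
      then have "0 < \<rho> (fst i)" using \<rho>(1)[of "fst i"] by simp
      then show ?thesis by (intro mult_left_mono one i) auto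
    qed simp
  qed
  also have "\<dots> = (\<Sum>s\<in>S. \<rho> s * log 2 (1 + real q2 * \<rho> s / real Kn))"
    using q2 Kn by (simp add: I_def sum.cartesian_product' sum_distrib_left)
  finally show ?thesis by (simp add: H_def I_def w_def)
qed

text \<open>Decode to any index whose likelihood exceeds \<open>\<gamma>\<close> times the mean
  output law. An error means that the true codeword fails the test or that another one passes it; a
  single wrong codeword passes with probability at most 1 / \<gamma>.\<close>

lemma threshold_decoding:
  fixes q :: "'t \<Rightarrow> real" and A :: "'t \<Rightarrow> 'o \<Rightarrow> real"
  assumes fin: "finite L" "finite T" "finite X" and L: "L \<noteq> {}" and \<gamma>: "0 < \<gamma>"
    and q: "\<And>t. 0 \<le> q t" "(\<Sum>t\<in>T. q t) = 1"
    and A: "\<And>t x. 0 \<le> A t x" "\<And>t. t \<in> T \<Longrightarrow> (\<Sum>x\<in>X. A t x) = 1"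
    and Bd: "\<And>x. Bd x = (\<Sum>t\<in>T. q t * A t x)"
    and \<delta>: "\<And>C x. \<delta> C x = (SOME l. l \<in> L \<and> \<gamma> * Bd x < A (C l) x)"
  shows "(\<Sum>C\<in>L \<rightarrow>\<^sub>E T. product_weight q L C * ((\<Sum>l\<in>L. \<Sum>x\<in>X. A (C l) x * of_bool (\<delta> C x \<noteq> l)) / real (card L)))
     \<le> (\<Sum>t\<in>T. q t * (\<Sum>x\<in>X. A t x * of_bool (A t x \<le> \<gamma> * Bd x))) + real (card L) / \<gamma>"
proof -
  define e where "e = (\<Sum>t\<in>T. q t * (\<Sum>x\<in>X. A t x * of_bool (A t x \<le> \<gamma> * Bd x)))"
  have cL: "real (card L) > 0" using L fin by (simp add: card_gt_0_iff)
  have Bd0: "0 \<le> Bd x" for x unfolding Bd by (intro sum_nonneg mult_nonneg_nonneg q A)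
  have pt: "of_bool (\<delta> C x \<noteq> l) \<le> (of_bool (A (C l) x \<le> \<gamma> * Bd x) + (\<Sum>i\<in>L - {l}. of_bool (\<gamma> * Bd x < A (C i) x)) :: real)"
    if "l \<in> L" for C x l
  proof (cases "\<delta> C x = l \<or> A (C l) x \<le> \<gamma> * Bd x")
    case True
    then show ?thesis by (auto intro!: sum_nonneg add_nonneg_nonneg)
  next
    case False
    then have "l \<in> L \<and> \<gamma> * Bd x < A (C l) x" using that by auto
    then have "\<delta> C x \<in> L \<and> \<gamma> * Bd x < A (C (\<delta> C x)) x" unfolding \<delta> by (rule someI)
    then have d: "\<delta> C x \<in> L - {l}" "of_bool (\<gamma> * Bd x < A (C (\<delta> C x)) x) = (1::real)" using False by auto
    have "of_bool (\<gamma> * Bd x < A (C (\<delta> C x)) x) \<le> (\<Sum>i\<in>L - {l}. of_bool (\<gamma> * Bd x < A (C i) x) :: real)"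
      using d(1) fin by (intro member_le_sum) auto
    then show ?thesis using d(2) False by simp
  qed
  have e2: "(\<Sum>C\<in>L \<rightarrow>\<^sub>E T. product_weight q L C * (A (C l) x * of_bool (\<gamma> * Bd x < A (C i) x)))
        = Bd x * (\<Sum>t\<in>T. q t * of_bool (\<gamma> * Bd x < A t x))" if "l \<in> L" "i \<in> L - {l}" for l i x
    unfolding Bd using that
    by (intro sum_product_weight_two[OF fin(1,2) q(2), of l i "\<lambda>t. A t x" "\<lambda>t. of_bool (_ < A t x)"]) auto
  \<comment> \<open>Change of measure: a wrong codeword is independent of the output, whose law is
    then \<open>Bd\<close>, and on the accepting event \<open>Bd x\<close> is below
    \<open>A t x / \<gamma>\<close>.\<close>
  have e3: "(\<Sum>x\<in>X. Bd x * (\<Sum>t\<in>T. q t * of_bool (\<gamma> * Bd x < A t x))) \<le> 1 / \<gamma>"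
  proof -
    have "(\<Sum>x\<in>X. Bd x * (\<Sum>t\<in>T. q t * of_bool (\<gamma> * Bd x < A t x))) \<le> (\<Sum>x\<in>X. \<Sum>t\<in>T. q t * A t x / \<gamma>)"
      unfolding sum_distrib_left
    proof (intro sum_mono)
      fix x t
      have "Bd x * of_bool (\<gamma> * Bd x < A t x) \<le> A t x / \<gamma>" using A(1)[of t x] \<gamma> by (auto simp: field_simps)
      then have "q t * (Bd x * of_bool (\<gamma> * Bd x < A t x)) \<le> q t * (A t x / \<gamma>)"
        by (rule mult_left_mono[OF _ q(1)])
      then show "Bd x * (q t * of_bool (\<gamma> * Bd x < A t x)) \<le> q t * A t x / \<gamma>"
        by (simp only: mult.left_commute[of "Bd x"] times_divide_eq_right)
    qed
    also have "\<dots> = (\<Sum>t\<in>T. q t * (\<Sum>x\<in>X. A t x)) / \<gamma>"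
      by (subst sum.swap) (simp add: sum_distrib_left sum_divide_distrib)
    also have "\<dots> = 1 / \<gamma>" by (simp add: A(2) q(2))
    finally show ?thesis .
  qed
  have each: "(\<Sum>C\<in>L \<rightarrow>\<^sub>E T. product_weight q L C * (\<Sum>x\<in>X. A (C l) x * of_bool (\<delta> C x \<noteq> l))) \<le> e + real (card L) / \<gamma>"
    if l: "l \<in> L" for l
  proof -
    have "(\<Sum>C\<in>L \<rightarrow>\<^sub>E T. product_weight q L C * (\<Sum>x\<in>X. A (C l) x * of_bool (\<delta> C x \<noteq> l)))
      \<le> (\<Sum>C\<in>L \<rightarrow>\<^sub>E T. product_weight q L C * (\<Sum>x\<in>X. A (C l) x * (of_bool (A (C l) x \<le> \<gamma> * Bd x) + (\<Sum>i\<in>L - {l}. of_bool (\<gamma> * Bd x < A (C i) x)))))"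
      by (intro sum_mono mult_left_mono pt l product_weight_nonneg q A)
    also have "\<dots> = (\<Sum>C\<in>L \<rightarrow>\<^sub>E T. product_weight q L C * (\<Sum>x\<in>X. A (C l) x * of_bool (A (C l) x \<le> \<gamma> * Bd x)))
       + (\<Sum>C\<in>L \<rightarrow>\<^sub>E T. \<Sum>x\<in>X. \<Sum>i\<in>L - {l}. product_weight q L C * (A (C l) x * of_bool (\<gamma> * Bd x < A (C i) x)))"
      by (simp only: distrib_left sum.distrib sum_distrib_left)
    also have "(\<Sum>C\<in>L \<rightarrow>\<^sub>E T. product_weight q L C * (\<Sum>x\<in>X. A (C l) x * of_bool (A (C l) x \<le> \<gamma> * Bd x))) = e"
      unfolding e_def using l by (intro sum_product_weight_one[OF fin(1,2) q(2), of l "\<lambda>t. \<Sum>x\<in>X. A t x * of_bool (A t x \<le> \<gamma> * Bd x)"])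
    also have "(\<Sum>C\<in>L \<rightarrow>\<^sub>E T. \<Sum>x\<in>X. \<Sum>i\<in>L - {l}. product_weight q L C * (A (C l) x * of_bool (\<gamma> * Bd x < A (C i) x)))
       = (\<Sum>i\<in>L - {l}. \<Sum>x\<in>X. \<Sum>C\<in>L \<rightarrow>\<^sub>E T. product_weight q L C * (A (C l) x * of_bool (\<gamma> * Bd x < A (C i) x)))"
      by (subst sum.swap, subst (2) sum.swap, subst sum.swap, rule refl)
    also have "\<dots> = (\<Sum>i\<in>L - {l}. \<Sum>x\<in>X. Bd x * (\<Sum>t\<in>T. q t * of_bool (\<gamma> * Bd x < A t x)))"
      by (intro sum.cong refl e2 l)
    also have "\<dots> \<le> (\<Sum>i\<in>L - {l}. 1 / \<gamma>)" by (intro sum_mono e3)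
    also have "\<dots> \<le> real (card L) / \<gamma>" using \<gamma> l fin by (simp add: divide_right_mono card_Diff_subset)
    finally show ?thesis by simp
  qed
  have "(\<Sum>C\<in>L \<rightarrow>\<^sub>E T. product_weight q L C * ((\<Sum>l\<in>L. \<Sum>x\<in>X. A (C l) x * of_bool (\<delta> C x \<noteq> l)) / real (card L)))
     = (\<Sum>l\<in>L. \<Sum>C\<in>L \<rightarrow>\<^sub>E T. product_weight q L C * (\<Sum>x\<in>X. A (C l) x * of_bool (\<delta> C x \<noteq> l))) / real (card L)"
    by (subst sum.swap) (simp only: sum_distrib_left sum_divide_distrib times_divide_eq_right)
  also have "\<dots> \<le> (\<Sum>l\<in>L. e + real (card L) / \<gamma>) / real (card L)"
    using cL by (intro divide_right_mono sum_mono each) auto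
  also have "\<dots> = e + real (card L) / \<gamma>" using cL by simp
  finally show ?thesis by (simp add: e_def)
qed

section \<open>Existence of good codebooks and hashes\<close>

text \<open>Error, covering and a further cost \<open>\<Phi>\<close> per codeword enter through one
  weighted functional, so a single draw below its mean serves all three. The sum over groups,
  outputs and members reduces the covering term to \<open>soft_covering_pointwise\<close>.\<close>

lemma random_codebook:
  fixes q :: "'t \<Rightarrow> real" and Uz :: "'t \<Rightarrow> 'z \<Rightarrow> real" and A :: "'t \<Rightarrow> 'o \<Rightarrow> real" and q1 q2 Dn :: nat
  defines "L \<equiv> {..<q1} \<times> {..<q2} \<times> {..<Dn}"
  defines "R \<equiv> \<lambda>C m z. (\<Sum>a<q2. \<Sum>d<Dn. Uz (C (m, a, d)) z) / (real q2 * real Dn)"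
  assumes fin: "finite T" "finite Z" "finite X" and pos: "0 < q1" "0 < q2" "0 < Dn" "0 < \<gamma>" "0 \<le> c1" "0 \<le> c2"
    and q: "\<And>t. 0 \<le> q t" "(\<Sum>t\<in>T. q t) = 1"
    and U: "\<And>t z. 0 \<le> Uz t z" "\<And>t. t \<in> T \<Longrightarrow> (\<Sum>z\<in>Z. Uz t z) = 1"
    and A: "\<And>t x. 0 \<le> A t x" "\<And>t. t \<in> T \<Longrightarrow> (\<Sum>x\<in>X. A t x) = 1"
    and SC: "0 \<le> SC" "q1 = 1 \<or>
      (\<Sum>t\<in>T. q t * (\<Sum>z\<in>Z. Uz t z * log 2 (1 + Uz t z / (real (q2 * Dn) * (\<Sum>t\<in>T. q t * Uz t z))))) \<le> SC"
    and bound: "c1 * ((\<Sum>t\<in>T. q t * (\<Sum>x\<in>X. A t x * of_bool (A t x \<le> \<gamma> * (\<Sum>t\<in>T. q t * A t x)))) + real (q1 * q2 * Dn) / \<gamma>)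
        + c2 * (SC + (\<Sum>t\<in>T. q t * \<Phi> t)) \<le> c"
  shows "\<exists>C \<delta> Q. C \<in> L \<rightarrow>\<^sub>E T \<and> (\<forall>z. 0 \<le> Q z) \<and> (\<Sum>z\<in>Z. Q z) = 1 \<and>
     (\<forall>l\<in>L. \<forall>z\<in>Z. Q z = 0 \<longrightarrow> Uz (C l) z = 0) \<and>
     c1 * ((\<Sum>l\<in>L. \<Sum>x\<in>X. A (C l) x * of_bool (\<delta> x \<noteq> l)) / (real q1 * real q2 * real Dn))
      + c2 * ((\<Sum>m<q1. \<Sum>z\<in>Z. R C m z * log 2 (R C m z / Q z)) / real q1
             + (\<Sum>l\<in>L. \<Phi> (C l)) / (real q1 * real q2 * real Dn)) \<le> c"
proof -
  have finL: "finite L" by (simp add: L_def)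
  have cardL: "real (card L) = real q1 * real q2 * real Dn" by (simp add: L_def card_cartesian_product)
  have Lne: "L \<noteq> {}" using pos by (auto simp: L_def)
  define Qz where "Qz z = (\<Sum>t\<in>T. q t * Uz t z)" for z
  \<comment> \<open>With a single group (\<open>q1 = 1\<close>) the reference is the output law itself; no covering condition is needed.\<close>
  define Qf where "Qf C = (if q1 = 1 then R C 0 else Qz)" for C
  define Bd where "Bd x = (\<Sum>t\<in>T. q t * A t x)" for x
  define \<delta> where "\<delta> C x = (SOME l. l \<in> L \<and> \<gamma> * Bd x < A (C l) x)" for C x
  define index_error where "index_error C = (\<Sum>l\<in>L. \<Sum>x\<in>X. A (C l) x * of_bool (\<delta> C x \<noteq> l)) / real (card L)" for C
  define cover_leak where "cover_leak C = (\<Sum>m<q1. \<Sum>z\<in>Z. R C m z * log 2 (R C m z / Qf C z)) / real q1" for C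
  define LH where "LH C = (\<Sum>l\<in>L. \<Phi> (C l)) / real (card L)" for C
  let ?Cs = "L \<rightarrow>\<^sub>E T"
  have finC: "finite ?Cs" by (intro finite_PiE finL fin)
  have cL: "real (card L) > 0" using Lne finL by (simp add: card_gt_0_iff)
  have R0: "0 \<le> R C m z" for C m z by (simp add: R_def U sum_nonneg)
  have E1: "(\<Sum>C\<in>?Cs. product_weight q L C * index_error C) \<le> (\<Sum>t\<in>T. q t * (\<Sum>x\<in>X. A t x * of_bool (A t x \<le> \<gamma> * Bd x))) + real (card L) / \<gamma>"
    unfolding index_error_def by (rule threshold_decoding[OF finL fin(1,3) Lne pos(4) q A Bd_def \<delta>_def])
  have E2: "(\<Sum>C\<in>?Cs. product_weight q L C * LH C) = (\<Sum>t\<in>T. q t * \<Phi> t)"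
  proof -
    have "(\<Sum>C\<in>?Cs. product_weight q L C * LH C) = (\<Sum>l\<in>L. \<Sum>C\<in>?Cs. product_weight q L C * \<Phi> (C l)) / real (card L)"
      unfolding LH_def by (subst sum.swap) (simp add: sum_distrib_left sum_divide_distrib)
    also have "\<dots> = (\<Sum>l\<in>L. \<Sum>t\<in>T. q t * \<Phi> t) / real (card L)"
      by (intro arg_cong2[where f = "(/)"] sum.cong refl sum_product_weight_one finL fin q)
    also have "\<dots> = (\<Sum>t\<in>T. q t * \<Phi> t)" using cL by simp
    finally show ?thesis .
  qed
  have E3: "(\<Sum>C\<in>?Cs. product_weight q L C * cover_leak C) \<le> SC"
  proof (cases "q1 = 1")
    case True
    then have "cover_leak C = 0" for C
      unfolding cover_leak_def Qf_def by (auto intro!: sum.neutral simp: log_def)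
    then show ?thesis using SC(1) by simp
  next
    case False
    then have SC': "(\<Sum>t\<in>T. q t * (\<Sum>z\<in>Z. Uz t z * log 2 (1 + Uz t z / (real (q2 * Dn) * Qz z)))) \<le> SC"
      using SC by (auto simp: Qz_def)
      define G where "G m = {m} \<times> {..<q2} \<times> {..<Dn}" for m :: nat
      have cG: "real (card (G m)) = real (q2 * Dn)" for m by (simp add: G_def card_cartesian_product)
      have RG: "R C m z = (\<Sum>i\<in>G m. Uz (C i) z) / real (card (G m))" for C m z
        unfolding cG by (simp add: R_def G_def sum.cartesian_product')
      have "(\<Sum>C\<in>?Cs. product_weight q L C * cover_leak C)
        = (\<Sum>m<q1. \<Sum>z\<in>Z. \<Sum>C\<in>?Cs. product_weight q L C * (R C m z * log 2 (R C m z / Qz z))) / real q1"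
        unfolding cover_leak_def Qf_def using False
        by (simp add: sum_distrib_left sum_divide_distrib sum.swap[of _ "{..<q1}" ?Cs] sum.swap[of _ Z ?Cs])
      also have "\<dots> = (\<Sum>m<q1. \<Sum>z\<in>Z. \<Sum>l\<in>G m. \<Sum>C\<in>?Cs.
          product_weight q L C * (Uz (C l) z * log 2 ((\<Sum>i\<in>G m. Uz (C i) z) / real (card (G m)) / Qz z))) / real (q2 * Dn) / real q1"
      proof -
        have "(\<Sum>C\<in>?Cs. product_weight q L C * (R C m z * log 2 (R C m z / Qz z)))
          = (\<Sum>l\<in>G m. \<Sum>C\<in>?Cs. product_weight q L C * (Uz (C l) z * log 2 ((\<Sum>i\<in>G m. Uz (C i) z) / real (card (G m)) / Qz z))) / real (q2 * Dn)" for m z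
        proof -
          have "(\<Sum>C\<in>?Cs. product_weight q L C * (R C m z * log 2 (R C m z / Qz z)))
            = (\<Sum>C\<in>?Cs. \<Sum>l\<in>G m. product_weight q L C * (Uz (C l) z * log 2 (R C m z / Qz z)) / real (q2 * Dn))"
            by (intro sum.cong refl) (subst (1) RG, simp only: cG sum_distrib_left sum_distrib_right sum_divide_distrib times_divide_eq_left times_divide_eq_right)
          also have "\<dots> = (\<Sum>l\<in>G m. \<Sum>C\<in>?Cs. product_weight q L C * (Uz (C l) z * log 2 (R C m z / Qz z))) / real (q2 * Dn)"
            by (subst sum.swap) (simp only: sum_divide_distrib)
          finally show ?thesis unfolding RG .
        qed
        then show ?thesis by (simp only: sum_divide_distrib)
      qed
      also have "\<dots> \<le> (\<Sum>m<q1. \<Sum>z\<in>Z. \<Sum>l\<in>G m. \<Sum>t\<in>T. q t * (Uz t z * log 2 (1 + Uz t z / (real (card (G m)) * Qz z)))) / real (q2 * Dn) / real q1"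
      proof (intro divide_right_mono sum_mono)
        fix m z l assume "m \<in> {..<q1}" "l \<in> G m"
        then show "(\<Sum>C\<in>?Cs. product_weight q L C * (Uz (C l) z * log 2 ((\<Sum>i\<in>G m. Uz (C i) z) / real (card (G m)) / Qz z)))
          \<le> (\<Sum>t\<in>T. q t * (Uz t z * log 2 (1 + Uz t z / (real (card (G m)) * Qz z))))"
          by (intro soft_covering_pointwise finL fin q U Qz_def) (auto simp: G_def L_def)
      qed auto
      also have "\<dots> = (\<Sum>z\<in>Z. \<Sum>t\<in>T. q t * (Uz t z * log 2 (1 + Uz t z / (real (q2 * Dn) * Qz z))))"
        using pos by (simp add: cG flip: sum_distrib_left)
      also have "\<dots> = (\<Sum>t\<in>T. q t * (\<Sum>z\<in>Z. Uz t z * log 2 (1 + Uz t z / (real (q2 * Dn) * Qz z))))"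
        by (subst sum.swap) (simp only: sum_distrib_left)
      finally show ?thesis using SC' by linarith
  qed
  have "(\<Sum>C\<in>?Cs. product_weight q L C * (c1 * index_error C + c2 * (cover_leak C + LH C))) 
     = c1 * (\<Sum>C\<in>?Cs. product_weight q L C * index_error C) + c2 * ((\<Sum>C\<in>?Cs. product_weight q L C * cover_leak C) + (\<Sum>C\<in>?Cs. product_weight q L C * LH C))"
    by (simp add: distrib_left sum.distrib sum_distrib_left mult_ac)
  also have "\<dots> \<le> c1 * ((\<Sum>t\<in>T. q t * (\<Sum>x\<in>X. A t x * of_bool (A t x \<le> \<gamma> * Bd x))) + real (card L) / \<gamma>)
        + c2 * (SC + (\<Sum>t\<in>T. q t * \<Phi> t))"
    unfolding E2 by (intro add_mono mult_left_mono E1 E3 pos order_refl)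
  also have "\<dots> \<le> c" using bound by (simp add: Bd_def cardL)
  finally have E: "(\<Sum>C\<in>?Cs. product_weight q L C * (c1 * index_error C + c2 * (cover_leak C + LH C))) \<le> c" .
  obtain C where C: "C \<in> ?Cs" "0 < product_weight q L C" "c1 * index_error C + c2 * (cover_leak C + LH C) \<le> c"
    using exists_below_mean[OF finC product_weight_nonneg[of q, OF q(1)] sum_product_weight[OF finL fin(1) q(2)] E] by blast
  have CT: "C l \<in> T" if "l \<in> L" for l using C(1) that by auto
  have z0: "Uz (C l) z = 0" if "l \<in> L" "Qf C z = 0" for l z
  proof (cases "q1 = 1")
    case True
    then have "(\<Sum>i\<in>{..<q2} \<times> {..<Dn}. Uz (C (0, i)) z) = 0"
      using that(2) pos by (simp add: Qf_def R_def sum.cartesian_product')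
    then have "\<And>i. i \<in> {..<q2} \<times> {..<Dn} \<Longrightarrow> Uz (C (0, i)) z = 0"
      by (subst (asm) sum_nonneg_eq_0_iff) (auto simp: U)
    then show ?thesis using that(1) True by (auto simp: L_def)
  next
    case False
    then have "(\<Sum>t\<in>T. q t * Uz t z) = 0" using that(2) by (simp add: Qf_def Qz_def)
    then have "q (C l) * Uz (C l) z = 0"
      using CT[OF that(1)] fin q U by (simp add: sum_nonneg_eq_0_iff)
    \<comment> \<open>Positive weight of the drawn codebook: each codeword lies in the support of
      \<open>q\<close>, where a null output of the mean law is null for the codeword too.\<close>
    moreover have "q (C l) \<noteq> 0" using C(2) product_weight_eq_0[OF finL that(1), of q C] by auto
    ultimately show ?thesis by simp
  qed
  have Qs: "(\<Sum>z\<in>Z. Qf C z) = 1"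
  proof (cases "q1 = 1")
    case True
    have "(\<Sum>z\<in>Z. R C 0 z) = (\<Sum>a<q2. \<Sum>d<Dn. \<Sum>z\<in>Z. Uz (C (0, a, d)) z) / (real q2 * real Dn)"
      by (simp add: R_def sum.swap[of _ "{..<q2}" Z] sum.swap[of _ "{..<Dn}" Z] flip: sum_divide_distrib)
    also have "\<dots> = (\<Sum>a<q2. \<Sum>d<Dn. 1) / (real q2 * real Dn)"
      using True by (intro arg_cong2[where f = "(/)"] sum.cong refl U(2) CT) (auto simp: L_def)
    also have "\<dots> = 1" using pos by simp
    finally show ?thesis using True by (simp add: Qf_def)
  next
    case False
    have "(\<Sum>z\<in>Z. Qz z) = (\<Sum>t\<in>T. q t * (\<Sum>z\<in>Z. Uz t z))"
      unfolding Qz_def by (subst sum.swap) (simp only: sum_distrib_left)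
    then show ?thesis using False by (simp add: Qf_def U(2) q(2))
  qed
  have Qn: "0 \<le> Qf C z" for z by (simp add: Qf_def R0 Qz_def q U sum_nonneg)
  show ?thesis
    using C(1,3) z0 Qs Qn unfolding index_error_def cover_leak_def LH_def cardL
    by (intro exI[of _ C] exI[of _ "\<delta> C"] exI[of _ "Qf C"]) auto
qed

text \<open>Chosen in two stages: the codebook with \<open>\<Phi>\<close> set to the bound on a
  codeword's hash leakage averaged over the tables, then a table below that average for this
  codebook.\<close>

lemma random_block_code:
  fixes U :: "'t::finite list \<Rightarrow> 's::finite list \<Rightarrow> 'y::finite list \<Rightarrow> 'z::finite list \<Rightarrow> real"
    and q :: "'t list \<Rightarrow> real" and n q1 q2 Dn Kn :: nat
  defines "L \<equiv> {..<q1} \<times> {..<q2} \<times> {..<Dn}"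
  defines "Usz \<equiv> \<lambda>t s z. \<Sum>y\<in>words UNIV n. U t s y z"
  defines "Uz \<equiv> \<lambda>t z. \<Sum>s\<in>words UNIV n. \<Sum>y\<in>words UNIV n. U t s y z"
  defines "A \<equiv> \<lambda>t (s, y). \<Sum>z\<in>words UNIV n. U t s y z"
  assumes pos: "0 < q1" "0 < q2" "0 < Dn" "0 < Kn" "0 < \<gamma>" "0 \<le> c1" "0 \<le> c2"
    and q: "\<And>t. 0 \<le> q t" "(\<Sum>t\<in>words UNIV n. q t) = 1"
    and U: "\<And>t s y z. 0 \<le> U t s y z" "\<And>t. t \<in> words UNIV n \<Longrightarrow> (\<Sum>s\<in>words UNIV n. \<Sum>y\<in>words UNIV n. \<Sum>z\<in>words UNIV n. U t s y z) = 1"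
    and SC: "0 \<le> SC" "q1 = 1 \<or>
      (\<Sum>t\<in>words UNIV n. q t * (\<Sum>z\<in>words UNIV n. Uz t z * log 2 (1 + Uz t z / (real (q2 * Dn) * (\<Sum>t\<in>words UNIV n. q t * Uz t z))))) \<le> SC"
    and bound: "c1 * ((\<Sum>t\<in>words UNIV n. q t * (\<Sum>x\<in>words UNIV n \<times> words UNIV n. A t x * of_bool (A t x \<le> \<gamma> * (\<Sum>t\<in>words UNIV n. q t * A t x))))
           + real (q1 * q2 * Dn) / \<gamma>)
        + c2 * (SC + (\<Sum>t\<in>words UNIV n. q t * (\<Sum>z\<in>words UNIV n. \<Sum>s\<in>words UNIV n. Usz t s z * log 2 (1 + real q2 * (Usz t s z / Uz t z) / real Kn)))) \<le> c"
  shows "\<exists>C g \<delta> Q. (\<forall>l. length (C l) = n) \<and> block_code n q1 q2 Dn Kn (\<lambda>l. U (C l)) \<and>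
     (\<forall>z. 0 \<le> Q z) \<and> (\<Sum>z\<in>words UNIV n. Q z) = 1 \<and>
     (\<forall>l\<in>L. \<forall>z\<in>words UNIV n. Q z = 0 \<longrightarrow> block_code.Vz n (\<lambda>l. U (C l)) l z = 0) \<and>
     c1 * block_code.index_error n q1 q2 Dn (\<lambda>l. U (C l)) \<delta>
      + c2 * (block_code.cover_leak n q1 q2 Dn (\<lambda>l. U (C l)) Q + block_code.hash_leak n q1 q2 Dn Kn (\<lambda>l. U (C l)) g) \<le> c"
proof -
  let ?T = "words UNIV n :: 't list set" and ?S = "words UNIV n :: 's list set"
    and ?Y = "words UNIV n :: 'y list set" and ?Z = "words UNIV n :: 'z list set"
  define \<Phi> where "\<Phi> t = (\<Sum>z\<in>?Z. \<Sum>s\<in>?S. Usz t s z * log 2 (1 + real q2 * (Usz t s z / Uz t z) / real Kn))" for t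
  define R where "R C m z = (\<Sum>a<q2. \<Sum>d<Dn. Uz (C (m, a, d)) z) / (real q2 * real Dn)" for C :: "nat \<times> nat \<times> nat \<Rightarrow> 't list" and m z
  have Usz0: "0 \<le> Usz t s z" for t s z by (simp add: Usz_def U sum_nonneg)
  have Uz0: "0 \<le> Uz t z" for t z by (simp add: Uz_def U sum_nonneg)
  have A0: "0 \<le> A t x" for t x by (auto simp: A_def U sum_nonneg split: prod.splits)
  have Uz_Usz: "Uz t z = (\<Sum>s\<in>?S. Usz t s z)" for t z by (simp add: Uz_def Usz_def)
  have Uz1: "(\<Sum>z\<in>?Z. Uz t z) = 1" if "t \<in> ?T" for t
    unfolding Uz_def using U(2)[OF that] by (simp add: sum.swap[of _ ?S ?Z] sum.swap[of _ ?Y ?Z])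
  have A1: "(\<Sum>x\<in>?S \<times> ?Y. A t x) = 1" if "t \<in> ?T" for t
    using U(2)[OF that] by (simp add: A_def sum.cartesian_product')
  have "\<exists>C \<delta> Q. C \<in> L \<rightarrow>\<^sub>E ?T \<and> (\<forall>z. 0 \<le> Q z) \<and> (\<Sum>z\<in>?Z. Q z) = 1 \<and>
     (\<forall>l\<in>L. \<forall>z\<in>?Z. Q z = 0 \<longrightarrow> Uz (C l) z = 0) \<and>
     c1 * ((\<Sum>l\<in>L. \<Sum>x\<in>?S \<times> ?Y. A (C l) x * of_bool (\<delta> x \<noteq> l)) / (real q1 * real q2 * real Dn))
      + c2 * ((\<Sum>m<q1. \<Sum>z\<in>?Z. R C m z * log 2 (R C m z / Q z)) / real q1
             + (\<Sum>l\<in>L. \<Phi> (C l)) / (real q1 * real q2 * real Dn)) \<le> c"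
    unfolding L_def R_def
    by (rule random_codebook[where T = ?T and Z = ?Z and X = "?S \<times> ?Y" and q = q and \<gamma> = \<gamma> and SC = SC])
      (use pos q Uz0 Uz1 A0 A1 SC bound in \<open>simp_all add: \<Phi>_def\<close>)
  then obtain C0 \<delta> Q where C0: "C0 \<in> L \<rightarrow>\<^sub>E ?T" and Q: "\<And>z. 0 \<le> Q z" "(\<Sum>z\<in>?Z. Q z) = 1"
    and Q0: "\<And>l z. l \<in> L \<Longrightarrow> z \<in> ?Z \<Longrightarrow> Q z = 0 \<Longrightarrow> Uz (C0 l) z = 0"
    and le: "c1 * ((\<Sum>l\<in>L. \<Sum>x\<in>?S \<times> ?Y. A (C0 l) x * of_bool (\<delta> x \<noteq> l)) / (real q1 * real q2 * real Dn))
      + c2 * ((\<Sum>m<q1. \<Sum>z\<in>?Z. R C0 m z * log 2 (R C0 m z / Q z)) / real q1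
             + (\<Sum>l\<in>L. \<Phi> (C0 l)) / (real q1 * real q2 * real Dn)) \<le> c"
    by blast
  \<comment> \<open>The default outside \<open>L\<close> gives every index a word of length
    \<open>n\<close>, as the later causality argument asks for.\<close>
  define C where "C l = (if l \<in> L then C0 l else replicate n undefined)" for l
  have CT: "C l \<in> ?T" for l using C0 by (auto simp: C_def words_def)
  define V where "V l = U (C l)" for l
  have bc: "block_code n q1 q2 Dn Kn V"
    using pos CT by unfold_locales (auto simp: V_def U)
  have Vsz: "block_code.Vsz n V l s z = Usz (C l) s z" for l s z
    by (simp add: block_code.Vsz_def[OF bc] V_def Usz_def)
  have Vz: "block_code.Vz n V l z = Uz (C l) z" for l z
    by (simp add: block_code.Vz_def[OF bc] Vsz Uz_Usz)
  have index_error: "block_code.index_error n q1 q2 Dn V (\<lambda>y s. \<delta> (s, y))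
     = (\<Sum>l\<in>L. \<Sum>x\<in>?S \<times> ?Y. A (C0 l) x * of_bool (\<delta> x \<noteq> l)) / (real q1 * real q2 * real Dn)"
    unfolding block_code.index_error_def[OF bc] L_def[symmetric]
    by (intro arg_cong2[where f = "(/)"] sum.cong refl)
      (simp add: A_def sum.cartesian_product' V_def C_def sum_distrib_right
        del: sum_of_bool_eq sum_of_bool_mult_eq sum_mult_of_bool_eq)
  have RC: "R C m z = R C0 m z" if "m < q1" for m z
    using that unfolding R_def by (intro arg_cong2[where f = "(/)"] sum.cong refl) (auto simp: C_def L_def)
  have cover_leak: "block_code.cover_leak n q1 q2 Dn V Q = (\<Sum>m<q1. \<Sum>z\<in>?Z. R C0 m z * log 2 (R C0 m z / Q z)) / real q1"
  proof -
    have "block_code.group_law n q2 Dn V m z = R C0 m z" if "m < q1" for m z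
      by (simp add: block_code.group_law_def[OF bc] Vz RC[OF that, symmetric]) (simp add: R_def)
    then show ?thesis by (simp add: block_code.cover_leak_def[OF bc])
  qed
  define H where "H = (?S \<times> {..<Kn}) \<rightarrow>\<^sub>E {..<q2}"
  define w where "w h = product_weight (\<lambda>_. 1 / real q2) (?S \<times> {..<Kn}) h" for h :: "'s list \<times> nat \<Rightarrow> nat"
  define kl where "kl h \<rho> = block_code.keyleak n q2 Kn (\<lambda>s k. h (s, k)) \<rho>" for h :: "'s list \<times> nat \<Rightarrow> nat" and \<rho>
  define hash_leak where "hash_leak h = block_code.hash_leak n q1 q2 Dn Kn V (\<lambda>s k. h (s, k))" for h
  have D2L: "hash_leak h = (\<Sum>l\<in>L. \<Sum>z\<in>?Z. Uz (C l) z * kl h (block_code.post n V l z)) / (real q1 * real q2 * real Dn)" for h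
    by (simp add: hash_leak_def block_code.hash_leak_def[OF bc] kl_def Vz L_def sum.cartesian_product')
  \<comment> \<open>Leftover hashing for the posterior given index and output, multiplied by the
    probability of the output to return to joint laws.\<close>
  have hash: "(\<Sum>h\<in>H. w h * (Uz (C l) z * kl h (block_code.post n V l z)))
      \<le> (\<Sum>s\<in>?S. Usz (C l) s z * log 2 (1 + real q2 * (Usz (C l) s z / Uz (C l) z) / real Kn))" for l z
  proof (cases "Uz (C l) z = 0")
    case True
    then have "Usz (C l) s z = 0" if "s \<in> ?S" for s
      using that unfolding Uz_Usz by (simp add: sum_nonneg_eq_0_iff Usz0)
    then show ?thesis using True by simp
  next
    case False
    have post: "block_code.post n V l z s = Usz (C l) s z / Uz (C l) z" for s
      by (simp add: block_code.post_def[OF bc] Vsz Vz)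
    have "(\<Sum>h\<in>H. w h * kl h (block_code.post n V l z))
       \<le> (\<Sum>s\<in>?S. block_code.post n V l z s * log 2 (1 + real q2 * block_code.post n V l z s / real Kn))"
      unfolding kl_def block_code.keyleak_def[OF bc] H_def w_def
      using pos False
      by (intro leftover_hash) (auto simp: block_code.keydist_def[OF bc] block_code.post_nonneg[OF bc] block_code.post_sum[OF bc] Vz)
    then have "Uz (C l) z * (\<Sum>h\<in>H. w h * kl h (block_code.post n V l z))
       \<le> Uz (C l) z * (\<Sum>s\<in>?S. block_code.post n V l z s * log 2 (1 + real q2 * block_code.post n V l z s / real Kn))"
      using Uz0 by (rule mult_left_mono)
    then show ?thesis using False
      by (simp add: sum_distrib_left post mult.left_commute)
  qed
  have finH: "finite H" unfolding H_def by (intro finite_PiE) auto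
  have ED2: "(\<Sum>h\<in>H. w h * hash_leak h) \<le> (\<Sum>l\<in>L. \<Phi> (C l)) / (real q1 * real q2 * real Dn)"
  proof -
    have "(\<Sum>h\<in>H. w h * hash_leak h) = (\<Sum>l\<in>L. \<Sum>z\<in>?Z. \<Sum>h\<in>H. w h * (Uz (C l) z * kl h (block_code.post n V l z))) / (real q1 * real q2 * real Dn)"
      unfolding D2L by (simp add: sum_distrib_left sum_divide_distrib sum.swap[of _ L H] sum.swap[of _ ?Z H])
    also have "\<dots> \<le> (\<Sum>l\<in>L. \<Phi> (C l)) / (real q1 * real q2 * real Dn)"
      unfolding \<Phi>_def by (intro divide_right_mono sum_mono hash) auto
    finally show ?thesis .
  qed
  have u: "(\<Sum>a<q2. 1 / real q2) = 1" using pos by simp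
  obtain h where h: "hash_leak h \<le> (\<Sum>l\<in>L. \<Phi> (C l)) / (real q1 * real q2 * real Dn)"
    using exists_below_mean[OF finH _ _ ED2] sum_product_weight[OF _ _ u, of "?S \<times> {..<Kn}"]
    by (auto simp: w_def H_def product_weight_nonneg)
  have "(\<Sum>l\<in>L. \<Phi> (C l)) = (\<Sum>l\<in>L. \<Phi> (C0 l))" by (intro sum.cong) (auto simp: C_def)
  with h have h': "c2 * hash_leak h \<le> c2 * ((\<Sum>l\<in>L. \<Phi> (C0 l)) / (real q1 * real q2 * real Dn))"
    using pos by (intro mult_left_mono) auto
  have "c1 * block_code.index_error n q1 q2 Dn V (\<lambda>y s. \<delta> (s, y)) + c2 * (block_code.cover_leak n q1 q2 Dn V Q + hash_leak h) \<le> c"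
    using le h' unfolding index_error cover_leak by (simp add: distrib_left)
  moreover have "\<forall>l\<in>L. \<forall>z\<in>?Z. Q z = 0 \<longrightarrow> block_code.Vz n V l z = 0"
    using Q0 by (auto simp: Vz C_def)
  ultimately show ?thesis
    using CT bc Q unfolding hash_leak_def V_def
    by (intro exI[of _ C] exI[of _ "\<lambda>s k. h (s, k)"] exI[of _ "\<lambda>y s. \<delta> (s, y)"] exI[of _ Q]) (auto simp: words_def)
qed

section \<open>Second moments of i.i.d. sums\<close>

text \<open>Sequences over several alphabets become sequences of tuples, so the i.i.d. estimates are
  needed for one alphabet only.\<close>

lemma sum_words_pair:
  fixes F :: "'a::finite list \<Rightarrow> 'b::finite list \<Rightarrow> 'c::comm_monoid_add"
  shows "(\<Sum>as\<in>words UNIV n. \<Sum>bs\<in>words UNIV n. F as bs) = (\<Sum>w\<in>words UNIV n. F (map fst w) (map snd w))"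
proof (induction n arbitrary: F)
  case (Suc n)
  have "(\<Sum>as\<in>words UNIV (Suc n). \<Sum>bs\<in>words UNIV (Suc n). F as bs)
    = (\<Sum>a\<in>UNIV. \<Sum>as\<in>words UNIV n. \<Sum>b\<in>UNIV. \<Sum>bs\<in>words UNIV n. F (a # as) (b # bs))"
    by (simp add: sum_words_Suc)
  also have "\<dots> = (\<Sum>a\<in>UNIV. \<Sum>b\<in>UNIV. \<Sum>as\<in>words UNIV n. \<Sum>bs\<in>words UNIV n. F (a # as) (b # bs))"
    by (intro sum.cong refl sum.swap)
  also have "\<dots> = (\<Sum>a\<in>UNIV. \<Sum>b\<in>UNIV. \<Sum>w\<in>words UNIV n. F (a # map fst w) (b # map snd w))"
    by (intro sum.cong refl Suc.IH)
  also have "\<dots> = (\<Sum>x\<in>UNIV \<times> UNIV. \<Sum>w\<in>words UNIV n. F (fst x # map fst w) (snd x # map snd w))"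
    by (simp add: sum.cartesian_product' del: UNIV_Times_UNIV)
  finally show ?case by (simp add: sum_words_Suc)
qed simp

lemma iid_moments:
  fixes p g :: "'w::finite \<Rightarrow> real"
  assumes p: "(\<Sum>w\<in>UNIV. p w) = 1" and g: "(\<Sum>w\<in>UNIV. p w * g w) = 0"
  shows iid_total: "(\<Sum>ws\<in>words UNIV n. \<Prod>i<n. p (ws ! i)) = 1"
    and iid_mean: "(\<Sum>ws\<in>words UNIV n. (\<Prod>i<n. p (ws ! i)) * (\<Sum>i<n. g (ws ! i))) = 0"
    and iid_variance: "(\<Sum>ws\<in>words UNIV n. (\<Prod>i<n. p (ws ! i)) * (\<Sum>i<n. g (ws ! i))\<^sup>2) = real n * (\<Sum>w\<in>UNIV. p w * (g w)\<^sup>2)"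
proof -
  show tot: "(\<Sum>ws\<in>words UNIV n. \<Prod>i<n. p (ws ! i)) = 1" for n
    by (simp add: sum_prod_words[of "\<lambda>_. p"] p)
  show mean: "(\<Sum>ws\<in>words UNIV n. (\<Prod>i<n. p (ws ! i)) * (\<Sum>i<n. g (ws ! i))) = 0" for n
  proof (induction n)
    case (Suc n)
    have "(\<Sum>ws\<in>words UNIV (Suc n). (\<Prod>i<Suc n. p (ws ! i)) * (\<Sum>i<Suc n. g (ws ! i)))
      = (\<Sum>x\<in>UNIV. \<Sum>ws\<in>words UNIV n. p x * g x * (\<Prod>i<n. p (ws ! i)) + p x * ((\<Prod>i<n. p (ws ! i)) * (\<Sum>i<n. g (ws ! i))))"
      unfolding sum_words_Suc prod.lessThan_Suc_shift sum.lessThan_Suc_shift by (simp add: algebra_simps)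
    also have "\<dots> = (\<Sum>x\<in>UNIV. p x * g x * 1 + p x * 0)"
      unfolding sum.distrib sum_distrib_left[symmetric] tot Suc.IH ..
    finally show ?case by (simp add: g)
  qed simp
  show "(\<Sum>ws\<in>words UNIV n. (\<Prod>i<n. p (ws ! i)) * (\<Sum>i<n. g (ws ! i))\<^sup>2) = real n * (\<Sum>w\<in>UNIV. p w * (g w)\<^sup>2)"
  proof (induction n)
    case (Suc n)
    have "(\<Sum>ws\<in>words UNIV (Suc n). (\<Prod>i<Suc n. p (ws ! i)) * (\<Sum>i<Suc n. g (ws ! i))\<^sup>2)
      = (\<Sum>x\<in>UNIV. \<Sum>ws\<in>words UNIV n. p x * (g x)\<^sup>2 * (\<Prod>i<n. p (ws ! i))
          + 2 * p x * g x * ((\<Prod>i<n. p (ws ! i)) * (\<Sum>i<n. g (ws ! i))) + p x * ((\<Prod>i<n. p (ws ! i)) * (\<Sum>i<n. g (ws ! i))\<^sup>2))"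
      unfolding sum_words_Suc prod.lessThan_Suc_shift sum.lessThan_Suc_shift
      by (simp add: algebra_simps power2_sum)
    also have "\<dots> = (\<Sum>x\<in>UNIV. p x * (g x)\<^sup>2 * 1 + 2 * p x * g x * 0 + p x * (real n * (\<Sum>w\<in>UNIV. p w * (g w)\<^sup>2)))"
      unfolding sum.distrib sum_distrib_left[symmetric] tot mean Suc.IH ..
    also have "\<dots> = (\<Sum>w\<in>UNIV. p w * (g w)\<^sup>2) + (\<Sum>w\<in>UNIV. p w) * (real n * (\<Sum>w\<in>UNIV. p w * (g w)\<^sup>2))"
      by (simp only: sum.distrib sum_distrib_right mult_1_right mult_zero_right add_0_right)
    also have "\<dots> = real (Suc n) * (\<Sum>w\<in>UNIV. p w * (g w)\<^sup>2)"
      by (simp add: p algebra_simps)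
    finally show ?case .
  qed simp
qed

text \<open>\<open>p\<close> is a letter law and \<open>f\<close> a likelihood ratio, positive where
  \<open>p\<close> is; the logarithm of the product over a block is then a sum of i.i.d. terms
  almost surely.\<close>

locale iid_ratio =
  fixes p f :: "'w::finite \<Rightarrow> real"
  assumes p_nonneg: "0 \<le> p w" and p_sum: "(\<Sum>w\<in>UNIV. p w) = 1"
    and f_pos: "0 < p w \<Longrightarrow> 0 < f w"
begin

definition \<mu> where "\<mu> = (\<Sum>w\<in>UNIV. p w * log 2 (f w))"
text \<open>The variance, not the standard deviation, of \<open>log 2 (f w)\<close>.\<close>

definition \<sigma> where "\<sigma> = (\<Sum>w\<in>UNIV. p w * (log 2 (f w) - \<mu>)\<^sup>2)"

lemma sigma_nonneg: "0 \<le> \<sigma>"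
  unfolding \<sigma>_def by (intro sum_nonneg mult_nonneg_nonneg p_nonneg) simp

lemma centred: "(\<Sum>w\<in>UNIV. p w * (log 2 (f w) - \<mu>)) = 0"
  by (simp add: right_diff_distrib sum_subtractf p_sum flip: \<mu>_def sum_distrib_right)

lemma log_prod:
  assumes "(\<Prod>i<n. p (ws ! i)) \<noteq> 0"
  shows "0 < (\<Prod>i<n. f (ws ! i))"
    and "log 2 (\<Prod>i<n. f (ws ! i)) = real n * \<mu> + (\<Sum>i<n. log 2 (f (ws ! i)) - \<mu>)"
proof -
  have pos: "0 < f (ws ! i)" if "i < n" for i
    using assms that p_nonneg[of "ws ! i"] by (intro f_pos) (auto simp: order_less_le)
  then show "0 < (\<Prod>i<n. f (ws ! i))" by (intro prod_pos) auto
  have "log 2 (\<Prod>i<n. f (ws ! i)) = (\<Sum>i<n. log 2 (f (ws ! i)))"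
    using pos by (subst log_def, subst ln_prod) (auto simp: log_def sum_divide_distrib order_less_imp_not_eq2)
  then show "log 2 (\<Prod>i<n. f (ws ! i)) = real n * \<mu> + (\<Sum>i<n. log 2 (f (ws ! i)) - \<mu>)"
    by (simp add: sum_subtractf)
qed

text \<open>log (1 + x) is at most 1 plus the positive part of log x, and log x stays below
  \<open>\<kappa>\<close> up to a centred i.i.d. sum. The variance of that sum then bounds the
  expectation, at the price of an arbitrarily small slope \<open>\<eta>\<close>.\<close>

lemma expected_log_one_plus:
  assumes n: "0 < n" and \<eta>: "0 < \<eta>" and c: "0 < c" "log 2 c + real n * \<mu> \<le> \<kappa>" "0 \<le> \<kappa>"
  shows "(\<Sum>ws\<in>words UNIV n. (\<Prod>i<n. p (ws ! i)) * log 2 (1 + c * (\<Prod>i<n. f (ws ! i)))) \<le> 1 + \<kappa> + \<eta> * real n + \<sigma> / (4 * \<eta>)"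
proof -
  define P where "P ws = (\<Prod>i<n. p (ws ! i))" for ws
  define D where "D ws = (\<Sum>i<n. log 2 (f (ws ! i)) - \<mu>)" for ws
  have P0: "0 \<le> P ws" for ws unfolding P_def by (intro prod_nonneg) (simp add: p_nonneg)
  have pt: "P ws * log 2 (1 + c * (\<Prod>i<n. f (ws ! i))) \<le> P ws * (1 + \<kappa> + \<eta> * real n + (D ws)\<^sup>2 / (4 * \<eta> * real n))" for ws
  proof (cases "P ws = 0")
    case False
    define x where "x = c * (\<Prod>i<n. f (ws ! i))"
    have x: "x > 0" "log 2 x = log 2 c + real n * \<mu> + D ws"
      using log_prod[of ws n] False c by (auto simp: x_def P_def D_def log_mult_pos)
    have "log 2 (1 + x) \<le> 1 + max 0 (log 2 x)"
    proof (cases "x \<le> 1")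
      case True
      then have "log 2 (1 + x) \<le> log 2 2" using x by (subst log_le_cancel_iff) auto
      then show ?thesis by simp
    next
      case False
      then have "log 2 (1 + x) \<le> log 2 (2 * x)" using x by (subst log_le_cancel_iff) auto
      also have "\<dots> = 1 + log 2 x" using x by (simp add: log_mult_pos)
      finally show ?thesis by simp
    qed
    also have "max 0 (log 2 x) \<le> \<kappa> + \<bar>D ws\<bar>" using x c by auto
    \<comment> \<open>Arithmetic-geometric mean: the absolute deviation is traded for its square,
      with weights that make the variance term independent of \<open>n\<close>.\<close>
    also have "\<bar>D ws\<bar> \<le> \<eta> * real n + (D ws)\<^sup>2 / (4 * \<eta> * real n)"
    proof -
      have "0 \<le> (\<bar>D ws\<bar> - 2 * \<eta> * real n)\<^sup>2" by simp
      then have "4 * \<eta> * real n * \<bar>D ws\<bar> \<le> (D ws)\<^sup>2 + (2 * \<eta> * real n)\<^sup>2"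
        by (simp add: power2_diff mult.assoc mult.left_commute mult.commute)
      then have "\<bar>D ws\<bar> \<le> ((D ws)\<^sup>2 + (2 * \<eta> * real n)\<^sup>2) / (4 * \<eta> * real n)"
        using n \<eta> by (simp add: field_simps)
      also have "\<dots> = \<eta> * real n + (D ws)\<^sup>2 / (4 * \<eta> * real n)"
        using n \<eta> by (simp add: field_simps power2_eq_square)
      finally show ?thesis .
    qed
    finally show ?thesis using P0[of ws] unfolding x_def by (intro mult_left_mono) auto
  qed simp
  have tot: "(\<Sum>ws\<in>words UNIV n. P ws) = 1" unfolding P_def by (rule iid_total[OF p_sum centred])
  have var: "(\<Sum>ws\<in>words UNIV n. P ws * (D ws)\<^sup>2) = real n * \<sigma>"
    unfolding P_def D_def \<sigma>_def by (rule iid_variance[OF p_sum centred])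
  have "(\<Sum>ws\<in>words UNIV n. P ws * log 2 (1 + c * (\<Prod>i<n. f (ws ! i))))
    \<le> (\<Sum>ws\<in>words UNIV n. P ws * (1 + \<kappa> + \<eta> * real n + (D ws)\<^sup>2 / (4 * \<eta> * real n)))"
    by (intro sum_mono pt)
  also have "\<dots> = (\<Sum>ws\<in>words UNIV n. P ws) * (1 + \<kappa> + \<eta> * real n) + (\<Sum>ws\<in>words UNIV n. P ws * (D ws)\<^sup>2) / (4 * \<eta> * real n)"
    by (simp only: distrib_left[of "P _" "1 + \<kappa> + \<eta> * real n"] sum.distrib sum_distrib_right sum_divide_distrib times_divide_eq_right)
  also have "\<dots> = 1 + \<kappa> + \<eta> * real n + \<sigma> / (4 * \<eta>)" using n by (simp add: tot var)
  finally show ?thesis by (simp add: P_def)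
qed

lemma chebyshev:
  assumes n: "0 < n" and \<delta>: "0 < \<delta>"
  shows "(\<Sum>ws\<in>words UNIV n. (\<Prod>i<n. p (ws ! i)) * of_bool ((\<Prod>i<n. f (ws ! i)) \<le> 2 powr (real n * (\<mu> - \<delta>)))) \<le> \<sigma> / (real n * \<delta>\<^sup>2)"
proof -
  define P where "P ws = (\<Prod>i<n. p (ws ! i))" for ws
  define D where "D ws = (\<Sum>i<n. log 2 (f (ws ! i)) - \<mu>)" for ws
  have P0: "0 \<le> P ws" for ws unfolding P_def by (intro prod_nonneg) (simp add: p_nonneg)
  have pt: "P ws * of_bool ((\<Prod>i<n. f (ws ! i)) \<le> 2 powr (real n * (\<mu> - \<delta>))) \<le> P ws * ((D ws)\<^sup>2 / (real n * \<delta>)\<^sup>2)" for ws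
  proof (cases "P ws \<noteq> 0 \<and> (\<Prod>i<n. f (ws ! i)) \<le> 2 powr (real n * (\<mu> - \<delta>))")
    case True
    have "log 2 (\<Prod>i<n. f (ws ! i)) \<le> log 2 (2 powr (real n * (\<mu> - \<delta>)))"
      using True log_prod(1)[of ws n] by (subst log_le_cancel_iff) (auto simp: P_def)
    then have "real n * \<mu> + D ws \<le> real n * (\<mu> - \<delta>)"
      using True log_prod(2)[of ws n] by (simp add: P_def D_def)
    then have "real n * \<delta> \<le> - D ws" by (simp add: algebra_simps)
    then have "(real n * \<delta>)\<^sup>2 \<le> (- D ws)\<^sup>2" using n \<delta> by (intro power_mono) auto
    then have "1 \<le> (D ws)\<^sup>2 / (real n * \<delta>)\<^sup>2" using n \<delta> by simp
    then show ?thesis using True P0[of ws] by (intro mult_left_mono) auto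
  next
    case False
    then show ?thesis using P0[of ws] by auto
  qed
  have var: "(\<Sum>ws\<in>words UNIV n. P ws * (D ws)\<^sup>2) = real n * \<sigma>"
    unfolding P_def D_def \<sigma>_def by (rule iid_variance[OF p_sum centred])
  have "(\<Sum>ws\<in>words UNIV n. P ws * of_bool ((\<Prod>i<n. f (ws ! i)) \<le> 2 powr (real n * (\<mu> - \<delta>))))
    \<le> (\<Sum>ws\<in>words UNIV n. P ws * ((D ws)\<^sup>2 / (real n * \<delta>)\<^sup>2))"
    by (intro sum_mono pt)
  also have "\<dots> = real n * \<sigma> / (real n * \<delta>)\<^sup>2" by (simp add: var flip: sum_divide_distrib)
  also have "\<dots> = \<sigma> / (real n * \<delta>\<^sup>2)" using n \<delta> by (simp add: power2_eq_square)
  finally show ?thesis by (simp add: P_def)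
qed

end

section \<open>Single-letter quantities and block bounds\<close>

lemma sum_words_pair_prod:
  fixes p f :: "nat \<Rightarrow> 'a::finite \<times> 'b::finite \<Rightarrow> real"
  shows "(\<Sum>as\<in>words UNIV n. \<Sum>bs\<in>words UNIV n. (\<Prod>i<n. p i (as ! i, bs ! i)) * h (\<Prod>i<n. f i (as ! i, bs ! i)))
    = (\<Sum>w\<in>words UNIV n. (\<Prod>i<n. p i (w ! i)) * h (\<Prod>i<n. f i (w ! i)))"
proof -
  have "(\<Sum>as\<in>words UNIV n. \<Sum>bs\<in>words UNIV n. (\<Prod>i<n. p i (as ! i, bs ! i)) * h (\<Prod>i<n. f i (as ! i, bs ! i)))
    = (\<Sum>w\<in>words UNIV n. (\<Prod>i<n. p i (map fst w ! i, map snd w ! i)) * h (\<Prod>i<n. f i (map fst w ! i, map snd w ! i)))"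
    by (rule sum_words_pair)
  also have "\<dots> = (\<Sum>w\<in>words UNIV n. (\<Prod>i<n. p i (w ! i)) * h (\<Prod>i<n. f i (w ! i)))"
    by (intro sum.cong refl) (simp add: words_def)
  finally show ?thesis .
qed

lemma rate_size:
  assumes "0 \<le> r"
  shows "2 powr r \<le> real (nat \<lceil>2 powr r\<rceil>)" "real (nat \<lceil>2 powr r\<rceil>) \<le> 2 powr (r + 1)"
proof -
  have 1: "1 \<le> 2 powr r" using assms by (simp add: ge_one_powr_ge_zero)
  show "2 powr r \<le> real (nat \<lceil>2 powr r\<rceil>)" by linarith
  have "real (nat \<lceil>2 powr r\<rceil>) \<le> 2 powr r + 1" using 1 by linarith
  also have "\<dots> \<le> 2 powr (r + 1)" using 1 by (simp add: powr_add)
  finally show "real (nat \<lceil>2 powr r\<rceil>) \<le> 2 powr (r + 1)" .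
qed

lemma sum_pair: "(\<Sum>w\<in>UNIV. F w) = (\<Sum>a\<in>UNIV. \<Sum>b\<in>UNIV. F (a, b))"
  for F :: "'a::finite \<times> 'b::finite \<Rightarrow> real"
  by (simp add: UNIV_Times_UNIV[symmetric] sum.cartesian_product' del: UNIV_Times_UNIV)

locale wiretap_input =
  fixes ps :: "'s::finite \<Rightarrow> real" and W :: "'x::finite \<Rightarrow> 's \<Rightarrow> 'y::finite \<times> 'z::finite \<Rightarrow> real"
    and px :: "'t::finite \<Rightarrow> 's \<Rightarrow> 'x \<Rightarrow> real" and q :: "'t \<Rightarrow> real"
  assumes ps: "is_pmf ps" and W: "is_pmf (W x s)" and px: "is_pmf (px t s)" and q: "is_pmf q"
begin

abbreviation "v \<equiv> compose_channel px W"

definition usz where "usz t s z = (\<Sum>y\<in>UNIV. ps s * v t s (y, z))"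
definition uz where "uz t z = (\<Sum>s\<in>UNIV. usz t s z)"
definition usy where "usy t x = (\<Sum>z\<in>UNIV. ps (fst x) * v t (fst x) (snd x, z))"
definition qz where "qz z = (\<Sum>t\<in>UNIV. q t * uz t z)"
definition qsy where "qsy x = (\<Sum>t\<in>UNIV. q t * usy t x)"

text \<open>For \<open>T\<close> of law \<open>q\<close> independent of the state, \<open>IY\<close>
  is I(T;Y,S), \<open>IZ\<close> is I(T;Z) and \<open>HS\<close> is H(S|Z,T).\<close>

definition IY where "IY = (\<Sum>t\<in>UNIV. \<Sum>x\<in>UNIV. q t * usy t x * log 2 (usy t x / qsy x))"
definition IZ where "IZ = (\<Sum>t\<in>UNIV. \<Sum>z\<in>UNIV. q t * uz t z * log 2 (uz t z / qz z))"
definition HS where "HS = - (\<Sum>t\<in>UNIV. \<Sum>z\<in>UNIV. \<Sum>s\<in>UNIV. q t * usz t s z * log 2 (usz t s z / uz t z))"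

lemma v_nonneg: "0 \<le> v t s o'"
  unfolding compose_channel_def
  using W[unfolded is_pmf_def] px[unfolded is_pmf_def] by (intro sum_nonneg mult_nonneg_nonneg) blast+

lemma v_sum: "(\<Sum>y\<in>UNIV. \<Sum>z\<in>UNIV. v t s (y, z)) = 1"
proof -
  have "(\<Sum>y\<in>UNIV. \<Sum>z\<in>UNIV. v t s (y, z)) = (\<Sum>o'\<in>UNIV. v t s o')"
    by (simp add: sum.cartesian_product UNIV_Times_UNIV[symmetric] del: UNIV_Times_UNIV)
  also have "\<dots> = (\<Sum>x\<in>UNIV. px t s x * (\<Sum>o'\<in>UNIV. W x s o'))"
    unfolding compose_channel_def by (subst sum.swap) (simp only: sum_distrib_left)
  also have "\<dots> = 1" using W px by (simp add: is_pmf_def)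
  finally show ?thesis .
qed

lemma nonneg: "0 \<le> ps s" "0 \<le> q t" "0 \<le> usz t s z" "0 \<le> uz t z" "0 \<le> usy t x" "0 \<le> qz z" "0 \<le> qsy x"
  using ps q v_nonneg
  by (auto simp: is_pmf_def usz_def uz_def usy_def qz_def qsy_def intro!: sum_nonneg mult_nonneg_nonneg)

lemma sums: "(\<Sum>s\<in>UNIV. ps s) = 1" "(\<Sum>t\<in>UNIV. q t) = 1"
  using ps q by (auto simp: is_pmf_def)

lemma usy_sum: "(\<Sum>x\<in>UNIV. usy t x) = 1"
proof -
  have "(\<Sum>x\<in>UNIV. usy t x) = (\<Sum>s\<in>UNIV. ps s * (\<Sum>y\<in>UNIV. \<Sum>z\<in>UNIV. v t s (y, z)))"
    by (simp add: usy_def UNIV_Times_UNIV[symmetric] sum.cartesian_product' sum_distrib_left del: UNIV_Times_UNIV)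
  then show ?thesis by (simp add: v_sum sums)
qed

lemma usz_sum: "(\<Sum>z\<in>UNIV. \<Sum>s\<in>UNIV. usz t s z) = 1"
proof -
  have "(\<Sum>z\<in>UNIV. \<Sum>s\<in>UNIV. usz t s z) = (\<Sum>s\<in>UNIV. \<Sum>z\<in>UNIV. usz t s z)" by (rule sum.swap)
  also have "\<dots> = (\<Sum>s\<in>UNIV. ps s * (\<Sum>y\<in>UNIV. \<Sum>z\<in>UNIV. v t s (y, z)))"
    unfolding usz_def by (intro sum.cong refl) (subst sum.swap, simp only: sum_distrib_left)
  finally show ?thesis by (simp add: v_sum sums)
qed

lemma uz_sum: "(\<Sum>z\<in>UNIV. uz t z) = 1"
  by (simp add: uz_def usz_sum)

lemma qz_pos: "0 < q t * uz t z \<Longrightarrow> 0 < qz z"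
  unfolding qz_def using member_le_sum[where i = t and A = UNIV and f = "\<lambda>t. q t * uz t z"] nonneg
  by (simp add: less_le_trans)

lemma qsy_pos: "0 < q t * usy t x \<Longrightarrow> 0 < qsy x"
  unfolding qsy_def using member_le_sum[where i = t and A = UNIV and f = "\<lambda>t. q t * usy t x"] nonneg
  by (simp add: less_le_trans)

lemma uz_pos: "0 < usz t s z \<Longrightarrow> 0 < uz t z"
  unfolding uz_def using member_le_sum[where i = s and A = UNIV and f = "\<lambda>s. usz t s z"] nonneg
  by (simp add: less_le_trans)

text \<open>Three letter laws with likelihood ratios: the logarithms of \<open>fY\<close> and
  \<open>fZ\<close> are the information densities of Bob and Eve, that of \<open>fS\<close> is the
  log-posterior of the state.\<close>

definition pY where "pY w = q (fst w) * usy (fst w) (snd w)"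
definition fY where "fY w = usy (fst w) (snd w) / qsy (snd w)"
definition pZ where "pZ w = q (fst w) * uz (fst w) (snd w)"
definition fZ where "fZ w = uz (fst w) (snd w) / qz (snd w)"
definition pS where "pS w = q (fst w) * usz (fst w) (snd (snd w)) (fst (snd w))"
definition fS where "fS w = usz (fst w) (snd (snd w)) (fst (snd w)) / uz (fst w) (fst (snd w))"

lemma mult_pos_right: "0 < q t * c \<Longrightarrow> 0 \<le> c \<Longrightarrow> 0 < c"
  by (simp add: zero_less_mult_iff order_less_le)

sublocale Y: iid_ratio pY fY
proof
  show "0 \<le> pY w" for w by (simp add: pY_def nonneg)
  show "(\<Sum>w\<in>UNIV. pY w) = 1"
    by (subst sum_pair) (simp add: pY_def usy_sum sums flip: sum_distrib_left)
  show "0 < pY w \<Longrightarrow> 0 < fY w" for w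
    using mult_pos_right[of "fst w" "usy (fst w) (snd w)"] qsy_pos[of "fst w" "snd w"]
    by (simp add: pY_def fY_def nonneg)
qed

sublocale Z: iid_ratio pZ fZ
proof
  show "0 \<le> pZ w" for w by (simp add: pZ_def nonneg)
  show "(\<Sum>w\<in>UNIV. pZ w) = 1"
    by (subst sum_pair) (simp add: pZ_def uz_sum sums flip: sum_distrib_left)
  show "0 < pZ w \<Longrightarrow> 0 < fZ w" for w
    using mult_pos_right[of "fst w" "uz (fst w) (snd w)"] qz_pos[of "fst w" "snd w"]
    by (simp add: pZ_def fZ_def nonneg)
qed

sublocale S: iid_ratio pS fS
proof
  show "0 \<le> pS w" for w by (simp add: pS_def nonneg)
  show "(\<Sum>w\<in>UNIV. pS w) = 1"
    by (subst sum_pair, subst sum_pair) (simp add: pS_def usz_sum sums flip: sum_distrib_left)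
  show "0 < pS w \<Longrightarrow> 0 < fS w" for w
    using mult_pos_right[of "fst w" "usz (fst w) (snd (snd w)) (fst (snd w))"]
      uz_pos[of "fst w" "snd (snd w)" "fst (snd w)"]
    by (simp add: pS_def fS_def nonneg)
qed

lemma mus: "Y.\<mu> = IY" "Z.\<mu> = IZ" "S.\<mu> = - HS"
  unfolding Y.\<mu>_def Z.\<mu>_def S.\<mu>_def IY_def IZ_def HS_def
  by (simp_all add: sum_pair pY_def fY_def pZ_def fZ_def pS_def fS_def)

section \<open>Product laws over a block\<close>

definition qn :: "'t list \<Rightarrow> real" where "qn ts = (\<Prod>i<length ts. q (ts ! i))"
abbreviation "kern \<equiv> memoryless_law ps v"
definition Usz where "Usz n t s z = (\<Sum>y\<in>words UNIV n. kern t s y z)"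
definition Uz where "Uz n t z = (\<Sum>s\<in>words UNIV n. \<Sum>y\<in>words UNIV n. kern t s y z)"
definition Usy where "Usy n t x = (\<Sum>z\<in>words UNIV n. kern t (fst x) (snd x) z)"

lemma qn_nonneg: "0 \<le> qn ts" unfolding qn_def by (simp add: prod_nonneg nonneg)

lemma qn_n: "ts \<in> words UNIV n \<Longrightarrow> qn ts = (\<Prod>i<n. q (ts ! i))" by (simp add: qn_def words_def)

lemma qn_sum: "(\<Sum>ts\<in>words UNIV n. qn ts) = 1"
  by (simp add: qn_n sum_prod_words[of "\<lambda>_. q"] sums cong: sum.cong)

lemma kern_nonneg: "0 \<le> kern t s y z"
  unfolding memoryless_law_def by (intro prod_nonneg ballI mult_nonneg_nonneg nonneg v_nonneg)

lemma Usz_prod: "ss \<in> words UNIV n \<Longrightarrow> Usz n ts ss zs = (\<Prod>i<n. usz (ts ! i) (ss ! i) (zs ! i))"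
  unfolding Usz_def memoryless_law_def usz_def by (simp add: length_words sum_prod_words flip: sum_prod_words)

lemma Uz_prod: "Uz n ts zs = (\<Prod>i<n. uz (ts ! i) (zs ! i))"
proof -
  have "Uz n ts zs = (\<Sum>ss\<in>words UNIV n. \<Prod>i<n. usz (ts ! i) (ss ! i) (zs ! i))"
    unfolding Uz_def by (intro sum.cong refl) (simp add: Usz_prod flip: Usz_def)
  then show ?thesis by (simp add: sum_prod_words[of "\<lambda>i s. usz (ts ! i) s (zs ! i)"] uz_def)
qed

lemma Usy_prod: "ss \<in> words UNIV n \<Longrightarrow> Usy n ts (ss, ys) = (\<Prod>i<n. usy (ts ! i) (ss ! i, ys ! i))"
  unfolding Usy_def memoryless_law_def usy_def by (simp add: length_words sum_prod_words flip: sum_prod_words)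

lemma qn_Uz: "(\<Sum>ts\<in>words UNIV n. qn ts * Uz n ts zs) = (\<Prod>i<n. qz (zs ! i))"
proof -
  have "(\<Sum>ts\<in>words UNIV n. qn ts * Uz n ts zs) = (\<Sum>ts\<in>words UNIV n. \<Prod>i<n. q (ts ! i) * uz (ts ! i) (zs ! i))"
    by (intro sum.cong refl) (simp add: qn_n Uz_prod prod.distrib)
  then show ?thesis by (simp add: sum_prod_words[of "\<lambda>i t. q t * uz t (zs ! i)"] qz_def)
qed

lemma qn_Usy:
  assumes "ss \<in> words UNIV n"
  shows "(\<Sum>ts\<in>words UNIV n. qn ts * Usy n ts (ss, ys)) = (\<Prod>i<n. qsy (ss ! i, ys ! i))"
proof -
  have "(\<Sum>ts\<in>words UNIV n. qn ts * Usy n ts (ss, ys)) = (\<Sum>ts\<in>words UNIV n. \<Prod>i<n. q (ts ! i) * usy (ts ! i) (ss ! i, ys ! i))"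
    by (intro sum.cong refl) (simp add: qn_n Usy_prod[OF assms] prod.distrib)
  then show ?thesis by (simp add: sum_prod_words[of "\<lambda>i t. q t * usy t (ss ! i, ys ! i)"] qsy_def)
qed

lemma kern_sum: "t \<in> words UNIV n \<Longrightarrow> (\<Sum>s\<in>words UNIV n. \<Sum>y\<in>words UNIV n. \<Sum>z\<in>words UNIV n. kern t s y z) = 1"
proof -
  have "(\<Sum>s\<in>words UNIV n. \<Sum>y\<in>words UNIV n. \<Sum>z\<in>words UNIV n. kern t s y z)
    = (\<Sum>s\<in>words UNIV n. \<Sum>z\<in>words UNIV n. \<Sum>y\<in>words UNIV n. kern t s y z)"
    by (intro sum.cong refl sum.swap)
  also have "\<dots> = (\<Sum>z\<in>words UNIV n. Uz n t z)" unfolding Uz_def by (rule sum.swap)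
  also have "\<dots> = 1" by (simp add: Uz_prod sum_prod_words[of "\<lambda>i z. uz (t ! i) z"] uz_sum)
  finally show ?thesis .
qed

text \<open>At rate at least \<open>IZ\<close> the exponent inside the logarithm has nonpositive
  mean, so only fluctuations remain.\<close>

lemma covering_bound:
  assumes "0 < n" "0 < \<eta>" "0 < N" "real n * IZ \<le> log 2 N"
  shows "(\<Sum>t\<in>words UNIV n. qn t * (\<Sum>z\<in>words UNIV n. Uz n t z * log 2 (1 + Uz n t z / (N * (\<Sum>t\<in>words UNIV n. qn t * Uz n t z)))))
    \<le> 1 + \<eta> * real n + Z.\<sigma> / (4 * \<eta>)"
proof -
  have "(\<Sum>t\<in>words UNIV n. qn t * (\<Sum>z\<in>words UNIV n. Uz n t z * log 2 (1 + Uz n t z / (N * (\<Sum>t\<in>words UNIV n. qn t * Uz n t z)))))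
    = (\<Sum>t\<in>words UNIV n. \<Sum>z\<in>words UNIV n. (\<Prod>i<n. pZ (t ! i, z ! i)) * log 2 (1 + 1 / N * (\<Prod>i<n. fZ (t ! i, z ! i))))"
    unfolding sum_distrib_left qn_Uz
    by (intro sum.cong refl) (simp add: qn_n Uz_prod pZ_def fZ_def prod.distrib prod_dividef)
  also have "\<dots> = (\<Sum>w\<in>words UNIV n. (\<Prod>i<n. pZ (w ! i)) * log 2 (1 + 1 / N * (\<Prod>i<n. fZ (w ! i))))"
    by (rule sum_words_pair_prod[where p = "\<lambda>_. pZ" and f = "\<lambda>_. fZ" and h = "\<lambda>x. log 2 (1 + 1 / N * x)"])
  also have "\<dots> \<le> 1 + 0 + \<eta> * real n + Z.\<sigma> / (4 * \<eta>)"
    using assms by (intro Z.expected_log_one_plus) (auto simp: mus log_divide)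
  finally show ?thesis by simp
qed

text \<open>The 2 in the last hypothesis leaves room for rounding \<open>q2\<close> up and
  \<open>Kn\<close> down, one bit each.\<close>

lemma hash_bound:
  assumes "0 < n" "0 < \<eta>" "0 < N" "0 < K" "log 2 N - log 2 K \<le> real n * HS + 2"
  shows "(\<Sum>t\<in>words UNIV n. qn t * (\<Sum>z\<in>words UNIV n. \<Sum>s\<in>words UNIV n. Usz n t s z * log 2 (1 + N * (Usz n t s z / Uz n t z) / K)))
    \<le> 3 + \<eta> * real n + S.\<sigma> / (4 * \<eta>)"
proof -
  have "(\<Sum>t\<in>words UNIV n. qn t * (\<Sum>z\<in>words UNIV n. \<Sum>s\<in>words UNIV n. Usz n t s z * log 2 (1 + N * (Usz n t s z / Uz n t z) / K)))
    = (\<Sum>t\<in>words UNIV n. \<Sum>z\<in>words UNIV n. \<Sum>s\<in>words UNIV n. (\<Prod>i<n. pS (t ! i, z ! i, s ! i)) * log 2 (1 + N / K * (\<Prod>i<n. fS (t ! i, z ! i, s ! i))))"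
    unfolding sum_distrib_left
    by (intro sum.cong refl) (simp add: qn_n Usz_prod Uz_prod pS_def fS_def prod.distrib prod_dividef mult.commute)
  also have "\<dots> = (\<Sum>t\<in>words UNIV n. \<Sum>w\<in>words UNIV n. (\<Prod>i<n. pS (t ! i, w ! i)) * log 2 (1 + N / K * (\<Prod>i<n. fS (t ! i, w ! i))))"
    by (intro sum.cong refl
        sum_words_pair_prod[where p = "\<lambda>i w. pS (_ ! i, w)" and f = "\<lambda>i w. fS (_ ! i, w)" and h = "\<lambda>x. log 2 (1 + N / K * x)"])
  also have "\<dots> = (\<Sum>w\<in>words UNIV n. (\<Prod>i<n. pS (w ! i)) * log 2 (1 + N / K * (\<Prod>i<n. fS (w ! i))))"
    by (rule sum_words_pair_prod[where p = "\<lambda>_. pS" and f = "\<lambda>_. fS" and h = "\<lambda>x. log 2 (1 + N / K * x)"])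
  also have "\<dots> \<le> 1 + 2 + \<eta> * real n + S.\<sigma> / (4 * \<eta>)"
    using assms by (intro S.expected_log_one_plus) (auto simp: mus log_divide)
  finally show ?thesis by simp
qed

lemma decoding_bound:
  assumes "0 < n" "0 < \<delta>"
  shows "(\<Sum>t\<in>words UNIV n. qn t * (\<Sum>x\<in>words UNIV n \<times> words UNIV n. Usy n t x
      * of_bool (Usy n t x \<le> 2 powr (real n * (IY - \<delta>)) * (\<Sum>t\<in>words UNIV n. qn t * Usy n t x))))
    \<le> Y.\<sigma> / (real n * \<delta>\<^sup>2)"
proof -
  define \<gamma> where "\<gamma> = 2 powr (real n * (IY - \<delta>))"
  have "(\<Sum>t\<in>words UNIV n. qn t * (\<Sum>x\<in>words UNIV n \<times> words UNIV n. Usy n t x * of_bool (Usy n t x \<le> \<gamma> * (\<Sum>t\<in>words UNIV n. qn t * Usy n t x))))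
    = (\<Sum>t\<in>words UNIV n. \<Sum>s\<in>words UNIV n. \<Sum>y\<in>words UNIV n. qn t * (Usy n t (s, y) * of_bool (Usy n t (s, y) \<le> \<gamma> * (\<Sum>t\<in>words UNIV n. qn t * Usy n t (s, y)))))"
    by (simp only: sum.cartesian_product' sum_distrib_left)
  also have "\<dots> = (\<Sum>t\<in>words UNIV n. \<Sum>s\<in>words UNIV n. \<Sum>y\<in>words UNIV n. (\<Prod>i<n. pY (t ! i, s ! i, y ! i)) * of_bool ((\<Prod>i<n. fY (t ! i, s ! i, y ! i)) \<le> \<gamma>))"
  proof (intro sum.cong refl)
    fix t :: "'t list" and s :: "'s list" and y :: "'y list"
    assume tsy: "t \<in> words UNIV n" "s \<in> words UNIV n" "y \<in> words UNIV n"
    have P: "(\<Prod>i<n. pY (t ! i, s ! i, y ! i)) = qn t * Usy n t (s, y)"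
      using tsy by (simp add: pY_def qn_n Usy_prod prod.distrib)
    show "qn t * (Usy n t (s, y) * of_bool (Usy n t (s, y) \<le> \<gamma> * (\<Sum>t\<in>words UNIV n. qn t * Usy n t (s, y))))
      = (\<Prod>i<n. pY (t ! i, s ! i, y ! i)) * of_bool ((\<Prod>i<n. fY (t ! i, s ! i, y ! i)) \<le> \<gamma>)"
    proof (cases "(\<Prod>i<n. pY (t ! i, s ! i, y ! i)) = 0")
      case True
      then show ?thesis using P by auto
    next
      case False
      \<comment> \<open>Where the joint law has mass, the mean law is positive, and the test can be
        divided by it.\<close>
      have "0 < qsy (s ! i, y ! i)" if "i < n" for i
      proof (rule qsy_pos)
        have "pY (t ! i, s ! i, y ! i) \<noteq> 0" using False that by auto
        then show "0 < q (t ! i) * usy (t ! i) (s ! i, y ! i)"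
          using nonneg(2)[of "t ! i"] nonneg(5)[of "t ! i" "(s ! i, y ! i)"] by (simp add: pY_def)
      qed
      then have "0 < (\<Prod>i<n. qsy (s ! i, y ! i))" by (intro prod_pos) auto
      then have "Usy n t (s, y) \<le> \<gamma> * (\<Sum>t\<in>words UNIV n. qn t * Usy n t (s, y)) \<longleftrightarrow> (\<Prod>i<n. fY (t ! i, s ! i, y ! i)) \<le> \<gamma>"
        by (subst qn_Usy[OF tsy(2)]) (simp add: fY_def Usy_prod[OF tsy(2)] prod_dividef pos_divide_le_eq)
      then show ?thesis by (simp only: P mult.assoc)
    qed
  qed
  also have "\<dots> = (\<Sum>t\<in>words UNIV n. \<Sum>w\<in>words UNIV n. (\<Prod>i<n. pY (t ! i, w ! i)) * of_bool ((\<Prod>i<n. fY (t ! i, w ! i)) \<le> \<gamma>))"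
    by (intro sum.cong refl
        sum_words_pair_prod[where p = "\<lambda>i w. pY (_ ! i, w)" and f = "\<lambda>i w. fY (_ ! i, w)" and h = "\<lambda>x. of_bool (x \<le> \<gamma>)"])
  also have "\<dots> = (\<Sum>w\<in>words UNIV n. (\<Prod>i<n. pY (w ! i)) * of_bool ((\<Prod>i<n. fY (w ! i)) \<le> \<gamma>))"
    by (rule sum_words_pair_prod[where p = "\<lambda>_. pY" and f = "\<lambda>_. fY" and h = "\<lambda>x. of_bool (x \<le> \<gamma>)"])
  also have "\<dots> \<le> Y.\<sigma> / (real n * \<delta>\<^sup>2)"
    using Y.chebyshev[OF assms] by (simp only: \<gamma>_def mus)
  finally show ?thesis by (simp only: \<gamma>_def)
qed

end

section \<open>Achievable rates\<close>

context wiretap_input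
begin

lemma HS_nonneg: "0 \<le> HS"
proof -
  have "q t * usz t s z * log 2 (usz t s z / uz t z) \<le> 0" for t s z
  proof (cases "usz t s z = 0")
    case False
    then have u: "0 < usz t s z" using nonneg(3)[of t s z] by simp
    have "usz t s z \<le> uz t z"
      unfolding uz_def by (rule member_le_sum) (auto simp: nonneg)
    then have "log 2 (usz t s z / uz t z) \<le> 0" using u uz_pos[OF u] by simp
    then show ?thesis using u nonneg(2)[of t] by (simp add: mult_nonneg_nonpos)
  qed simp
  then show ?thesis unfolding HS_def by (simp add: sum_nonpos)
qed

text \<open>\<open>R1\<close> is the rate protected by covering, \<open>R2\<close> the rate
  protected by the pad and \<open>Rd\<close> that of the private index. \<open>key\<close> makes the
  hash nearly uniform, \<open>cover\<close> makes the groups indistinguishable, \<open>dec\<close>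
  lets Bob find the whole index.\<close>

lemma achievable:
  assumes R: "0 < R" "R = R1 + R2" "0 \<le> R1" "0 \<le> R2" "0 \<le> Rd" and Rf: "0 \<le> Rf"
    and key: "R2 \<le> HS + Rf" and cover: "R1 = 0 \<or> IZ \<le> R2 + Rd" and dec: "R + Rd < IY"
  shows "securely_achievable ps W Rf R"
  unfolding securely_achievable_def
proof (intro conjI allI impI)
  show "0 \<le> R" using R by simp
  fix \<epsilon> :: real assume \<epsilon>: "0 < \<epsilon>"
  \<comment> \<open>Half of the slack lowers the decoding threshold, the other half beats the number
    of codewords.\<close>
  define \<delta> where "\<delta> = (IY - R - Rd) / 2"
  have \<delta>: "0 < \<delta>" using dec by (simp add: \<delta>_def)
  \<comment> \<open>The parts of the covering and hash bounds linear in \<open>n\<close>, together 2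
    * \<eta> * n, then take up a quarter of \<epsilon> * R * n.\<close>
  define \<eta> where "\<eta> = \<epsilon> * R / 8"
  have \<eta>: "0 < \<eta>" using R \<epsilon> by (simp add: \<eta>_def)
  \<comment> \<open>The at most 2 n R bits exposed in the first block are then at most a quarter of
    \<epsilon> B n R.\<close>
  define B where "B = nat \<lceil>8 / \<epsilon>\<rceil>"
  have Be: "8 / \<epsilon> \<le> real B" by (simp add: B_def) linarith
  have B: "0 < B" using Be \<epsilon> by (metis divide_pos_pos of_nat_0_less_iff less_le_trans zero_less_numeral)
  \<comment> \<open>4 is the sum of the constants 1 and 3 in the covering and hash bounds.\<close>
  define K1 where "K1 = 4 + (Z.\<sigma> + S.\<sigma>) / (4 * \<eta>)"
  have K1: "0 < K1" unfolding K1_def using \<eta> Z.sigma_nonneg S.sigma_nonneg by (intro add_pos_nonneg) auto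
  \<comment> \<open>Lower bounds for \<open>n\<close>: \<open>a1\<close> limits the constant part of
    the leakage to 1/4, \<open>a2\<close> and \<open>a3\<close> limit the two error terms to 1/8
    each, and 1 / R absorbs the rounding of \<open>q2\<close>.\<close>
  define a1 where "a1 = 4 * K1 / (\<epsilon> * R)"
  define a2 where "a2 = 8 * real B * Y.\<sigma> / (\<epsilon> * \<delta>\<^sup>2)"
  define a3 where "a3 = 64 * real B / (\<epsilon> * \<delta> * ln 2)"
  have a0: "0 \<le> a1" "0 \<le> a2" "0 \<le> a3" "0 \<le> 1 / R"
    using K1 \<epsilon> R \<delta> Y.sigma_nonneg by (simp_all add: a1_def a2_def a3_def)
  obtain n :: nat where n': "1 / R + a1 + a2 + a3 + 1 \<le> real n" using real_arch_simple by blast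
  then have nb: "1 / R \<le> real n" "a1 \<le> real n" "a2 \<le> real n" "a3 \<le> real n" "1 \<le> real n"
    using a0 by linarith+
  have n: "0 < n" using nb(5) by simp
  define q1 q2 Dn where "q1 = nat \<lceil>2 powr (real n * R1)\<rceil>"
    and "q2 = nat \<lceil>2 powr (real n * R2)\<rceil>" and "Dn = nat \<lceil>2 powr (real n * Rd)\<rceil>"
  \<comment> \<open>Rounded down, unlike the other sizes, because the feedback budget bounds it from
    above.\<close>
  define Kn where "Kn = nat \<lfloor>2 powr (real n * Rf)\<rfloor>"
  define Mn where "Mn = num_messages (n * B) R"
  define \<gamma> where "\<gamma> = 2 powr (real n * (IY - \<delta>))"
  have s1: "2 powr (real n * R1) \<le> real q1" "real q1 \<le> 2 powr (real n * R1 + 1)"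
    and s2: "2 powr (real n * R2) \<le> real q2" "real q2 \<le> 2 powr (real n * R2 + 1)"
    and sD: "2 powr (real n * Rd) \<le> real Dn" "real Dn \<le> 2 powr (real n * Rd + 1)"
    unfolding q1_def q2_def Dn_def using R by (simp_all only: rate_size mult_nonneg_nonneg of_nat_0_le_iff)
  have pos: "0 < q1" "0 < q2" "0 < Dn"
    using s1(1) s2(1) sD(1) by (metis powr_gt_zero of_nat_0_less_iff less_le_trans zero_neq_numeral)+
  have f1: "1 \<le> 2 powr (real n * Rf)" using Rf by (simp add: ge_one_powr_ge_zero)
  have Kn1: "real Kn \<le> 2 powr (real n * Rf)" using f1 by (simp add: Kn_def)
  have Kn2: "2 powr (real n * Rf - 1) \<le> real Kn"
  proof -
    have "2 powr (real n * Rf - 1) = 2 powr (real n * Rf) / 2" by (simp add: powr_diff)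
    also have "\<dots> \<le> real_of_int \<lfloor>2 powr (real n * Rf)\<rfloor>"
    proof -
      have "1 \<le> \<lfloor>2 powr (real n * Rf)\<rfloor>" using f1 by (simp add: le_floor_iff)
      then have "1 \<le> real_of_int \<lfloor>2 powr (real n * Rf)\<rfloor>" by linarith
      then show ?thesis using floor_correct[of "2 powr (real n * Rf)"] by linarith
    qed
    finally show ?thesis using f1 by (simp add: Kn_def)
  qed
  have Kp: "0 < Kn" using Kn2 by (metis powr_gt_zero of_nat_0_less_iff less_le_trans zero_neq_numeral)
  have logK: "log 2 (real Kn) \<le> real n * Rf" "real n * Rf - 1 \<le> log 2 (real Kn)"
    using Kn1 Kn2 Kp by (simp_all add: log_le_iff le_log_iff)
  have logq2: "log 2 (real q2) \<le> real n * R2 + 1" "real n * R2 \<le> log 2 (real q2)"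
    using s2 pos by (simp_all add: log_le_iff le_log_iff)
  have logD: "real n * Rd \<le> log 2 (real Dn)" using sD pos by (simp add: le_log_iff)
  have nBR: "0 < real (n * B) * R" using n B R by simp
  have Mge: "2 powr (real (n * B) * R) \<le> real Mn" unfolding Mn_def num_messages_def by linarith
  have "1 < 2 powr (real (n * B) * R)" using nBR by simp
  then have M2: "2 \<le> Mn" using Mge by linarith
  have Mle: "Mn \<le> (q1 * q2) ^ B"
  proof -
    have "2 powr (real (n * B) * R) = (2 powr (real n * R1) * 2 powr (real n * R2)) ^ B"
      by (simp add: powr_add[symmetric] powr_powr powr_realpow[symmetric] R(2) algebra_simps)
    also have "\<dots> \<le> (real q1 * real q2) ^ B"
      using s1(1) s2(1) by (intro power_mono mult_mono) auto
    finally have "2 powr (real (n * B) * R) \<le> real_of_int (int ((q1 * q2) ^ B))" by simp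
    then have "\<lceil>2 powr (real (n * B) * R)\<rceil> \<le> int ((q1 * q2) ^ B)" by (simp only: ceiling_le_iff)
    then show ?thesis unfolding Mn_def num_messages_def by linarith
  qed
  define lM where "lM = log 2 (real Mn)"
  have lM: "real (n * B) * R \<le> lM" unfolding lM_def using Mge M2 by (simp add: le_log_iff)
  have lMp: "0 < lM" using lM nBR by linarith
  define SC where "SC = 1 + \<eta> * real n + Z.\<sigma> / (4 * \<eta>)"
  define LH where "LH = 3 + \<eta> * real n + S.\<sigma> / (4 * \<eta>)"
  define PE where "PE = Y.\<sigma> / (real n * \<delta>\<^sup>2)"
  have SC0: "0 \<le> SC" "0 \<le> LH" using \<eta> Z.sigma_nonneg S.sigma_nonneg by (simp_all add: SC_def LH_def)
  define c1 where "c1 = real B / \<epsilon>"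
  define c2 where "c2 = real B / (\<epsilon> * lM)"
  \<comment> \<open>What remains of the total budget 1 after the first block has been paid
    for.\<close>
  define c where "c = 1 - log 2 (real q2) / (\<epsilon> * lM)"
  have c12: "0 \<le> c1" "0 \<le> c2" using \<epsilon> lMp by (simp_all add: c1_def c2_def)
  \<comment> \<open>The factor 8 comes from three ceilings, each at most doubling a size.\<close>
  have sz: "real (q1 * q2 * Dn) / \<gamma> \<le> 8 * 2 powr (- (real n * \<delta>))"
  proof -
    have "real (q1 * q2 * Dn) \<le> 2 powr (real n * R1 + 1) * 2 powr (real n * R2 + 1) * 2 powr (real n * Rd + 1)"
      using s1 s2 sD by (auto intro!: mult_mono)
    also have "\<dots> = 8 * 2 powr (real n * (R + Rd))"
      by (simp add: powr_add R(2) algebra_simps)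
    finally have "real (q1 * q2 * Dn) / \<gamma> \<le> 8 * 2 powr (real n * (R + Rd)) / \<gamma>"
      by (intro divide_right_mono) (auto simp: \<gamma>_def)
    also have "\<dots> = 8 * 2 powr (real n * (R + Rd) - real n * (IY - \<delta>))"
      by (simp add: \<gamma>_def powr_diff)
    also have "real n * (R + Rd) - real n * (IY - \<delta>) = - (real n * \<delta>)"
      by (simp add: \<delta>_def field_simps)
    finally show ?thesis .
  qed
  have small_exp: "2 powr (- (real n * \<delta>)) \<le> 1 / (real n * \<delta> * ln 2)"
  proof -
    have "real n * \<delta> * ln 2 \<le> exp (real n * \<delta> * ln 2)" using exp_ge_add_one_self[of "real n * \<delta> * ln 2"] by linarith
    also have "\<dots> = 2 powr (real n * \<delta>)" by (simp add: powr_def mult.commute)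
    finally have "real n * \<delta> * ln 2 \<le> 2 powr (real n * \<delta>)" .
    then have "1 / 2 powr (real n * \<delta>) \<le> 1 / (real n * \<delta> * ln 2)"
      using n \<delta> by (intro divide_left_mono) auto
    then show ?thesis by (simp add: powr_minus_divide)
  qed
  have t1: "c1 * (PE + real (q1 * q2 * Dn) / \<gamma>) \<le> 1 / 4"
  proof -
    have "c1 * PE \<le> 1 / 8"
    proof -
      have "8 * real B * Y.\<sigma> \<le> real n * (\<epsilon> * \<delta>\<^sup>2)"
        using nb(3) \<epsilon> \<delta> by (simp add: a2_def pos_divide_le_eq)
      then show ?thesis using n \<epsilon> \<delta> by (simp add: c1_def PE_def field_simps)
    qed
    moreover have "c1 * (real (q1 * q2 * Dn) / \<gamma>) \<le> 1 / 8"
    proof -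
      have "c1 * (real (q1 * q2 * Dn) / \<gamma>) \<le> c1 * (8 * (1 / (real n * \<delta> * ln 2)))"
        using sz small_exp c12 by (intro mult_left_mono) auto
      also have "\<dots> \<le> 1 / 8"
      proof -
        have "64 * real B \<le> real n * (\<epsilon> * \<delta> * ln 2)"
          using nb(4) \<epsilon> \<delta> by (simp add: a3_def pos_divide_le_eq)
        then show ?thesis using n \<epsilon> \<delta> by (simp add: c1_def field_simps)
      qed
      finally show ?thesis .
    qed
    ultimately show ?thesis unfolding distrib_left by linarith
  qed
  have t2: "c2 * (SC + LH) \<le> 1 / 2"
  proof -
    have e: "SC + LH = 2 * \<eta> * real n + K1" by (simp add: SC_def LH_def K1_def add_divide_distrib)
    have "c2 * (SC + LH) \<le> real B / (\<epsilon> * (real (n * B) * R)) * (SC + LH)"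
      unfolding c2_def using SC0 lM nBR \<epsilon> by (intro mult_right_mono divide_left_mono mult_left_mono) auto
    also have "\<dots> = (SC + LH) / (\<epsilon> * R * real n)" using B by simp
    also have "\<dots> = 2 * \<eta> / (\<epsilon> * R) + K1 / (\<epsilon> * R * real n)"
      unfolding e using n by (simp add: add_divide_distrib)
    also have "2 * \<eta> / (\<epsilon> * R) = 1 / 4" using \<epsilon> R by (simp add: \<eta>_def)
    also have "K1 / (\<epsilon> * R * real n) \<le> 1 / 4"
    proof -
      have "4 * K1 \<le> real n * (\<epsilon> * R)" using nb(2) \<epsilon> R by (simp add: a1_def pos_divide_le_eq)
      then show ?thesis using n \<epsilon> R by (simp add: pos_divide_le_eq mult_ac)
    qed
    finally show ?thesis by simp
  qed
  have t3: "log 2 (real q2) / (\<epsilon> * lM) \<le> 1 / 4"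
  proof -
    have nR: "1 \<le> real n * R" using nb(1) R by (simp add: pos_divide_le_eq)
    have "real n * R2 \<le> real n * R" using R by (intro mult_left_mono) auto
    then have "log 2 (real q2) \<le> 2 * (real n * R)" using logq2(1) nR by linarith
    also have "\<dots> \<le> (\<epsilon> * real B / 4) * (real n * R)"
      using Be \<epsilon> nR by (intro mult_right_mono) (auto simp: field_simps)
    also have "\<dots> = \<epsilon> * (real (n * B) * R) / 4" by simp
    also have "\<dots> \<le> \<epsilon> * lM / 4" using lM \<epsilon> by (intro divide_right_mono mult_left_mono) auto
    finally show ?thesis using \<epsilon> lMp by (simp add: pos_divide_le_eq)
  qed
  have total: "c1 * (PE + real (q1 * q2 * Dn) / \<gamma>) + c2 * (SC + LH) \<le> c"
    using t1 t2 t3 unfolding c_def by linarith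
  have SCb: "q1 = 1 \<or> (\<Sum>t\<in>words UNIV n. qn t * (\<Sum>z\<in>words UNIV n. Uz n t z * log 2 (1 + Uz n t z
        / (real (q2 * Dn) * (\<Sum>t\<in>words UNIV n. qn t * Uz n t z))))) \<le> SC"
  proof (cases "R1 = 0")
    case True
    then show ?thesis by (simp add: q1_def)
  next
    case False
    then have "real n * IZ \<le> real n * (R2 + Rd)" using cover by (intro mult_left_mono) auto
    also have "\<dots> \<le> log 2 (real (q2 * Dn))"
      using logq2(2) logD pos by (simp add: log_mult_pos distrib_left)
    finally show ?thesis unfolding SC_def using n \<eta> pos by (intro disjI2 covering_bound) auto
  qed
  have LHb: "(\<Sum>t\<in>words UNIV n. qn t * (\<Sum>z\<in>words UNIV n. \<Sum>s\<in>words UNIV n. Usz n t s z * log 2 (1 + real q2 * (Usz n t s z / Uz n t z) / real Kn))) \<le> LH"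
  proof -
    have "real n * R2 \<le> real n * (HS + Rf)" using key by (intro mult_left_mono) auto
    then have "log 2 (real q2) - log 2 (real Kn) \<le> real n * HS + 2"
      using logq2(1) logK(2) by (simp add: distrib_left)
    then show ?thesis unfolding LH_def using n \<eta> pos Kp by (intro hash_bound) auto
  qed
  have PEb: "(\<Sum>t\<in>words UNIV n. qn t * (\<Sum>x\<in>words UNIV n \<times> words UNIV n. Usy n t x
      * of_bool (Usy n t x \<le> \<gamma> * (\<Sum>t\<in>words UNIV n. qn t * Usy n t x)))) \<le> PE"
    unfolding \<gamma>_def PE_def by (rule decoding_bound[OF n \<delta>])
  have Usy_eq: "(\<lambda>t (s, y). \<Sum>z\<in>words UNIV n. kern t s y z) = Usy n" by (auto simp: Usy_def fun_eq_iff)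
  have bnd: "c1 * ((\<Sum>t\<in>words UNIV n. qn t * (\<Sum>x\<in>words UNIV n \<times> words UNIV n. Usy n t x
      * of_bool (Usy n t x \<le> \<gamma> * (\<Sum>t\<in>words UNIV n. qn t * Usy n t x)))) + real (q1 * q2 * Dn) / \<gamma>)
     + c2 * (SC + (\<Sum>t\<in>words UNIV n. qn t * (\<Sum>z\<in>words UNIV n. \<Sum>s\<in>words UNIV n. Usz n t s z * log 2 (1 + real q2 * (Usz n t s z / Uz n t z) / real Kn)))) \<le> c"
  proof -
    have "c1 * ((\<Sum>t\<in>words UNIV n. qn t * (\<Sum>x\<in>words UNIV n \<times> words UNIV n. Usy n t x
      * of_bool (Usy n t x \<le> \<gamma> * (\<Sum>t\<in>words UNIV n. qn t * Usy n t x)))) + real (q1 * q2 * Dn) / \<gamma>)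
       \<le> c1 * (PE + real (q1 * q2 * Dn) / \<gamma>)" using PEb c12 by (intro mult_left_mono) auto
    moreover have "c2 * (SC + (\<Sum>t\<in>words UNIV n. qn t * (\<Sum>z\<in>words UNIV n. \<Sum>s\<in>words UNIV n. Usz n t s z * log 2 (1 + real q2 * (Usz n t s z / Uz n t z) / real Kn))))
       \<le> c2 * (SC + LH)" using LHb c12 by (intro mult_left_mono) auto
    ultimately show ?thesis using total by linarith
  qed
  have \<gamma>0: "0 < \<gamma>" by (simp add: \<gamma>_def)
  have "\<exists>C g \<delta>' Q. (\<forall>l. length (C l) = n) \<and> block_code n q1 q2 Dn Kn (\<lambda>l. kern (C l)) \<and>
     (\<forall>z. 0 \<le> Q z) \<and> (\<Sum>z\<in>words UNIV n. Q z) = 1 \<and>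
     (\<forall>l\<in>{..<q1} \<times> {..<q2} \<times> {..<Dn}. \<forall>z\<in>words UNIV n. Q z = 0 \<longrightarrow> block_code.Vz n (\<lambda>l. kern (C l)) l z = 0) \<and>
     c1 * block_code.index_error n q1 q2 Dn (\<lambda>l. kern (C l)) \<delta>'
      + c2 * (block_code.cover_leak n q1 q2 Dn (\<lambda>l. kern (C l)) Q + block_code.hash_leak n q1 q2 Dn Kn (\<lambda>l. kern (C l)) g) \<le> c"
    by (rule random_block_code[where q = qn and \<gamma> = \<gamma> and SC = SC and U = kern, OF pos Kp \<gamma>0 c12 qn_nonneg qn_sum kern_nonneg kern_sum
      SC0(1) SCb[unfolded Uz_def] bnd[unfolded Usz_def Uz_def Usy_eq[symmetric]]])
  then obtain C g \<delta>' Q where C: "\<And>l. length (C l) = n" and bc: "block_code n q1 q2 Dn Kn (\<lambda>l. kern (C l))"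
    and Q: "\<And>z. 0 \<le> Q z" "(\<Sum>z\<in>words UNIV n. Q z) = 1"
    and Q0: "\<And>l z. l \<in> {..<q1} \<times> {..<q2} \<times> {..<Dn} \<Longrightarrow> z \<in> words UNIV n \<Longrightarrow> Q z = 0 \<Longrightarrow> block_code.Vz n (\<lambda>l. kern (C l)) l z = 0"
    and le: "c1 * block_code.index_error n q1 q2 Dn (\<lambda>l. kern (C l)) \<delta>'
      + c2 * (block_code.cover_leak n q1 q2 Dn (\<lambda>l. kern (C l)) Q + block_code.hash_leak n q1 q2 Dn Kn (\<lambda>l. kern (C l)) g) \<le> c"
    by blast
  have small: "real B * block_code.index_error n q1 q2 Dn (\<lambda>l. kern (C l)) \<delta>' / \<epsilon>
     + (log 2 (real q2) + real B * (block_code.cover_leak n q1 q2 Dn (\<lambda>l. kern (C l)) Q + block_code.hash_leak n q1 q2 Dn Kn (\<lambda>l. kern (C l)) g))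
      / (\<epsilon> * log 2 (real Mn)) \<le> 1"
    using le by (simp add: c1_def c2_def c_def lM_def add_divide_distrib)
  have "\<exists>K fb enc (dec :: 'y list \<Rightarrow> 's list \<Rightarrow> nat list \<Rightarrow> nat).
        let \<Omega> = (code_outcomes (n * B) Mn K :: (nat \<times> 's list \<times> nat list \<times> 'x list \<times> 'y list \<times> 'z list) set);
            P = code_pmf ps W (n * B) Mn fb enc
        in valid_feedback Rf (n * B) K fb \<and> valid_encoder (n * B) enc \<and>
           prob_ev P \<Omega> (\<lambda>(m, ss, ks, xs, ys, zs). dec ys ss ks \<noteq> m) \<le> \<epsilon> \<and>
           centropy P \<Omega> (\<lambda>(m, ss, ks, xs, ys, zs). m) (\<lambda>(m, ss, ks, xs, ys, zs). zs)
             \<ge> (1 - \<epsilon>) * centropy P \<Omega> (\<lambda>(m, ss, ks, xs, ys, zs). m) (\<lambda>_. ())"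
    by (rule block_code.codes_from_blocks[OF bc px n B logK(1) C _ Q Q0 M2 Mle \<epsilon> small]) auto
  then show "\<exists>n>0. \<exists>K fb enc (dec :: 'y list \<Rightarrow> 's list \<Rightarrow> nat list \<Rightarrow> nat).
        let Mn = num_messages n R;
            \<Omega> = (code_outcomes n Mn K :: (nat \<times> 's list \<times> nat list \<times> 'x list \<times> 'y list \<times> 'z list) set);
            P = code_pmf ps W n Mn fb enc
        in valid_feedback Rf n K fb \<and> valid_encoder n enc \<and>
           prob_ev P \<Omega> (\<lambda>(m, ss, ks, xs, ys, zs). dec ys ss ks \<noteq> m) \<le> \<epsilon> \<and>
           centropy P \<Omega> (\<lambda>(m, ss, ks, xs, ys, zs). m) (\<lambda>(m, ss, ks, xs, ys, zs). zs)
             \<ge> (1 - \<epsilon>) * centropy P \<Omega> (\<lambda>(m, ss, ks, xs, ys, zs). m) (\<lambda>_. ())"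
    unfolding Mn_def Let_def using n B by (intro exI[of _ "n * B"] conjI) auto
qed

text \<open>Up to HS + Rf everything is padded. Above it the key rate is exhausted and
  \<open>Rd\<close> is the shortfall of (m2, d) to \<open>IZ\<close>, if any; R + Rd is then the
  larger of R and R - (HS + Rf) + IZ, both below \<open>IY\<close>.\<close>

lemma achievable_rates:
  assumes R: "0 < R" "R < IY" and Rf: "0 \<le> Rf" and key: "R \<le> HS + Rf \<or> R < IY - IZ + HS + Rf"
  shows "securely_achievable ps W Rf R"
proof (cases "R \<le> HS + Rf")
  case True
  then show ?thesis using R Rf by (intro achievable[of R 0 R 0]) auto
next
  case False
  then show ?thesis using R Rf key HS_nonneg
    by (intro achievable[of R "R - (HS + Rf)" "HS + Rf" "max 0 (IZ - (HS + Rf))"]) auto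
qed

end

section \<open>Rate zero\<close>

lemma centropy_constant:
  assumes "\<And>w. w \<in> A \<Longrightarrow> f w = c"
  shows "centropy P A f g = 0"
proof -
  have "prob_ev P A (\<lambda>v. f v = f w \<and> g v = g w) = prob_ev P A (\<lambda>v. g v = g w)" if "w \<in> A" for w
    using assms that unfolding prob_ev_def by (intro sum.cong) auto
  then have "P w * log 2 (prob_ev P A (\<lambda>v. f v = f w \<and> g v = g w) / prob_ev P A (\<lambda>v. g v = g w)) = 0" if "w \<in> A" for w
    using that by (simp add: log_def)
  then show ?thesis unfolding centropy_def neg_equal_0_iff_equal by (intro sum.neutral ballI)
qed

text \<open>There is a single message, of entropy 0, so secrecy reads 0 >= 0. This makes the
  supremum nonnegative, which settles bounds that are not positive.\<close>

lemma achievable_zero: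
  fixes ps :: "'s::finite \<Rightarrow> real" and W :: "'x::finite \<Rightarrow> 's \<Rightarrow> 'y::finite \<times> 'z::finite \<Rightarrow> real"
  assumes "0 \<le> Rf"
  shows "securely_achievable ps W Rf 0"
  unfolding securely_achievable_def
proof (intro conjI allI impI)
  fix \<epsilon> :: real assume "0 < \<epsilon>"
  define fb :: "nat \<Rightarrow> 'y list \<Rightarrow> nat list \<Rightarrow> nat \<Rightarrow> real" where "fb i ys ks k = of_bool (k = 0)" for i ys ks k
  define enc :: "nat \<Rightarrow> nat \<Rightarrow> 'x list \<Rightarrow> 's list \<Rightarrow> nat list \<Rightarrow> 'x \<Rightarrow> real" where "enc i m xs ss ks x = 1 / real CARD('x)" for i m xs ss ks x
  let ?\<Omega> = "code_outcomes 1 1 (\<lambda>_. 1) :: (nat \<times> 's list \<times> nat list \<times> 'x list \<times> 'y list \<times> 'z list) set"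
  let ?P = "code_pmf ps W 1 1 fb enc"
  have const: "(case w of (m, ss, ks, xs, ys, zs) \<Rightarrow> m) = 0" if "w \<in> ?\<Omega>" for w
    using that by (auto simp: code_outcomes_def)
  have "centropy ?P ?\<Omega> (\<lambda>(m, ss, ks, xs, ys, zs). m) (\<lambda>(m, ss, ks, xs, ys, zs). zs) = 0"
    "centropy ?P ?\<Omega> (\<lambda>(m, ss, ks, xs, ys, zs). m) (\<lambda>_. ()) = 0"
    by (rule centropy_constant[OF const], assumption)+
  moreover have "prob_ev ?P ?\<Omega> (\<lambda>(m, ss, ks, xs, ys, zs). 0 \<noteq> m) = 0"
    unfolding prob_ev_def by (intro sum.neutral) (auto simp: code_outcomes_def)
  moreover have "valid_feedback Rf 1 (\<lambda>_. 1) fb" using assms by (auto simp: valid_feedback_def fb_def)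
  moreover have "valid_encoder 1 enc" by (simp add: valid_encoder_def is_pmf_def enc_def)
  ultimately show "\<exists>n>0. \<exists>K fb enc (dec :: 'y list \<Rightarrow> 's list \<Rightarrow> nat list \<Rightarrow> nat).
        let Mn = num_messages n 0;
            \<Omega> = (code_outcomes n Mn K :: (nat \<times> 's list \<times> nat list \<times> 'x list \<times> 'y list \<times> 'z list) set);
            P = code_pmf ps W n Mn fb enc
        in valid_feedback Rf n K fb \<and> valid_encoder n enc \<and>
           prob_ev P \<Omega> (\<lambda>(m, ss, ks, xs, ys, zs). dec ys ss ks \<noteq> m) \<le> \<epsilon> \<and>
           centropy P \<Omega> (\<lambda>(m, ss, ks, xs, ys, zs). m) (\<lambda>(m, ss, ks, xs, ys, zs). zs)
             \<ge> (1 - \<epsilon>) * centropy P \<Omega> (\<lambda>(m, ss, ks, xs, ys, zs). m) (\<lambda>_. ())"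
    using \<open>0 < \<epsilon>\<close> unfolding Let_def
    by (intro exI[of _ 1] exI[of _ "\<lambda>_. 1"] exI[of _ fb] exI[of _ enc] exI[of _ "\<lambda>_ _ _. 0"] conjI)
      (simp_all add: num_messages_def)
qed simp

section \<open>Information quantities of the auxiliary variable\<close>

text \<open>Here \<open>U\<close> may depend on the state, unlike the input of
  \<open>wiretap_input\<close>; \<open>strategies\<close> translates between the two.\<close>

locale state_input =
  fixes ps :: "'s::finite \<Rightarrow> real" and W :: "'x::finite \<Rightarrow> 's \<Rightarrow> 'y::finite \<times> 'z::finite \<Rightarrow> real"
    and pu :: "'s \<Rightarrow> 'u::finite \<Rightarrow> real" and px :: "'u \<Rightarrow> 's \<Rightarrow> 'x \<Rightarrow> real"
  assumes ps: "is_pmf ps" and W: "is_pmf (W x s)" and pu: "is_pmf (pu s)" and px: "is_pmf (px u s)"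
begin

abbreviation "P \<equiv> sl_pmf ps pu px W"
abbreviation "c \<equiv> compose_channel px W"

definition cy where "cy u s y = (\<Sum>z\<in>UNIV. c u s (y, z))"
definition cz where "cz u s z = (\<Sum>y\<in>UNIV. c u s (y, z))"
definition my where "my s y = (\<Sum>u\<in>UNIV. pu s u * cy u s y)"
definition mz where "mz s z = (\<Sum>u\<in>UNIV. pu s u * cz u s z)"
definition pz where "pz z = (\<Sum>s\<in>UNIV. ps s * mz s z)"

lemma c_nonneg: "0 \<le> c u s o'"
  unfolding compose_channel_def
  using W[unfolded is_pmf_def] px[unfolded is_pmf_def] by (intro sum_nonneg mult_nonneg_nonneg) blast+

lemma nonneg: "0 \<le> ps s" "0 \<le> pu s u" "0 \<le> cy u s y" "0 \<le> cz u s z" "0 \<le> my s y" "0 \<le> mz s z" "0 \<le> pz z"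
  using ps pu c_nonneg
  by (auto simp: is_pmf_def cy_def cz_def my_def mz_def pz_def intro!: sum_nonneg mult_nonneg_nonneg)

lemma sums: "(\<Sum>s\<in>UNIV. ps s) = 1" "(\<Sum>u\<in>UNIV. pu s u) = 1"
  using ps pu by (auto simp: is_pmf_def)

lemma cy_sum: "(\<Sum>y\<in>UNIV. cy u s y) = 1"
proof -
  have "(\<Sum>y\<in>UNIV. cy u s y) = (\<Sum>o'\<in>UNIV. c u s o')" by (simp add: cy_def sum_pair)
  also have "\<dots> = (\<Sum>x\<in>UNIV. px u s x * (\<Sum>o'\<in>UNIV. W x s o'))"
    unfolding compose_channel_def by (subst sum.swap) (simp only: sum_distrib_left)
  also have "\<dots> = 1" using W px by (simp add: is_pmf_def)
  finally show ?thesis .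
qed

lemma expectation:
  "(\<Sum>w\<in>UNIV. P w * \<phi> (rvS w) (rvU w) (rvY w) (rvZ w))
    = (\<Sum>s\<in>UNIV. \<Sum>u\<in>UNIV. \<Sum>y\<in>UNIV. \<Sum>z\<in>UNIV. ps s * pu s u * c u s (y, z) * \<phi> s u y z)"
proof -
  have "(\<Sum>w\<in>UNIV. P w * \<phi> (rvS w) (rvU w) (rvY w) (rvZ w))
    = (\<Sum>s\<in>UNIV. \<Sum>u\<in>UNIV. \<Sum>x\<in>UNIV. \<Sum>y\<in>UNIV. \<Sum>z\<in>UNIV. ps s * pu s u * px u s x * W x s (y, z) * \<phi> s u y z)"
    by (simp add: sum_pair sl_pmf_def rvS_def rvU_def rvY_def rvZ_def)
  also have "\<dots> = (\<Sum>s\<in>UNIV. \<Sum>u\<in>UNIV. \<Sum>y\<in>UNIV. \<Sum>z\<in>UNIV. \<Sum>x\<in>UNIV. ps s * pu s u * px u s x * W x s (y, z) * \<phi> s u y z)"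
    by (simp only: sum.swap[of _ "UNIV :: 'y set" "UNIV :: 'x set"] sum.swap[of _ "UNIV :: 'z set" "UNIV :: 'x set"])
  also have "\<dots> = (\<Sum>s\<in>UNIV. \<Sum>u\<in>UNIV. \<Sum>y\<in>UNIV. \<Sum>z\<in>UNIV. ps s * pu s u * c u s (y, z) * \<phi> s u y z)"
    by (simp add: compose_channel_def sum_distrib_left sum_distrib_right mult.assoc)
  finally show ?thesis .
qed

lemma expectation_y:
  "(\<Sum>w\<in>UNIV. P w * \<phi> (rvS w) (rvU w) (rvY w))
    = (\<Sum>s\<in>UNIV. \<Sum>u\<in>UNIV. \<Sum>y\<in>UNIV. ps s * pu s u * cy u s y * \<phi> s u y)"
  using expectation[of "\<lambda>s u y z. \<phi> s u y"] by (simp add: cy_def sum_distrib_left sum_distrib_right)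

lemma expectation_z:
  "(\<Sum>w\<in>UNIV. P w * \<phi> (rvS w) (rvU w) (rvZ w))
    = (\<Sum>s\<in>UNIV. \<Sum>u\<in>UNIV. \<Sum>z\<in>UNIV. ps s * pu s u * cz u s z * \<phi> s u z)"
proof -
  have "(\<Sum>w\<in>UNIV. P w * \<phi> (rvS w) (rvU w) (rvZ w))
    = (\<Sum>s\<in>UNIV. \<Sum>u\<in>UNIV. \<Sum>y\<in>UNIV. \<Sum>z\<in>UNIV. ps s * pu s u * c u s (y, z) * \<phi> s u z)"
    by (rule expectation)
  also have "\<dots> = (\<Sum>s\<in>UNIV. \<Sum>u\<in>UNIV. \<Sum>z\<in>UNIV. \<Sum>y\<in>UNIV. ps s * pu s u * c u s (y, z) * \<phi> s u z)"
    by (intro sum.cong refl sum.swap)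
  finally show ?thesis by (simp add: cz_def sum_distrib_left sum_distrib_right)
qed

lemma delta: "(\<Sum>a\<in>UNIV. F a * of_bool (a = b)) = F b" "(\<Sum>a\<in>UNIV. F a * (of_bool (a = b) * k)) = F b * k"
  for F :: "'a::finite \<Rightarrow> real" and k :: real
proof -
  show 1: "(\<Sum>a\<in>UNIV. F a * of_bool (a = b)) = F b" for F :: "'a \<Rightarrow> real"
    by (simp add: of_bool_def if_distrib[of "\<lambda>x. _ * x"] cong: if_cong)
  show "(\<Sum>a\<in>UNIV. F a * (of_bool (a = b) * k)) = F b * k"
    using 1[of "\<lambda>a. F a * k"] by (simp add: mult_ac)
qed

section \<open>Marginals of the single-letter law\<close>

lemma prob_ev_UNIV: "prob_ev P UNIV E = (\<Sum>w\<in>UNIV. P w * of_bool (E w))"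
  unfolding prob_ev_def by (subst sum.inter_filter) (auto simp: of_bool_def intro!: sum.cong)

lemma prob_SUY: "prob_ev P UNIV (\<lambda>w. E (rvS w) (rvU w) (rvY w))
    = (\<Sum>s\<in>UNIV. \<Sum>u\<in>UNIV. \<Sum>y\<in>UNIV. ps s * pu s u * cy u s y * of_bool (E s u y))"
  unfolding prob_ev_UNIV by (rule expectation_y)

lemma prob_SUZ: "prob_ev P UNIV (\<lambda>w. E (rvS w) (rvU w) (rvZ w))
    = (\<Sum>s\<in>UNIV. \<Sum>u\<in>UNIV. \<Sum>z\<in>UNIV. ps s * pu s u * cz u s z * of_bool (E s u z))"
  unfolding prob_ev_UNIV by (rule expectation_z)

lemma reorder: 
  fixes F :: "'s \<Rightarrow> 'u \<Rightarrow> 'b::finite \<Rightarrow> real"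
  shows "(\<Sum>s\<in>UNIV. \<Sum>u\<in>UNIV. \<Sum>b\<in>UNIV. F s u b * (of_bool (s = s0) * h s u b)) = (\<Sum>u\<in>UNIV. \<Sum>b\<in>UNIV. F s0 u b * h s0 u b)"
proof -
  have "(\<Sum>s\<in>UNIV. \<Sum>u\<in>UNIV. \<Sum>b\<in>UNIV. F s u b * (of_bool (s = s0) * h s u b))
    = (\<Sum>s\<in>UNIV. (\<Sum>u\<in>UNIV. \<Sum>b\<in>UNIV. F s u b * h s u b) * of_bool (s = s0))"
    by (simp only: sum_distrib_left sum_distrib_right mult_ac)
  then show ?thesis by (simp only: delta)
qed

lemma reorder_u: 
  fixes F :: "'u \<Rightarrow> 'b::finite \<Rightarrow> real"
  shows "(\<Sum>u\<in>UNIV. \<Sum>b\<in>UNIV. F u b * (of_bool (u = u0) * h u b)) = (\<Sum>b\<in>UNIV. F u0 b * h u0 b)"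
proof -
  have "(\<Sum>u\<in>UNIV. \<Sum>b\<in>UNIV. F u b * (of_bool (u = u0) * h u b))
    = (\<Sum>u\<in>UNIV. (\<Sum>b\<in>UNIV. F u b * h u b) * of_bool (u = u0))"
    by (simp only: sum_distrib_left sum_distrib_right mult_ac)
  then show ?thesis by (simp only: delta)
qed

lemma probS: "prob_ev P UNIV (\<lambda>w. rvS w = s0) = ps s0"
proof -
  have "prob_ev P UNIV (\<lambda>w. rvS w = s0) = (\<Sum>s\<in>UNIV. \<Sum>u\<in>UNIV. \<Sum>y\<in>UNIV. ps s * pu s u * cy u s y * (of_bool (s = s0) * 1))"
    using prob_SUY[of "\<lambda>s u y. s = s0"] by simp
  also have "\<dots> = ps s0" unfolding reorder by (simp add: cy_sum sums flip: sum_distrib_left)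
  finally show ?thesis .
qed

lemma probUS: "prob_ev P UNIV (\<lambda>w. rvU w = u0 \<and> rvS w = s0) = ps s0 * pu s0 u0"
proof -
  have "prob_ev P UNIV (\<lambda>w. rvU w = u0 \<and> rvS w = s0)
    = (\<Sum>s\<in>UNIV. \<Sum>u\<in>UNIV. \<Sum>y\<in>UNIV. ps s * pu s u * cy u s y * (of_bool (s = s0) * (of_bool (u = u0) * 1)))"
    using prob_SUY[of "\<lambda>s u y. u = u0 \<and> s = s0"] by (simp add: of_bool_conj mult_ac)
  also have "\<dots> = ps s0 * pu s0 u0" unfolding reorder reorder_u by (simp add: cy_sum sums flip: sum_distrib_left)
  finally show ?thesis .
qed

lemma probUYS: "prob_ev P UNIV (\<lambda>w. rvU w = u0 \<and> (rvY w, rvS w) = (y0, s0)) = ps s0 * pu s0 u0 * cy u0 s0 y0"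
proof -
  have "prob_ev P UNIV (\<lambda>w. rvU w = u0 \<and> (rvY w, rvS w) = (y0, s0))
    = (\<Sum>s\<in>UNIV. \<Sum>u\<in>UNIV. \<Sum>y\<in>UNIV. ps s * pu s u * cy u s y * (of_bool (s = s0) * (of_bool (u = u0) * of_bool (y = y0))))"
    using prob_SUY[of "\<lambda>s u y. u = u0 \<and> (y, s) = (y0, s0)"] by (simp add: of_bool_conj mult_ac)
  also have "\<dots> = ps s0 * pu s0 u0 * cy u0 s0 y0" unfolding reorder reorder_u by (simp only: delta)
  finally show ?thesis .
qed

lemma probYS: "prob_ev P UNIV (\<lambda>w. (rvY w, rvS w) = (y0, s0)) = ps s0 * my s0 y0"
proof -
  have "prob_ev P UNIV (\<lambda>w. (rvY w, rvS w) = (y0, s0))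
    = (\<Sum>s\<in>UNIV. \<Sum>u\<in>UNIV. \<Sum>y\<in>UNIV. ps s * pu s u * cy u s y * (of_bool (s = s0) * of_bool (y = y0)))"
    using prob_SUY[of "\<lambda>s u y. (y, s) = (y0, s0)"] by (simp add: of_bool_conj mult_ac)
  also have "\<dots> = ps s0 * my s0 y0" unfolding reorder delta my_def by (simp add: sum_distrib_left mult.assoc)
  finally show ?thesis .
qed

lemma probUZS: "prob_ev P UNIV (\<lambda>w. rvU w = u0 \<and> (rvZ w, rvS w) = (z0, s0)) = ps s0 * pu s0 u0 * cz u0 s0 z0"
proof -
  have "prob_ev P UNIV (\<lambda>w. rvU w = u0 \<and> (rvZ w, rvS w) = (z0, s0))
    = (\<Sum>s\<in>UNIV. \<Sum>u\<in>UNIV. \<Sum>z\<in>UNIV. ps s * pu s u * cz u s z * (of_bool (s = s0) * (of_bool (u = u0) * of_bool (z = z0))))"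
    using prob_SUZ[of "\<lambda>s u z. u = u0 \<and> (z, s) = (z0, s0)"] by (simp add: of_bool_conj mult_ac)
  also have "\<dots> = ps s0 * pu s0 u0 * cz u0 s0 z0" unfolding reorder reorder_u by (simp only: delta)
  finally show ?thesis .
qed

lemma probZS: "prob_ev P UNIV (\<lambda>w. (rvZ w, rvS w) = (z0, s0)) = ps s0 * mz s0 z0"
proof -
  have "prob_ev P UNIV (\<lambda>w. (rvZ w, rvS w) = (z0, s0))
    = (\<Sum>s\<in>UNIV. \<Sum>u\<in>UNIV. \<Sum>z\<in>UNIV. ps s * pu s u * cz u s z * (of_bool (s = s0) * of_bool (z = z0)))"
    using prob_SUZ[of "\<lambda>s u z. (z, s) = (z0, s0)"] by (simp add: of_bool_conj mult_ac)
  also have "\<dots> = ps s0 * mz s0 z0" unfolding reorder delta mz_def by (simp add: sum_distrib_left mult.assoc)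
  finally show ?thesis .
qed

lemma probSZ: "prob_ev P UNIV (\<lambda>w. rvS w = s0 \<and> rvZ w = z0) = ps s0 * mz s0 z0"
  using probZS[of z0 s0] by (simp add: conj_commute)

lemma probZ: "prob_ev P UNIV (\<lambda>w. rvZ w = z0) = pz z0"
proof -
  have "prob_ev P UNIV (\<lambda>w. rvZ w = z0) = (\<Sum>s\<in>UNIV. \<Sum>u\<in>UNIV. \<Sum>z\<in>UNIV. ps s * pu s u * cz u s z * of_bool (z = z0))"
    using prob_SUZ[of "\<lambda>s u z. z = z0"] by simp
  also have "\<dots> = pz z0" unfolding delta pz_def mz_def by (simp add: sum_distrib_left mult.assoc)
  finally show ?thesis .
qed

lemma probZU: "prob_ev P UNIV (\<lambda>w. (rvZ w, rvU w) = (z0, u0)) = (\<Sum>s\<in>UNIV. ps s * pu s u0 * cz u0 s z0)"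
proof -
  have "prob_ev P UNIV (\<lambda>w. (rvZ w, rvU w) = (z0, u0))
    = (\<Sum>s\<in>UNIV. \<Sum>u\<in>UNIV. \<Sum>z\<in>UNIV. ps s * pu s u * cz u s z * (of_bool (u = u0) * of_bool (z = z0)))"
    using prob_SUZ[of "\<lambda>s u z. (z, u) = (z0, u0)"] by (simp add: of_bool_conj mult_ac)
  also have "\<dots> = (\<Sum>s\<in>UNIV. ps s * pu s u0 * cz u0 s z0)" unfolding reorder_u by (simp only: delta)
  finally show ?thesis .
qed

lemma probSZU: "prob_ev P UNIV (\<lambda>w. rvS w = s0 \<and> (rvZ w, rvU w) = (z0, u0)) = ps s0 * pu s0 u0 * cz u0 s0 z0"
  using probUZS[of u0 z0 s0] by (simp add: conj_ac)

lemma my_pos: "0 < pu s u \<Longrightarrow> 0 < cy u s y \<Longrightarrow> 0 < my s y"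
  unfolding my_def using member_le_sum[where i = u and A = UNIV and f = "\<lambda>u. pu s u * cy u s y"] nonneg
  by (smt (verit, best) UNIV_I finite mult_nonneg_nonneg mult_pos_pos)

lemma mz_pos: "0 < pu s u \<Longrightarrow> 0 < cz u s z \<Longrightarrow> 0 < mz s z"
  unfolding mz_def using member_le_sum[where i = u and A = UNIV and f = "\<lambda>u. pu s u * cz u s z"] nonneg
  by (smt (verit, best) UNIV_I finite mult_nonneg_nonneg mult_pos_pos)

lemma pz_pos: "0 < ps s \<Longrightarrow> 0 < mz s z \<Longrightarrow> 0 < pz z"
  unfolding pz_def using member_le_sum[where i = s and A = UNIV and f = "\<lambda>s. ps s * mz s z"] nonneg
  by (smt (verit, best) UNIV_I finite mult_nonneg_nonneg mult_pos_pos)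

text \<open>The same entropy expanded twice, with \<open>y\<close> or with \<open>z\<close> as an
  extra variable, to allow termwise subtraction from either conditional entropy.\<close>

lemma entropy_US: "centropy P UNIV rvU rvS
    = - (\<Sum>s\<in>UNIV. \<Sum>u\<in>UNIV. \<Sum>y\<in>UNIV. ps s * pu s u * cy u s y * log 2 (ps s * pu s u / ps s))"
    "centropy P UNIV rvU rvS
    = - (\<Sum>s\<in>UNIV. \<Sum>u\<in>UNIV. \<Sum>z\<in>UNIV. ps s * pu s u * cz u s z * log 2 (ps s * pu s u / ps s))"
  unfolding centropy_def probUS probS neg_equal_iff_equal
  by (rule expectation_y expectation_z)+

text \<open>The factor \<open>ps s\<close> stays in numerator and denominator to match
  \<open>usy\<close> and \<open>qsy\<close> of the strategy input.\<close>

lemma cminfo_Y: "cminfo P UNIV rvU rvY rvS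
    = (\<Sum>s\<in>UNIV. \<Sum>u\<in>UNIV. \<Sum>y\<in>UNIV. ps s * pu s u * cy u s y * log 2 (ps s * cy u s y / (ps s * my s y)))"
proof -
  have "centropy P UNIV rvU (\<lambda>w. (rvY w, rvS w))
    = - (\<Sum>s\<in>UNIV. \<Sum>u\<in>UNIV. \<Sum>y\<in>UNIV. ps s * pu s u * cy u s y * log 2 (ps s * pu s u * cy u s y / (ps s * my s y)))"
    unfolding centropy_def probUYS probYS neg_equal_iff_equal by (rule expectation_y)
  then have "cminfo P UNIV rvU rvY rvS = (\<Sum>s\<in>UNIV. \<Sum>u\<in>UNIV. \<Sum>y\<in>UNIV. 
      ps s * pu s u * cy u s y * log 2 (ps s * pu s u * cy u s y / (ps s * my s y)) - ps s * pu s u * cy u s y * log 2 (ps s * pu s u / ps s))"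
    unfolding cminfo_def entropy_US(1) by (simp add: sum_subtractf)
  also have "\<dots> = (\<Sum>s\<in>UNIV. \<Sum>u\<in>UNIV. \<Sum>y\<in>UNIV. ps s * pu s u * cy u s y * log 2 (ps s * cy u s y / (ps s * my s y)))"
  proof (intro sum.cong refl)
    fix s u y
    show "ps s * pu s u * cy u s y * log 2 (ps s * pu s u * cy u s y / (ps s * my s y)) - ps s * pu s u * cy u s y * log 2 (ps s * pu s u / ps s)
      = ps s * pu s u * cy u s y * log 2 (ps s * cy u s y / (ps s * my s y))"
    proof (cases "ps s * pu s u * cy u s y = 0")
      case False
      then have p: "0 < ps s" "0 < pu s u" "0 < cy u s y"
        using nonneg(1)[of s] nonneg(2)[of s u] nonneg(3)[of u s y] by auto
      have "0 < my s y" using p my_pos by blast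
      then have "log 2 (ps s * pu s u * cy u s y / (ps s * my s y)) = log 2 (ps s * pu s u / ps s) + log 2 (ps s * cy u s y / (ps s * my s y))"
        using p by (simp add: log_mult_pos log_divide_pos)
      then show ?thesis by (simp add: distrib_left)
    qed auto
  qed
  finally show ?thesis .
qed

text \<open>The three logarithms telescope and \<open>pu\<close> and \<open>mz\<close> cancel; the
  remaining ratio is the one that \<open>HS - IZ\<close> yields for a strategy input.\<close>

lemma eavesdropper_terms: "centropy P UNIV rvS rvZ - cminfo P UNIV rvU rvZ rvS
    = - (\<Sum>s\<in>UNIV. \<Sum>u\<in>UNIV. \<Sum>z\<in>UNIV. ps s * pu s u * cz u s z * log 2 (ps s * cz u s z / pz z))"
proof -
  have "centropy P UNIV rvU (\<lambda>w. (rvZ w, rvS w))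
    = - (\<Sum>s\<in>UNIV. \<Sum>u\<in>UNIV. \<Sum>z\<in>UNIV. ps s * pu s u * cz u s z * log 2 (ps s * pu s u * cz u s z / (ps s * mz s z)))"
    unfolding centropy_def probUZS probZS neg_equal_iff_equal by (rule expectation_z)
  moreover have "centropy P UNIV rvS rvZ
    = - (\<Sum>s\<in>UNIV. \<Sum>u\<in>UNIV. \<Sum>z\<in>UNIV. ps s * pu s u * cz u s z * log 2 (ps s * mz s z / pz z))"
    unfolding centropy_def probSZ probZ neg_equal_iff_equal by (rule expectation_z)
  ultimately have "centropy P UNIV rvS rvZ - cminfo P UNIV rvU rvZ rvS = - (\<Sum>s\<in>UNIV. \<Sum>u\<in>UNIV. \<Sum>z\<in>UNIV. 
      ps s * pu s u * cz u s z * log 2 (ps s * pu s u * cz u s z / (ps s * mz s z)) - ps s * pu s u * cz u s z * log 2 (ps s * pu s u / ps s)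
      + ps s * pu s u * cz u s z * log 2 (ps s * mz s z / pz z))"
    unfolding cminfo_def entropy_US(2) by (simp add: sum_subtractf sum.distrib)
  also have "\<dots> = - (\<Sum>s\<in>UNIV. \<Sum>u\<in>UNIV. \<Sum>z\<in>UNIV. ps s * pu s u * cz u s z * log 2 (ps s * cz u s z / pz z))"
  proof (intro arg_cong[where f = uminus] sum.cong refl)
    fix s u z
    show "ps s * pu s u * cz u s z * log 2 (ps s * pu s u * cz u s z / (ps s * mz s z)) - ps s * pu s u * cz u s z * log 2 (ps s * pu s u / ps s)
      + ps s * pu s u * cz u s z * log 2 (ps s * mz s z / pz z)
      = ps s * pu s u * cz u s z * log 2 (ps s * cz u s z / pz z)"
    proof (cases "ps s * pu s u * cz u s z = 0")
      case False
      then have p: "0 < ps s" "0 < pu s u" "0 < cz u s z"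
        using nonneg(1)[of s] nonneg(2)[of s u] nonneg(4)[of u s z] by auto
      have m: "0 < mz s z" using p mz_pos by blast
      have "0 < pz z" using p(1) m pz_pos by blast
      then have "log 2 (ps s * pu s u * cz u s z / (ps s * mz s z)) - log 2 (ps s * pu s u / ps s) + log 2 (ps s * mz s z / pz z) = log 2 (ps s * cz u s z / pz z)"
        using p m by (simp add: log_mult_pos log_divide_pos)
      then show ?thesis by (simp only: flip: distrib_left right_diff_distrib)
    qed auto
  qed
  finally show ?thesis .
qed

text \<open>\<open>dec t s\<close> is the letter that strategy \<open>t\<close> uses in state
  \<open>s\<close>, and \<open>marg\<close> fixes its law for each state. In \<open>HS - IZ\<close>
  the ratios usz / uz and uz / qz telescope, so \<open>uz t z\<close>, the one quantity that mixes
  several letters of a strategy, cancels; hence only this difference is determined, not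
  \<open>HS\<close>.\<close>

lemma strategies:
  fixes q :: "'t::finite \<Rightarrow> real" and dec :: "'t \<Rightarrow> 's \<Rightarrow> 'u"
  assumes q: "is_pmf q" and marg: "\<And>s F. (\<Sum>t\<in>UNIV. q t * F (dec t s)) = (\<Sum>u\<in>UNIV. pu s u * F u)"
  defines "px' \<equiv> \<lambda>t s. px (dec t s) s"
  shows "wiretap_input ps W px' q"
    and "wiretap_input.IY ps W px' q = cminfo P UNIV rvU rvY rvS"
    and "wiretap_input.HS ps W px' q - wiretap_input.IZ ps W px' q = centropy P UNIV rvS rvZ - cminfo P UNIV rvU rvZ rvS"
proof -
  show wi: "wiretap_input ps W px' q" by unfold_locales (auto simp: px'_def ps W px q)
  interpret wi: wiretap_input ps W px' q by (rule wi)
  have v: "wi.v t s o' = c (dec t s) s o'" for t s o' by (simp add: compose_channel_def px'_def)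
  have usz: "wi.usz t s z = ps s * cz (dec t s) s z" for t s z
    by (simp add: wi.usz_def v cz_def sum_distrib_left)
  have usy: "wi.usy t (s, y) = ps s * cy (dec t s) s y" for t s y
    by (simp add: wi.usy_def v cy_def sum_distrib_left)
  have qsy: "wi.qsy (s, y) = ps s * my s y" for s y
    using marg[of "\<lambda>u. ps s * cy u s y" s] by (simp add: wi.qsy_def usy my_def sum_distrib_left mult.left_commute)
  have qz: "wi.qz z = pz z" for z
  proof -
    have "wi.qz z = (\<Sum>s\<in>UNIV. \<Sum>t\<in>UNIV. q t * (ps s * cz (dec t s) s z))"
      unfolding wi.qz_def wi.uz_def usz sum_distrib_left by (rule sum.swap)
    also have "\<dots> = (\<Sum>s\<in>UNIV. \<Sum>u\<in>UNIV. pu s u * (ps s * cz u s z))"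
      by (intro sum.cong refl marg)
    finally show ?thesis by (simp add: pz_def mz_def sum_distrib_left mult.left_commute)
  qed
  have "wi.IY = (\<Sum>s\<in>UNIV. \<Sum>y\<in>UNIV. \<Sum>t\<in>UNIV. q t * (ps s * cy (dec t s) s y * log 2 (ps s * cy (dec t s) s y / (ps s * my s y))))"
    unfolding wi.IY_def
    by (simp only: sum_pair usy qsy mult.assoc sum.swap[of _ "UNIV :: 's set" "UNIV :: 't set"] sum.swap[of _ "UNIV :: 'y set" "UNIV :: 't set"])
  also have "\<dots> = (\<Sum>s\<in>UNIV. \<Sum>y\<in>UNIV. \<Sum>u\<in>UNIV. pu s u * (ps s * cy u s y * log 2 (ps s * cy u s y / (ps s * my s y))))"
    by (intro sum.cong refl) (rule marg[of "\<lambda>u. ps _ * cy u _ _ * log 2 (ps _ * cy u _ _ / (ps _ * my _ _))"])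
  also have "\<dots> = cminfo P UNIV rvU rvY rvS"
    unfolding cminfo_Y by (simp only: sum.swap[of _ "UNIV :: 'u set" "UNIV :: 'y set"] mult.assoc mult.left_commute)
  finally show "wi.IY = cminfo P UNIV rvU rvY rvS" .
  have "wi.HS - wi.IZ = - (\<Sum>t\<in>UNIV. \<Sum>z\<in>UNIV. \<Sum>s\<in>UNIV.
      q t * wi.usz t s z * log 2 (wi.usz t s z / wi.uz t z) + q t * wi.usz t s z * log 2 (wi.uz t z / wi.qz z))"
    unfolding wi.HS_def wi.IZ_def
    by (simp add: sum.distrib wi.uz_def[of _ _] sum_distrib_left sum_distrib_right)
  also have "\<dots> = - (\<Sum>t\<in>UNIV. \<Sum>z\<in>UNIV. \<Sum>s\<in>UNIV. q t * wi.usz t s z * log 2 (wi.usz t s z / wi.qz z))"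
  proof (intro arg_cong[where f = uminus] sum.cong refl)
    fix t z s
    show "q t * wi.usz t s z * log 2 (wi.usz t s z / wi.uz t z) + q t * wi.usz t s z * log 2 (wi.uz t z / wi.qz z)
      = q t * wi.usz t s z * log 2 (wi.usz t s z / wi.qz z)"
    proof (cases "q t * wi.usz t s z = 0")
      case False
      then have p: "0 < q t" "0 < wi.usz t s z" using wi.nonneg(2)[of t] wi.nonneg(3)[of t s z] by auto
      have u: "0 < wi.uz t z" using p(2) by (rule wi.uz_pos)
      have "0 < wi.qz z" using p(1) u by (intro wi.qz_pos[of t]) simp
      then have "log 2 (wi.usz t s z / wi.uz t z) + log 2 (wi.uz t z / wi.qz z) = log 2 (wi.usz t s z / wi.qz z)"
        using p u by (simp add: log_divide_pos)
      then show ?thesis by (simp only: flip: distrib_left)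
    qed auto
  qed
  also have "\<dots> = - (\<Sum>s\<in>UNIV. \<Sum>z\<in>UNIV. \<Sum>t\<in>UNIV. q t * (ps s * cz (dec t s) s z * log 2 (ps s * cz (dec t s) s z / pz z)))"
    by (simp only: usz qz mult.assoc sum.swap[of _ "UNIV :: 's set" "UNIV :: 'z set"] sum.swap[of _ "UNIV :: 's set" "UNIV :: 't set"]
        sum.swap[of _ "UNIV :: 'z set" "UNIV :: 't set"])
  also have "\<dots> = - (\<Sum>s\<in>UNIV. \<Sum>z\<in>UNIV. \<Sum>u\<in>UNIV. pu s u * (ps s * cz u s z * log 2 (ps s * cz u s z / pz z)))"
    by (intro arg_cong[where f = uminus] sum.cong refl) (rule marg[of "\<lambda>u. ps _ * cz u _ _ * log 2 (ps _ * cz u _ _ / pz _)"])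
  also have "\<dots> = centropy P UNIV rvS rvZ - cminfo P UNIV rvU rvZ rvS"
    unfolding eavesdropper_terms by (simp only: sum.swap[of _ "UNIV :: 'u set" "UNIV :: 'z set"] mult.assoc mult.left_commute)
  finally show "wi.HS - wi.IZ = centropy P UNIV rvS rvZ - cminfo P UNIV rvU rvZ rvS" .
qed

end

text \<open>Drawing the letters of different states independently gives a strategy that is
  independent of the state and has the prescribed conditional laws.\<close>

lemma product_marginal:
  fixes pu :: "'s::finite \<Rightarrow> 'u::finite \<Rightarrow> real"
  assumes pu: "\<And>s. is_pmf (pu s)"
  shows "is_pmf (\<lambda>t. \<Prod>s\<in>UNIV. pu s (t s))"
    and "(\<Sum>t\<in>UNIV. (\<Prod>s\<in>UNIV. pu s (t s)) * F (t s0)) = (\<Sum>u\<in>UNIV. pu s0 u * F u)"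
proof -
  have one: "(\<Sum>u\<in>UNIV. pu s u) = 1" for s using pu by (auto simp: is_pmf_def)
  show m: "(\<Sum>t\<in>UNIV. (\<Prod>s\<in>UNIV. pu s (t s)) * F (t s0)) = (\<Sum>u\<in>UNIV. pu s0 u * F u)" for F s0
  proof -
    have "(\<Sum>t\<in>UNIV. (\<Prod>s\<in>UNIV. pu s (t s)) * F (t s0)) = (\<Sum>t\<in>UNIV. \<Prod>s\<in>UNIV. pu s (t s) * (if s = s0 then F (t s0) else 1))"
      by (simp add: prod.distrib)
    also have "\<dots> = (\<Sum>t\<in>UNIV. \<Prod>s\<in>UNIV. pu s (t s) * (if s = s0 then F (t s) else 1))"
      by (intro sum.cong prod.cong refl) auto
    also have "\<dots> = (\<Prod>s\<in>UNIV. \<Sum>u\<in>UNIV. pu s u * (if s = s0 then F u else 1))"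
      using prod_sum_PiE[of "UNIV :: 's set" "\<lambda>_. UNIV :: 'u set" "\<lambda>s u. pu s u * (if s = s0 then F u else 1)"] by simp
    also have "\<dots> = (\<Prod>s\<in>UNIV. if s = s0 then \<Sum>u\<in>UNIV. pu s0 u * F u else 1)"
      by (intro prod.cong refl) (auto simp: one)
    also have "\<dots> = (\<Sum>u\<in>UNIV. pu s0 u * F u)" by simp
    finally show ?thesis .
  qed
  show "is_pmf (\<lambda>t. \<Prod>s\<in>UNIV. pu s (t s))"
    using m[of "\<lambda>_. 1" undefined] pu by (auto simp: is_pmf_def one prod_nonneg)
qed

text \<open>Only rates strictly below \<open>b\<close> are at hand, so \<open>b\<close> is reached
  by density; for \<open>b\<close> not positive, rate zero suffices.\<close>

lemma capacity_ge:
  assumes Rf: "0 \<le> Rf" and ach: "\<And>R. 0 < R \<Longrightarrow> R < b \<Longrightarrow> securely_achievable ps W Rf R"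
  shows "ereal b \<le> secrecy_capacity ps W Rf"
proof (cases "0 < b")
  case True
  show ?thesis
  proof (rule dense_le_bounded[of 0 "ereal b"])
    show "0 < ereal b" using True by simp
    fix w assume w: "0 < w" "w < ereal b"
    then obtain r where "w = ereal r" by (cases w) auto
    then show "w \<le> secrecy_capacity ps W Rf"
      using w ach[of r] unfolding secrecy_capacity_def by (intro Sup_upper) auto
  qed
next
  case False
  have "ereal 0 \<le> secrecy_capacity ps W Rf"
    unfolding secrecy_capacity_def using achievable_zero[OF Rf, of ps W] by (intro Sup_upper) auto
  then show ?thesis using False by (metis ereal_less_eq(3) linorder_not_less order_trans)
qed

text \<open>A maximum over input laws is a lower bound exactly when every single choice is, so both
  maxima appear as quantifiers, for an arbitrary finite alphabet of \<open>U\<close>.\<close>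

theorem theorem1:
  fixes ps :: "'s::finite \<Rightarrow> real"
    and W :: "'x::finite \<Rightarrow> 's \<Rightarrow> 'y::finite \<times> 'z::finite \<Rightarrow> real"
    and Rf :: real
  assumes "is_pmf ps"
    and "\<forall>x s. is_pmf (W x s)"
    and "0 \<le> Rf"
  shows "(\<forall>(pu :: 's \<Rightarrow> 'u::finite \<Rightarrow> real) (px :: 'u \<Rightarrow> 's \<Rightarrow> 'x \<Rightarrow> real).
           (\<forall>s. is_pmf (pu s)) \<and> (\<forall>u s. is_pmf (px u s)) \<longrightarrow>
           (let P = sl_pmf ps pu px W in
             ereal (min (cminfo P UNIV rvU rvY rvS - cminfo P UNIV rvU rvZ rvS
                           + centropy P UNIV rvS rvZ + Rf)
                        (cminfo P UNIV rvU rvY rvS))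
             \<le> secrecy_capacity ps W Rf))
       \<and> (\<forall>(qu :: 'u \<Rightarrow> real) (px :: 'u \<Rightarrow> 's \<Rightarrow> 'x \<Rightarrow> real).
           is_pmf qu \<and> (\<forall>u s. is_pmf (px u s)) \<longrightarrow>
           (let P = sl_pmf ps (\<lambda>s. qu) px W in
             ereal (min (centropy P UNIV rvS (\<lambda>w. (rvZ w, rvU w)) + Rf)
                        (cminfo P UNIV rvU rvY rvS))
             \<le> secrecy_capacity ps W Rf))"
proof (intro conjI allI impI)
  fix pu :: "'s \<Rightarrow> 'u \<Rightarrow> real" and px :: "'u \<Rightarrow> 's \<Rightarrow> 'x \<Rightarrow> real"
  assume "(\<forall>s. is_pmf (pu s)) \<and> (\<forall>u s. is_pmf (px u s))"
  then have pu: "\<And>s. is_pmf (pu s)" and px: "\<And>u s. is_pmf (px u s)" by auto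
  interpret state_input ps W pu px using assms pu px by unfold_locales auto
  \<comment> \<open>Strategies are the functions from states to letters, with the product
    law.\<close>
  note st = strategies[where q = "\<lambda>t. \<Prod>s\<in>UNIV. pu s (t s)" and dec = "\<lambda>t. t", OF product_marginal[OF pu]]
  show "let P = sl_pmf ps pu px W in
             ereal (min (cminfo P UNIV rvU rvY rvS - cminfo P UNIV rvU rvZ rvS
                           + centropy P UNIV rvS rvZ + Rf)
                        (cminfo P UNIV rvU rvY rvS))
             \<le> secrecy_capacity ps W Rf"
    unfolding Let_def using assms(3) st(2,3)
    by (intro capacity_ge wiretap_input.achievable_rates[OF st(1)]) auto
next
  fix qu :: "'u \<Rightarrow> real" and px :: "'u \<Rightarrow> 's \<Rightarrow> 'x \<Rightarrow> real"
  assume "is_pmf qu \<and> (\<forall>u s. is_pmf (px u s))"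
  then have qu: "is_pmf qu" and px: "\<And>u s. is_pmf (px u s)" by auto
  interpret state_input ps W "\<lambda>s. qu" px using assms qu px by unfold_locales auto
  \<comment> \<open>\<open>U\<close> is independent of the state and serves as the strategy that
    uses one letter in every state, so that \<open>HS\<close> becomes H(S|Z,U).\<close>
  note st = strategies[where q = qu and dec = "\<lambda>u s. u", OF qu refl]
  interpret wi: wiretap_input ps W px qu by (rule st(1))
  have HS: "wi.HS = centropy P UNIV rvS (\<lambda>w. (rvZ w, rvU w))"
  proof -
    have usz: "wi.usz u s z = ps s * cz u s z" for u s z by (simp add: wi.usz_def cz_def sum_distrib_left)
    have "centropy P UNIV rvS (\<lambda>w. (rvZ w, rvU w))
      = - (\<Sum>s\<in>UNIV. \<Sum>u\<in>UNIV. \<Sum>z\<in>UNIV. ps s * qu u * cz u s z * log 2 (ps s * qu u * cz u s z / (\<Sum>s\<in>UNIV. ps s * qu u * cz u s z)))"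
      unfolding centropy_def probSZU probZU neg_equal_iff_equal by (rule expectation_z)
    also have "\<dots> = - (\<Sum>s\<in>UNIV. \<Sum>u\<in>UNIV. \<Sum>z\<in>UNIV. qu u * wi.usz u s z * log 2 (wi.usz u s z / wi.uz u z))"
    proof (intro arg_cong[where f = uminus] sum.cong refl)
      fix s u z
      have "(\<Sum>s\<in>UNIV. ps s * qu u * cz u s z) = qu u * wi.uz u z"
        by (simp add: wi.uz_def usz sum_distrib_left mult_ac)
      then show "ps s * qu u * cz u s z * log 2 (ps s * qu u * cz u s z / (\<Sum>s\<in>UNIV. ps s * qu u * cz u s z))
        = qu u * wi.usz u s z * log 2 (wi.usz u s z / wi.uz u z)"
        by (cases "qu u = 0") (simp_all add: usz mult_ac)
    qed
    also have "\<dots> = wi.HS"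
      unfolding wi.HS_def
      by (simp only: sum.swap[of _ "UNIV :: 's set" "UNIV :: 'u set"] sum.swap[of _ "UNIV :: 's set" "UNIV :: 'z set"])
    finally show ?thesis by simp
  qed
  show "let P = sl_pmf ps (\<lambda>s. qu) px W in
             ereal (min (centropy P UNIV rvS (\<lambda>w. (rvZ w, rvU w)) + Rf)
                        (cminfo P UNIV rvU rvY rvS))
             \<le> secrecy_capacity ps W Rf"
    unfolding Let_def using assms(3) st(2) HS
    by (intro capacity_ge wi.achievable_rates) auto
qed

end
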